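(* Let $(\xi_t,X_\tau)$ be a cyclic-independent conjugate process and let $\mu$ be a diffraction of $(\xi_t)$. Assume that $\lim_{n\to\infty}n^{-1}\sum_{t=1}^n\xi_t=\mathbb{E}\xi_0$ in probability (in $M_1(\mathbb{R})$). Assume in addition that, for $1\le k\le p$, $$\frac1n\sum_{t=1}^nF_t(x)F_{t+k}(y)=\mathbb{E}\big[F_0(x)F_k(y)\big]+o_{\mathbb{P}}(1)\quad\text{in }L^2(\mu\otimes\mu)$$ (as functions of $(x,y)\in\mathbb{R}^2$, as $n\to\infty$). Then, as $n\to\infty$, (i) $\|\widehat R^\mu-R^\mu\|_{HS}=o_{\mathbb{P}}(1)$; (ii) $\sup_{j\in\mathbb{N}}|\widehat\theta_j-\theta_j|=o_{\mathbb{P}}(1)$. If moreover the nonzero eigenvalues of $R^\mu$ are all distinct, then (iii) $\|\widehat\psi_j-\psi_j\|=o_{\mathbb{P}}(1)$ for each $j$ such that $\theta_j>0$.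
   Context: Let $(\Omega,\mathscr{A},\mathbb{P})$ be a probability space and $M_1(\mathbb{R})$ the set of Borel probability measures on $\mathbb{R}$ with the topology of weak convergence (metrized by the Lévy–Prohorov metric). Standing assumption: $(\xi_t:t=0,1,\dots)$ is a (strictly) stationary sequence of random elements of $M_1(\mathbb{R})$. Put $\Xi:=\sigma(\xi_0,\xi_1,\dots)$. The baricenter $\mathbb{E}\xi_0$ is the unique element of $M_1(\mathbb{R})$ with $\mathbb{E}\int f\,d\xi_0=\int f\,d\mathbb{E}\xi_0$ for all continuous bounded $f$. Conjugate process: a pair $(\xi_t,X_\tau)$ where $(X_\tau:\tau\ge0)$ is a real-valued process such that for every Borel $B$, every $t=0,1,\dots$ and $\tau\in[t,t+1)$, $\mathbb{P}[X_\tau\in B\mid\Xi]=\xi_t(B)$ a.s. It is cyclic-independent if, conditionally on $\Xi$, the processes $(X_\tau:\tau\in[t,t+1))$, $t=0,1,\dots$, form an independent sequence. A finite Borel measure $\mu$ on $\mathbb{R}$ is a diffraction of $(\xi_t)$ if it is equivalent (mutually absolutely continuous) to Lebesgue measure on some interval containing the support of $\mathbb{E}\xi_0$; $\langle\cdot,\cdot\rangle$, $\|\cdot\|$ are the inner product and norm of $L^2(\mu)$. Put $F_t(x):=\xi_t(-\infty,x]$, $\mathbb{E}F_0(x):=\mathbb{E}\xi_0(-\infty,x]$, $C_k(x,y):=\mathrm{Cov}(F_0(x),F_k(y))$, and $C_k^\mu f(x):=\int C_k(x,y)f(y)\,\mu(dy)$ on $L^2(\mu)$. Fix an integer $p\ge1$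 (with $p<n$). $R^\mu$ is the integral operator on $L^2(\mu)$ with kernel $R_\mu(x,y):=\sum_{k=1}^p\int C_k(x,z)C_k(y,z)\,\mu(dz)$; $(\theta_j:j\in\mathbb{N})$ is the non-increasing sequence of its eigenvalues (with multiplicity; it contains zeros if and only if $R^\mu$ has finite rank), with $L^2(\mu)$-orthonormal eigenfunctions $\psi_j$, $R^\mu\psi_j=\theta_j\psi_j$. Standing assumption: $\overline{\mathrm{Ran}(R^\mu)}=\overline{\mathrm{Ran}(C_0^\mu)}$. Sampling and estimators: in each cycle $t$ one observes $X_{1t},\dots,X_{q_t,t}$ ($q_t\ge1$), values $X_\tau$ at $q_t$ times $\tau\in[t,t+1)$. Put $\widehat F_t(x):=\frac1{q_t}\sum_{i=1}^{q_t}\mathbb{I}_{[X_{it}\le x]}$, $\widehat{\mathbb{E}}F_0(x):=\frac1n\sum_{t=1}^n\widehat F_t(x)$, $$\widehat C_k(x,y):=\frac1{n-p}\sum_{t=1}^{n-p}\big(\widehat F_t(x)-\widehat{\mathbb{E}}F_0(x)\big)\big(\widehat F_{t+k}(y)-\widehat{\mathbb{E}}F_0(y)\big),\qquad \widehat R_\mu(x,y):=\sum_{k=1}^p\int\widehat C_k(x,z)\widehat C_k(y,z)\,\mu(dz).$$ $\widehat R^\mu$ is the (finite-rank) integral operator on $L^2(\mu)$ with kernel $\widehat R_\mu$, with non-increasing sequence of eigenvalues $(\widehat\theta_j:j\in\mathbb{N})$ (with multiplicity, continued by zeros) and $L^2(\mu)$-orthonormal eigenfunctions $\widehat\psi_j$,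 $\widehat R^\mu\widehat\psi_j=\widehat\theta_j\widehat\psi_j$. Since eigenfunctions are determined only up to sign, the sign of $\psi_j$ is understood to be correctly matched to that of $\widehat\psi_j$ (e.g. $\langle\widehat\psi_j,\psi_j\rangle\ge0$). $\|\cdot\|_{HS}$ is the Hilbert–Schmidt norm, i.e. the $L^2(\mu\otimes\mu)$ norm of the kernel. *)

theory Defs
  imports "HOL-Probability.Probability"
begin

text \<open>
  Random elements of the space of Borel probability measures on the line are measurable maps into
  \<^term>\<open>prob_algebra borel :: real measure measure\<close>. Its sigma-algebra is generated by the
  evaluations \<open>\<nu> \<mapsto> \<nu>(B)\<close>; on the line this is the Borel sigma-algebra of the weak topology.
\<close>

definition strictly_stationary :: "'a measure \<Rightarrow> 'b measure \<Rightarrow> (nat \<Rightarrow> 'a \<Rightarrow> 'b) \<Rightarrow> bool" where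
  "strictly_stationary M N \<xi> \<longleftrightarrow>
    (\<forall>h. distr M (PiM UNIV (\<lambda>_. N)) (\<lambda>\<omega> t. \<xi> (t + h) \<omega>)
       = distr M (PiM UNIV (\<lambda>_. N)) (\<lambda>\<omega> t. \<xi> t \<omega>))"

definition generated_sigma :: "'a measure \<Rightarrow> 'b measure \<Rightarrow> (nat \<Rightarrow> 'a \<Rightarrow> 'b) \<Rightarrow> 'a measure" where
  "generated_sigma M N \<xi> = sigma (space M) {\<xi> t -` A \<inter> space M | t A. A \<in> sets N}"

definition baricenter :: "'a measure \<Rightarrow> ('a \<Rightarrow> real measure) \<Rightarrow> real measure" where
  "baricenter M \<zeta> = (THE \<nu>. \<nu> \<in> space (prob_algebra borel) \<and>
     (\<forall>f :: real \<Rightarrow> real. continuous_on UNIV f \<longrightarrow> bounded (range f) \<longrightarrow>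
        (\<integral>\<omega>. (\<integral>x. f x \<partial>\<zeta> \<omega>) \<partial>M) = (\<integral>x. f x \<partial>\<nu>)))"

definition mean_measure :: "nat \<Rightarrow> (nat \<Rightarrow> real measure) \<Rightarrow> real measure" where
  "mean_measure n \<nu> =
    measure_of UNIV (sets borel) (\<lambda>B. (\<Sum>t=1..n. emeasure (\<nu> t) B) / of_nat n)"

definition levy_prohorov :: "real measure \<Rightarrow> real measure \<Rightarrow> real" where
  "levy_prohorov \<nu> \<kappa> = Inf {e. 0 < e \<and> (\<forall>A\<in>sets borel.
      measure \<nu> A \<le> measure \<kappa> (\<Union>a\<in>A. ball a e) + e \<and>
      measure \<kappa> A \<le> measure \<nu> (\<Union>a\<in>A. ball a e) + e)}"

definition measure_support :: "real measure \<Rightarrow> real set" where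
  "measure_support \<nu> = {x. \<forall>U. open U \<longrightarrow> x \<in> U \<longrightarrow> emeasure \<nu> U > 0}"

text \<open>
  Convergence to zero in probability. The exceedance sets are covered by events, i.e. outer
  probability is used: \<^const>\<open>measure\<close> returns 0 on non-measurable sets, so that the naive
  formulation would hold vacuously for non-measurable quantities. For random variables the two
  notions agree.
\<close>

definition tendsto_zero_in_prob :: "'a measure \<Rightarrow> (nat \<Rightarrow> 'a \<Rightarrow> real) \<Rightarrow> bool" where
  "tendsto_zero_in_prob M Z \<longleftrightarrow> (\<forall>\<epsilon>>0. \<exists>A.
      (\<forall>n. A n \<in> sets M \<and> {\<omega> \<in> space M. \<epsilon> \<le> \<bar>Z n \<omega>\<bar>} \<subseteq> A n) \<and>
      (\<lambda>n. measure M (A n)) \<longlonglongrightarrow> 0)"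

definition conjugate_process ::
    "'a measure \<Rightarrow> (nat \<Rightarrow> 'a \<Rightarrow> real measure) \<Rightarrow> (real \<Rightarrow> 'a \<Rightarrow> real) \<Rightarrow> bool" where
  "conjugate_process M \<xi> X \<longleftrightarrow>
    (\<forall>\<tau>\<ge>0. X \<tau> \<in> borel_measurable M) \<and>
    (\<forall>B\<in>sets borel. \<forall>t. \<forall>\<tau>\<in>{real t..<real t + 1}. AE \<omega> in M.
       real_cond_exp M (generated_sigma M (prob_algebra borel) \<xi>) (indicator (X \<tau> -` B \<inter> space M)) \<omega>
       = measure (\<xi> t \<omega>) B)"

text \<open>The conditional counterpart of \<^const>\<open>prob_space.indep_vars\<close>, given a sub-sigma-algebra \<open>G\<close>.\<close>

definition cond_indep_vars ::
    "'a measure \<Rightarrow> 'a measure \<Rightarrow> ('i \<Rightarrow> 'b measure) \<Rightarrow> ('i \<Rightarrow> 'a \<Rightarrow> 'b) \<Rightarrow> 'i set \<Rightarrow> bool" where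
  "cond_indep_vars M G N Y I \<longleftrightarrow>
    (\<forall>i\<in>I. Y i \<in> measurable M (N i)) \<and>
    (\<forall>J\<subseteq>I. J \<noteq> {} \<longrightarrow> finite J \<longrightarrow> (\<forall>A\<in>Pi J (\<lambda>j. sets (N j)). AE \<omega> in M.
       real_cond_exp M G (indicator (\<Inter>j\<in>J. Y j -` A j \<inter> space M)) \<omega>
       = (\<Prod>j\<in>J. real_cond_exp M G (indicator (Y j -` A j \<inter> space M)) \<omega>)))"

definition cyclic_independent ::
    "'a measure \<Rightarrow> (nat \<Rightarrow> 'a \<Rightarrow> real measure) \<Rightarrow> (real \<Rightarrow> 'a \<Rightarrow> real) \<Rightarrow> bool" where
  "cyclic_independent M \<xi> X \<longleftrightarrow>
    cond_indep_vars M (generated_sigma M (prob_algebra borel) \<xi>)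
      (\<lambda>t::nat. PiM {real t..<real t + 1} (\<lambda>_. borel))
      (\<lambda>t \<omega>. \<lambda>\<tau>\<in>{real t..<real t + 1}. X \<tau> \<omega>) UNIV"

text \<open>Elements of \<open>L\<^sup>2(\<mu>)\<close> are represented by functions; equality in \<open>L\<^sup>2(\<mu>)\<close> is equality a.e.\<close>

definition L2 :: "'b measure \<Rightarrow> ('b \<Rightarrow> real) set" where
  "L2 \<mu> = {f \<in> borel_measurable \<mu>. integrable \<mu> (\<lambda>x. (f x)\<^sup>2)}"

definition L2_inner :: "'b measure \<Rightarrow> ('b \<Rightarrow> real) \<Rightarrow> ('b \<Rightarrow> real) \<Rightarrow> real" where
  "L2_inner \<mu> f g = (\<integral>x. f x * g x \<partial>\<mu>)"

definition L2_norm :: "'b measure \<Rightarrow> ('b \<Rightarrow> real) \<Rightarrow> real" where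
  "L2_norm \<mu> f = sqrt (L2_inner \<mu> f f)"

definition integral_operator ::
    "'b measure \<Rightarrow> ('b \<Rightarrow> 'b \<Rightarrow> real) \<Rightarrow> ('b \<Rightarrow> real) \<Rightarrow> 'b \<Rightarrow> real" where
  "integral_operator \<mu> K f x = (\<integral>y. K x y * f y \<partial>\<mu>)"

definition HS_norm :: "'b measure \<Rightarrow> ('b \<Rightarrow> 'b \<Rightarrow> real) \<Rightarrow> real" where
  "HS_norm \<mu> K = L2_norm (\<mu> \<Otimes>\<^sub>M \<mu>) (\<lambda>(x, y). K x y)"

definition closure_range :: "'b measure \<Rightarrow> ('b \<Rightarrow> 'b \<Rightarrow> real) \<Rightarrow> ('b \<Rightarrow> real) set" where
  "closure_range \<mu> K = {g \<in> L2 \<mu>. \<forall>\<epsilon>>0. \<exists>f\<in>L2 \<mu>.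
      L2_norm \<mu> (\<lambda>x. g x - integral_operator \<mu> K f x) < \<epsilon>}"

text \<open>
  Eigenvalues, in non-increasing order and with multiplicity, and orthonormal eigenfunctions of the
  integral operator with a (symmetric, nonnegative definite) kernel \<open>K\<close>. The last clause states
  that for every \<open>c \<noteq> 0\<close> the \<open>\<psi> j\<close> with \<open>\<theta> j = c\<close> span the eigenspace of \<open>c\<close>, so every nonzero
  eigenvalue is listed, and as often as its multiplicity. A Hilbert-Schmidt operator has finitely
  many eigenvalues (with multiplicity) above any positive threshold, so zeros occur in \<open>\<theta>\<close> if and
  only if the operator has finite rank.
\<close>

definition eigensystem ::
    "'b measure \<Rightarrow> ('b \<Rightarrow> 'b \<Rightarrow> real) \<Rightarrow> (nat \<Rightarrow> real) \<Rightarrow> (nat \<Rightarrow> 'b \<Rightarrow> real) \<Rightarrow> bool" where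
  "eigensystem \<mu> K \<theta> \<psi> \<longleftrightarrow>
    decseq \<theta> \<and>
    (\<forall>j. \<psi> j \<in> L2 \<mu>) \<and>
    (\<forall>i j. L2_inner \<mu> (\<psi> i) (\<psi> j) = (if i = j then 1 else 0)) \<and>
    (\<forall>j. AE x in \<mu>. integral_operator \<mu> K (\<psi> j) x = \<theta> j * \<psi> j x) \<and>
    (\<forall>c f. c \<noteq> 0 \<longrightarrow> f \<in> L2 \<mu> \<longrightarrow> (AE x in \<mu>. integral_operator \<mu> K f x = c * f x) \<longrightarrow>
       (\<forall>j. \<theta> j = c \<longrightarrow> L2_inner \<mu> f (\<psi> j) = 0) \<longrightarrow> (AE x in \<mu>. f x = 0))"

definition covariance :: "'a measure \<Rightarrow> ('a \<Rightarrow> real) \<Rightarrow> ('a \<Rightarrow> real) \<Rightarrow> real" where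
  "covariance M U V = (\<integral>\<omega>. (U \<omega> - (\<integral>\<omega>. U \<omega> \<partial>M)) * (V \<omega> - (\<integral>\<omega>. V \<omega> \<partial>M)) \<partial>M)"

definition is_diffraction :: "'a measure \<Rightarrow> (nat \<Rightarrow> 'a \<Rightarrow> real measure) \<Rightarrow> real measure \<Rightarrow> bool" where
  "is_diffraction M \<xi> \<mu> \<longleftrightarrow>
    finite_measure \<mu> \<and> sets \<mu> = sets borel \<and>
    (\<exists>I. is_interval I \<and> measure_support (baricenter M (\<xi> 0)) \<subseteq> I \<and>
       absolutely_continuous \<mu> (density lborel (indicator I)) \<and>
       absolutely_continuous (density lborel (indicator I)) \<mu>)"

definition cov_kernel :: "'a measure \<Rightarrow> (nat \<Rightarrow> 'a \<Rightarrow> real measure) \<Rightarrow> nat \<Rightarrow> real \<Rightarrow> real \<Rightarrow> real" where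
  "cov_kernel M \<xi> k x y = covariance M (\<lambda>\<omega>. cdf (\<xi> 0 \<omega>) x) (\<lambda>\<omega>. cdf (\<xi> k \<omega>) y)"

text \<open>The kernel \<open>\<Sum>\<^sub>k \<integral> C\<^sub>k(x,z) C\<^sub>k(y,z) \<mu>(dz)\<close> built from a family of lag kernels \<open>C\<^sub>k\<close>.\<close>

definition lag_kernel ::
    "'b measure \<Rightarrow> nat \<Rightarrow> (nat \<Rightarrow> 'b \<Rightarrow> 'b \<Rightarrow> real) \<Rightarrow> 'b \<Rightarrow> 'b \<Rightarrow> real" where
  "lag_kernel \<mu> p C x y = (\<Sum>k=1..p. \<integral>z. C k x z * C k y z \<partial>\<mu>)"

text \<open>In cycle \<open>t\<close> the process is observed at the times \<open>s t i\<close>, \<open>i = 1, \<dots>, q t\<close>.\<close>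

definition emp_cdf ::
    "(real \<Rightarrow> 'a \<Rightarrow> real) \<Rightarrow> (nat \<Rightarrow> nat) \<Rightarrow> (nat \<Rightarrow> nat \<Rightarrow> real) \<Rightarrow> nat \<Rightarrow> 'a \<Rightarrow> real \<Rightarrow> real" where
  "emp_cdf X q s t \<omega> x = (1 / real (q t)) * (\<Sum>i=1..q t. indicator {..x} (X (s t i) \<omega>))"

definition mean_emp_cdf ::
    "(real \<Rightarrow> 'a \<Rightarrow> real) \<Rightarrow> (nat \<Rightarrow> nat) \<Rightarrow> (nat \<Rightarrow> nat \<Rightarrow> real) \<Rightarrow> nat \<Rightarrow> 'a \<Rightarrow> real \<Rightarrow> real" where
  "mean_emp_cdf X q s n \<omega> x = (1 / real n) * (\<Sum>t=1..n. emp_cdf X q s t \<omega> x)"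

definition emp_cov ::
    "(real \<Rightarrow> 'a \<Rightarrow> real) \<Rightarrow> (nat \<Rightarrow> nat) \<Rightarrow> (nat \<Rightarrow> nat \<Rightarrow> real) \<Rightarrow> nat \<Rightarrow> nat \<Rightarrow> 'a
      \<Rightarrow> nat \<Rightarrow> real \<Rightarrow> real \<Rightarrow> real" where
  "emp_cov X q s p n \<omega> k x y = (1 / real (n - p)) * (\<Sum>t=1..n - p.
      (emp_cdf X q s t \<omega> x - mean_emp_cdf X q s n \<omega> x) *
      (emp_cdf X q s (t + k) \<omega> y - mean_emp_cdf X q s n \<omega> y))"

lemma emeasure_mean_measure:
  assumes "n > 0" "\<And>t. t \<in> {1..n} \<Longrightarrow> sets (\<nu> t) = sets borel" "B \<in> sets borel"
  shows "emeasure (mean_measure n \<nu>) B = (\<Sum>t=1..n. emeasure (\<nu> t) B) / of_nat n"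
proof (rule emeasure_measure_of[OF mean_measure_def])
  show "countably_additive (sets (mean_measure n \<nu>)) (\<lambda>B. (\<Sum>t=1..n. emeasure (\<nu> t) B) / of_nat n)"
  proof (rule countably_additiveI)
    fix A :: "nat \<Rightarrow> real set"
    assume A: "range A \<subseteq> sets (mean_measure n \<nu>)" "disjoint_family A" "\<Union> (range A) \<in> sets (mean_measure n \<nu>)"
    have s: "sets (mean_measure n \<nu>) = sets borel"
      unfolding mean_measure_def using sets.sigma_sets_eq[of borel] by simp
    have "(\<Sum>i. (\<Sum>t=1..n. emeasure (\<nu> t) (A i)) / of_nat n)
        = (\<Sum>i. \<Sum>t=1..n. emeasure (\<nu> t) (A i)) / of_nat n"
      by simp
    also have "(\<Sum>i. \<Sum>t=1..n. emeasure (\<nu> t) (A i)) = (\<Sum>t=1..n. \<Sum>i. emeasure (\<nu> t) (A i))"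
      by (rule suminf_sum) auto
    also have "\<dots> = (\<Sum>t=1..n. emeasure (\<nu> t) (\<Union> (range A)))"
    proof (rule sum.cong[OF refl])
      fix t assume "t \<in> {1..n}"
      then show "(\<Sum>i. emeasure (\<nu> t) (A i)) = emeasure (\<nu> t) (\<Union> (range A))"
        using A assms(2)[of t] s by (intro suminf_emeasure) auto
    qed
    finally show "(\<Sum>i. (\<Sum>t=1..n. emeasure (\<nu> t) (A i)) / of_nat n)
        = (\<Sum>t=1..n. emeasure (\<nu> t) (\<Union> (range A))) / of_nat n" .
  qed
  show "B \<in> sets (mean_measure n \<nu>)"
    unfolding mean_measure_def using sets.sigma_sets_eq[of borel] assms by simp
qed (auto simp: positive_def)

lemma real_prob_measure_eqI:
  assumes "\<nu> \<in> space (prob_algebra borel)" "\<kappa> \<in> space (prob_algebra borel)"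
    and eq: "\<And>f :: real \<Rightarrow> real. continuous_on UNIV f \<Longrightarrow> bounded (range f) \<Longrightarrow>
       (\<integral>x. f x \<partial>\<nu>) = (\<integral>x. f x \<partial>\<kappa>)"
  shows "\<nu> = \<kappa>"
proof (rule Levy_uniqueness)
  show d: "real_distribution \<nu>" "real_distribution \<kappa>"
    using assms(1,2) sets_eq_imp_space_eq[of _ "borel :: real measure"]
    by (auto simp: space_prob_algebra real_distribution_def real_distribution_axioms_def)
  have i: "integrable N (\<lambda>x. iexp (t * x))" if "real_distribution N" for N t
  proof -
    interpret real_distribution N by fact
    show ?thesis by (rule integrable_iexp) auto
  qed
  have c: "continuous_on UNIV (\<lambda>x::real. cos (t * x))" "bounded (range (\<lambda>x::real. cos (t * x)))"
    "continuous_on UNIV (\<lambda>x::real. sin (t * x))" "bounded (range (\<lambda>x::real. sin (t * x)))" for t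
    by (auto intro!: continuous_intros boundedI[where B=1])
  show "char \<nu> = char \<kappa>"
  proof
    fix t
    have "Re (char N t) = (\<integral>x. cos (t * x) \<partial>N)" "Im (char N t) = (\<integral>x. sin (t * x) \<partial>N)"
      if "real_distribution N" for N
      unfolding char_def using i[OF that, of t]
      by (simp_all add: integral_Re[symmetric] integral_Im[symmetric] Re_exp Im_exp)
    then show "char \<nu> t = char \<kappa> t"
      using d eq[OF c(1,2)[of t]] eq[OF c(3,4)[of t]] by (simp add: complex_eq_iff)
  qed
qed

lemma baricenter_eq_bind:
  assumes "prob_space M" and \<zeta>: "\<zeta> \<in> measurable M (prob_algebra borel)"
  shows "baricenter M \<zeta> = M \<bind> \<zeta>"
  unfolding baricenter_def
proof (rule the_equality)
  interpret prob_space M by fact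
  have \<zeta>': "\<zeta> \<in> measurable M (subprob_algebra borel)"
    using \<zeta> by (rule measurable_prob_algebraD)
  have sp: "M \<bind> \<zeta> \<in> space (prob_algebra borel)"
    using \<zeta> \<zeta>' not_empty
    by (auto simp: space_prob_algebra sets_bind[OF sets_kernel[OF \<zeta>']]
        intro!: prob_space_bind[where S=borel] AE_I2 dest: measurable_space)
  have b: "(\<integral>\<omega>. (\<integral>x. f x \<partial>\<zeta> \<omega>) \<partial>M) = (\<integral>x. f x \<partial>(M \<bind> \<zeta>))"
    if f: "continuous_on UNIV f" "bounded (range f)" for f :: "real \<Rightarrow> real"
  proof -
    obtain B where B: "\<And>x. norm (f x) \<le> B" using f(2) by (auto simp: bounded_iff)
    show ?thesis
      by (rule integral_bind[where K=borel and B=B and B'=1, symmetric])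
        (use B \<zeta>' f not_empty in \<open>auto intro!: borel_measurable_continuous_onI
          dest!: measurable_space[OF \<zeta>'] simp: space_subprob_algebra subprob_space.emeasure_space_le_1\<close>)
  qed
  show "M \<bind> \<zeta> \<in> space (prob_algebra borel) \<and>
    (\<forall>f :: real \<Rightarrow> real. continuous_on UNIV f \<longrightarrow> bounded (range f) \<longrightarrow>
        (\<integral>\<omega>. (\<integral>x. f x \<partial>\<zeta> \<omega>) \<partial>M) = (\<integral>x. f x \<partial>(M \<bind> \<zeta>)))"
    using sp b by blast
  fix \<nu> :: "real measure"
  assume "\<nu> \<in> space (prob_algebra borel) \<and>
    (\<forall>f :: real \<Rightarrow> real. continuous_on UNIV f \<longrightarrow> bounded (range f) \<longrightarrow>
        (\<integral>\<omega>. (\<integral>x. f x \<partial>\<zeta> \<omega>) \<partial>M) = (\<integral>x. f x \<partial>\<nu>))"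
  then show "\<nu> = M \<bind> \<zeta>"
    using sp b by (intro real_prob_measure_eqI) auto
qed

end

theory Submission
  imports Defs
begin

text \<open>
  The argument has a deterministic and a probabilistic half.

  The deterministic half is perturbation theory for a positive semidefinite integral operator with
  bounded kernel. An eigensystem is only known to exhaust the nonzero eigenspaces, so the first
  thing needed is that the operator norm of a bounded symmetric kernel is visible in its spectrum:
  if \<open>\<kappa>\<close> is the square of the operator norm of \<open>A\<close>, then \<open>A\<^sup>2\<close> has the eigenvalue
  \<open>\<kappa>\<close> (\<open>opnorm_sq_attained\<close>). The eigenfunction is a limit of power iterates of a column of the
  kernel; Hilbert-Schmidt norms prevent it from being zero. Applied to the kernel from which the
  first \<open>j\<close> eigenpairs have been subtracted, this gives \<open>\<parallel>A f\<parallel> \<le> \<theta> j * \<parallel>f\<parallel>\<close> whenever \<open>f\<close> is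
  orthogonal to \<open>\<psi> 0, \<dots>, \<psi> (j - 1)\<close> (\<open>norm_A_le\<close>). Weyl's inequality
  (\<open>eigenvalue_perturbation\<close>) follows by choosing a suitable vector in the span of the first
  \<open>j + 1\<close> perturbed eigenfunctions, and an eigenfunction whose eigenvalue is isolated moves by at
  most a constant times the Hilbert-Schmidt norm of the perturbation
  (\<open>eigenvector_perturbation\<close>). Both conclusions about eigenvalues and eigenfunctions are thereby
  reduced to the convergence of the kernels in Hilbert-Schmidt norm.

  The probabilistic half shows that each empirical lag covariance kernel converges to the true one in
  \<open>L\<^sup>1(\<mu> \<otimes> \<mu>)\<close>, in probability; since all kernels are bounded by \<open>1\<close>, this controls the
  Hilbert-Schmidt norm (\<open>lag_kernel_HS_norm_le\<close>). The error of the empirical covariance is at most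
  an edge effect of order \<open>p / n\<close>, plus sampling noise, plus an ergodic error (\<open>Ch_error_le\<close>).
  Given \<open>\<Xi>\<close>, the empirical distribution functions of different cycles are independent and
  unbiased, so the noise terms of disjoint sets of cycles are orthogonal
  (\<open>centred_products_orthogonal\<close>) and their averages have second moment at most \<open>3 / n\<close>. The
  ergodic error of products of distribution functions vanishes by hypothesis. That of single
  distribution functions vanishes because closeness in the Levy-Prohorov metric bounds the
  difference of two distribution functions by an increment of the limiting one, and such increments
  have small \<open>\<mu>\<close>-integral as \<open>\<mu>\<close> has no atoms.
\<close>

section \<open>The semi-inner product space of square integrable functions\<close>

lemma L2_measurable: "f \<in> L2 \<mu> \<Longrightarrow> f \<in> borel_measurable \<mu>"
  by (simp add: L2_def)

lemma L2_integrable_mult: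
  assumes "f \<in> L2 \<mu>" "g \<in> L2 \<mu>"
  shows "integrable \<mu> (\<lambda>x. f x * g x)"
proof (rule Bochner_Integration.integrable_bound)
  show "integrable \<mu> (\<lambda>x. (f x)\<^sup>2 + (g x)\<^sup>2)"
    using assms by (simp add: L2_def)
  show "(\<lambda>x. f x * g x) \<in> borel_measurable \<mu>"
    using assms by (auto dest!: L2_measurable)
  have "\<bar>a * b\<bar> \<le> a\<^sup>2 + b\<^sup>2" for a b :: real
  proof -
    have "2 * (\<bar>a\<bar> * \<bar>b\<bar>) \<le> a\<^sup>2 + b\<^sup>2" "0 \<le> \<bar>a\<bar> * \<bar>b\<bar>"
      using sum_squares_bound[of "\<bar>a\<bar>" "\<bar>b\<bar>"] by simp_all
    then show ?thesis unfolding abs_mult by linarith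
  qed
  then show "AE x in \<mu>. norm (f x * g x) \<le> norm ((f x)\<^sup>2 + (g x)\<^sup>2)"
    by simp
qed

lemma L2_add: "f \<in> L2 \<mu> \<Longrightarrow> g \<in> L2 \<mu> \<Longrightarrow> (\<lambda>x. f x + g x) \<in> L2 \<mu>"
  using L2_integrable_mult[of f \<mu> g]
  by (auto simp: L2_def power2_sum mult.assoc)

lemma L2_scale: "f \<in> L2 \<mu> \<Longrightarrow> (\<lambda>x. c * f x) \<in> L2 \<mu>"
  by (auto simp: L2_def power_mult_distrib)

lemma L2_diff: "f \<in> L2 \<mu> \<Longrightarrow> g \<in> L2 \<mu> \<Longrightarrow> (\<lambda>x. f x - g x) \<in> L2 \<mu>"
  using L2_add[of f \<mu> "\<lambda>x. -1 * g x"] L2_scale[of g \<mu> "-1"] by simp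

lemma L2_zero: "(\<lambda>x. 0) \<in> L2 \<mu>"
  by (simp add: L2_def)

lemma L2_sum: "(\<And>i. i \<in> I \<Longrightarrow> f i \<in> L2 \<mu>) \<Longrightarrow> (\<lambda>x. \<Sum>i\<in>I. f i x) \<in> L2 \<mu>"
  by (induction I rule: infinite_finite_induct) (simp_all add: L2_zero L2_add)

lemma L2_abs: "f \<in> L2 \<mu> \<Longrightarrow> (\<lambda>x. \<bar>f x\<bar>) \<in> L2 \<mu>"
  by (auto simp: L2_def)

lemma L2_bounded:
  assumes "finite_measure \<mu>" "f \<in> borel_measurable \<mu>" "\<And>x. x \<in> space \<mu> \<Longrightarrow> \<bar>f x\<bar> \<le> B"
  shows "f \<in> L2 \<mu>"
proof -
  interpret finite_measure \<mu> by fact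
  have "\<bar>f x\<bar>\<^sup>2 \<le> B\<^sup>2" if "x \<in> space \<mu>" for x
    using assms(3)[OF that] by (intro power_mono) auto
  then show ?thesis
    using assms(2) unfolding L2_def by (auto intro!: integrable_const_bound[where B="B\<^sup>2"])
qed

lemma L2_inner_commute: "L2_inner \<mu> f g = L2_inner \<mu> g f"
  by (simp add: L2_inner_def mult.commute)

lemma L2_inner_nonneg [simp]: "0 \<le> L2_inner \<mu> f f"
  by (simp add: L2_inner_def)

lemma L2_inner_add_left:
  "f \<in> L2 \<mu> \<Longrightarrow> g \<in> L2 \<mu> \<Longrightarrow> h \<in> L2 \<mu> \<Longrightarrow>
    L2_inner \<mu> (\<lambda>x. f x + g x) h = L2_inner \<mu> f h + L2_inner \<mu> g h"
  by (simp add: L2_inner_def distrib_right L2_integrable_mult)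

lemma L2_inner_add_right:
  "f \<in> L2 \<mu> \<Longrightarrow> g \<in> L2 \<mu> \<Longrightarrow> h \<in> L2 \<mu> \<Longrightarrow>
    L2_inner \<mu> h (\<lambda>x. f x + g x) = L2_inner \<mu> h f + L2_inner \<mu> h g"
  by (simp add: L2_inner_commute[of _ h] L2_inner_add_left)

lemma L2_inner_scale_left: "L2_inner \<mu> (\<lambda>x. c * f x) h = c * L2_inner \<mu> f h"
  by (simp add: L2_inner_def mult.assoc)

lemma L2_inner_scale_right: "L2_inner \<mu> h (\<lambda>x. c * f x) = c * L2_inner \<mu> h f"
  by (simp add: L2_inner_commute[of _ h] L2_inner_scale_left)

lemma L2_inner_diff_left:
  "f \<in> L2 \<mu> \<Longrightarrow> g \<in> L2 \<mu> \<Longrightarrow> h \<in> L2 \<mu> \<Longrightarrow>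
    L2_inner \<mu> (\<lambda>x. f x - g x) h = L2_inner \<mu> f h - L2_inner \<mu> g h"
  by (simp add: L2_inner_def left_diff_distrib L2_integrable_mult)

lemma L2_inner_diff_right:
  "f \<in> L2 \<mu> \<Longrightarrow> g \<in> L2 \<mu> \<Longrightarrow> h \<in> L2 \<mu> \<Longrightarrow>
    L2_inner \<mu> h (\<lambda>x. f x - g x) = L2_inner \<mu> h f - L2_inner \<mu> h g"
  by (simp add: L2_inner_commute[of _ h] L2_inner_diff_left)

lemma L2_inner_sum_left:
  "(\<And>i. i \<in> I \<Longrightarrow> f i \<in> L2 \<mu>) \<Longrightarrow> h \<in> L2 \<mu> \<Longrightarrow>
    L2_inner \<mu> (\<lambda>x. \<Sum>i\<in>I. f i x) h = (\<Sum>i\<in>I. L2_inner \<mu> (f i) h)"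
proof (induction I rule: infinite_finite_induct)
  case (insert i I)
  then show ?case
    using L2_inner_add_left[of "f i" \<mu> "\<lambda>x. \<Sum>i\<in>I. f i x" h] by (simp add: L2_sum)
qed (simp_all add: L2_inner_def)

lemma L2_inner_cong_AE:
  assumes "AE x in \<mu>. f x = f' x" "f \<in> borel_measurable \<mu>" "f' \<in> borel_measurable \<mu>"
    "g \<in> borel_measurable \<mu>"
  shows "L2_inner \<mu> f g = L2_inner \<mu> f' g"
  unfolding L2_inner_def using assms by (intro integral_cong_AE) auto

lemma L2_norm_square: "(L2_norm \<mu> f)\<^sup>2 = L2_inner \<mu> f f"
  by (simp add: L2_norm_def)

lemma L2_norm_nonneg [simp]: "0 \<le> L2_norm \<mu> f"
  by (simp add: L2_norm_def)

lemma L2_norm_scale: "L2_norm \<mu> (\<lambda>x. c * f x) = \<bar>c\<bar> * L2_norm \<mu> f"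
  by (simp add: L2_norm_def L2_inner_scale_left L2_inner_scale_right real_sqrt_mult
      flip: mult.assoc)

lemma L2_inner_diff_self:
  assumes "f \<in> L2 \<mu>" "g \<in> L2 \<mu>"
  shows "L2_inner \<mu> (\<lambda>x. f x - g x) (\<lambda>x. f x - g x)
    = L2_inner \<mu> f f - 2 * L2_inner \<mu> f g + L2_inner \<mu> g g"
  using assms
  by (simp add: L2_inner_diff_left L2_inner_diff_right L2_diff L2_inner_commute[of \<mu> g f])

lemma L2_inner_zero_imp_AE:
  assumes "f \<in> L2 \<mu>" "L2_inner \<mu> f f = 0"
  shows "AE x in \<mu>. f x = 0"
  using assms integral_nonneg_eq_0_iff_AE[of \<mu> "\<lambda>x. f x * f x"] L2_integrable_mult[of f \<mu> f]
  by (simp add: L2_inner_def)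

lemma L2_Cauchy_Schwarz_square:
  assumes f: "f \<in> L2 \<mu>" and g: "g \<in> L2 \<mu>"
  shows "(L2_inner \<mu> f g)\<^sup>2 \<le> L2_inner \<mu> f f * L2_inner \<mu> g g"
proof (cases "L2_inner \<mu> g g = 0")
  case True
  have "L2_inner \<mu> g f = L2_inner \<mu> (\<lambda>x. 0) f"
    using L2_inner_zero_imp_AE[OF g True] f g by (intro L2_inner_cong_AE) (auto dest: L2_measurable)
  then show ?thesis using True by (simp add: L2_inner_commute[of \<mu> f g]) (simp add: L2_inner_def)
next
  case False
  define a where "a = L2_inner \<mu> g g"
  define b where "b = L2_inner \<mu> f g"
  have a: "a > 0" using False L2_inner_nonneg[of \<mu> g] by (simp add: a_def less_le)
  have "0 \<le> L2_inner \<mu> (\<lambda>x. f x - (b / a) * g x) (\<lambda>x. f x - (b / a) * g x)" by simp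
  also have "\<dots> = L2_inner \<mu> f f - 2 * ((b / a) * b) + (b / a) * ((b / a) * a)"
    using L2_inner_diff_self[OF f L2_scale[OF g, of "b / a"]]
    by (simp only: L2_inner_scale_left L2_inner_scale_right a_def b_def)
  also have "\<dots> = L2_inner \<mu> f f - b\<^sup>2 / a"
    using a by (simp add: field_simps power2_eq_square)
  finally have "b\<^sup>2 \<le> L2_inner \<mu> f f * a" using a by (simp add: field_simps)
  then show ?thesis by (simp add: a_def b_def)
qed

lemma L2_Cauchy_Schwarz:
  assumes "f \<in> L2 \<mu>" "g \<in> L2 \<mu>"
  shows "\<bar>L2_inner \<mu> f g\<bar> \<le> L2_norm \<mu> f * L2_norm \<mu> g"
proof -
  have "sqrt ((L2_inner \<mu> f g)\<^sup>2) \<le> sqrt (L2_inner \<mu> f f * L2_inner \<mu> g g)"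
    using L2_Cauchy_Schwarz_square[OF assms] by (rule real_sqrt_le_mono)
  then show ?thesis by (simp add: L2_norm_def real_sqrt_mult)
qed

lemma L2_norm_triangle:
  assumes "f \<in> L2 \<mu>" "g \<in> L2 \<mu>"
  shows "L2_norm \<mu> (\<lambda>x. f x + g x) \<le> L2_norm \<mu> f + L2_norm \<mu> g"
proof (rule power2_le_imp_le)
  have "(L2_norm \<mu> (\<lambda>x. f x + g x))\<^sup>2
      = L2_inner \<mu> f f + 2 * L2_inner \<mu> f g + L2_inner \<mu> g g"
    using assms by (simp add: L2_norm_square L2_inner_add_left L2_inner_add_right L2_add
        L2_inner_commute[of \<mu> g f])
  also have "\<dots> \<le> (L2_norm \<mu> f + L2_norm \<mu> g)\<^sup>2"
    using L2_Cauchy_Schwarz[OF assms] by (simp add: power2_sum L2_norm_square)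
  finally show "(L2_norm \<mu> (\<lambda>x. f x + g x))\<^sup>2 \<le> (L2_norm \<mu> f + L2_norm \<mu> g)\<^sup>2" .
qed simp

lemma L2_norm_triangle_diff:
  assumes "f \<in> L2 \<mu>" "g \<in> L2 \<mu>"
  shows "L2_norm \<mu> (\<lambda>x. f x - g x) \<le> L2_norm \<mu> f + L2_norm \<mu> g"
  using L2_norm_triangle[OF assms(1) L2_scale[OF assms(2), of "-1"]]
  by (simp only: L2_norm_scale) simp

lemma L2_norm_sum_le:
  "(\<And>i. i \<in> I \<Longrightarrow> f i \<in> L2 \<mu>) \<Longrightarrow>
    L2_norm \<mu> (\<lambda>x. \<Sum>i\<in>I. f i x) \<le> (\<Sum>i\<in>I. L2_norm \<mu> (f i))"
proof (induction I rule: infinite_finite_induct)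
  case (insert i I)
  have "L2_norm \<mu> (\<lambda>x. f i x + (\<Sum>i\<in>I. f i x))
      \<le> L2_norm \<mu> (f i) + L2_norm \<mu> (\<lambda>x. \<Sum>i\<in>I. f i x)"
    using insert by (intro L2_norm_triangle L2_sum) auto
  then show ?case using insert by simp
qed (simp_all add: L2_norm_def L2_inner_def)

lemma L2_norm_cong_AE:
  assumes "AE x in \<mu>. f x = g x" "f \<in> borel_measurable \<mu>" "g \<in> borel_measurable \<mu>"
  shows "L2_norm \<mu> f = L2_norm \<mu> g"
  unfolding L2_norm_def L2_inner_def using assms
  by (intro arg_cong[where f=sqrt] integral_cong_AE) auto

lemma L2_imp_integrable:
  assumes "finite_measure \<mu>" "f \<in> L2 \<mu>"
  shows "integrable \<mu> f"
  using L2_integrable_mult[OF assms(2) L2_bounded[OF assms(1), of "\<lambda>_. 1" 1]] by simp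

lemma integral_abs_le_L2_norm:
  assumes "finite_measure \<mu>" "f \<in> L2 \<mu>"
  shows "(\<integral>x. \<bar>f x\<bar> \<partial>\<mu>) \<le> L2_norm \<mu> f * sqrt (measure \<mu> (space \<mu>))"
proof -
  have 1: "(\<lambda>_. 1) \<in> L2 \<mu>" using assms(1) by (rule L2_bounded[of _ _ 1]) auto
  have "L2_norm \<mu> (\<lambda>x. \<bar>f x\<bar>) = L2_norm \<mu> f" "L2_norm \<mu> (\<lambda>_. 1) = sqrt (measure \<mu> (space \<mu>))"
    by (simp_all add: L2_norm_def L2_inner_def abs_mult_self_eq)
  then show ?thesis
    using L2_Cauchy_Schwarz[OF L2_abs[OF assms(2)] 1] by (simp add: L2_inner_def)
qed

section \<open>Integral operators with bounded symmetric kernels\<close>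

lemma integrable_tensor:
  fixes f :: "'a \<Rightarrow> real" and g :: "'b \<Rightarrow> real"
  assumes "sigma_finite_measure M" "sigma_finite_measure N" "integrable M f" "integrable N g"
  shows "integrable (M \<Otimes>\<^sub>M N) (\<lambda>(x, y). f x * g y)"
proof -
  interpret M: sigma_finite_measure M by fact
  interpret N: sigma_finite_measure N by fact
  interpret pair_sigma_finite M N ..
  have [measurable]: "f \<in> borel_measurable M" "g \<in> borel_measurable N" using assms by auto
  show ?thesis
    using assms(3,4) by (intro Fubini_integrable) (auto simp: abs_mult)
qed

text \<open>
  An integral operator \<open>A\<close> on \<open>L\<^sup>2(\<mu>)\<close> given by a measurable, symmetric kernel that is bounded
  everywhere (not only almost everywhere). Boundedness makes \<open>A f\<close> a bounded function, so that
  limits can be taken pointwise by dominated convergence and completeness of \<open>L\<^sup>2(\<mu>)\<close> is never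
  needed.
\<close>

locale bounded_symmetric_kernel = finite_measure \<mu>
  for \<mu> :: "'b measure" and T :: "'b \<Rightarrow> 'b \<Rightarrow> real" and B :: real +
  assumes T_measurable [measurable]: "(\<lambda>(x, y). T x y) \<in> borel_measurable (\<mu> \<Otimes>\<^sub>M \<mu>)"
    and T_bounded: "\<bar>T x y\<bar> \<le> B"
    and T_symmetric: "T x y = T y x"
begin

sublocale pair_sigma_finite \<mu> \<mu> ..

abbreviation A :: "('b \<Rightarrow> real) \<Rightarrow> 'b \<Rightarrow> real" where
  "A \<equiv> integral_operator \<mu> T"

lemma B_nonneg: "0 \<le> B"
  using T_bounded[of undefined undefined] by linarith

lemma section_measurable: "x \<in> space \<mu> \<Longrightarrow> T x \<in> borel_measurable \<mu>"
  using measurable_Pair2[OF T_measurable, of x] by simp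

lemma section_L2: "x \<in> space \<mu> \<Longrightarrow> T x \<in> L2 \<mu>"
  by (intro L2_bounded[where B=B] section_measurable T_bounded) (unfold_locales)

lemma A_eq: "A f x = L2_inner \<mu> (T x) f"
  by (simp add: integral_operator_def L2_inner_def)

lemma A_bounded:
  assumes "f \<in> L2 \<mu>"
  shows "\<bar>A f x\<bar> \<le> B * (\<integral>y. \<bar>f y\<bar> \<partial>\<mu>)"
proof -
  have i: "integrable \<mu> (\<lambda>y. \<bar>f y\<bar>)"
    using assms by (intro integrable_abs L2_imp_integrable) unfold_locales
  have "\<bar>A f x\<bar> \<le> (\<integral>y. \<bar>T x y * f y\<bar> \<partial>\<mu>)"
    unfolding integral_operator_def by (rule integral_abs_bound)
  also have "\<dots> \<le> (\<integral>y. B * \<bar>f y\<bar> \<partial>\<mu>)"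
    using i B_nonneg T_bounded by (intro integral_mono') (auto simp: abs_mult intro!: mult_right_mono)
  finally show ?thesis by simp
qed

lemma A_measurable [measurable]:
  assumes [measurable]: "f \<in> borel_measurable \<mu>"
  shows "A f \<in> borel_measurable \<mu>"
  unfolding integral_operator_def[abs_def] by measurable

lemma A_L2: "f \<in> L2 \<mu> \<Longrightarrow> A f \<in> L2 \<mu>"
  by (rule L2_bounded[OF finite_measure_axioms A_measurable[OF L2_measurable] A_bounded])

lemma A_iter_L2: "f \<in> L2 \<mu> \<Longrightarrow> (A ^^ n) f \<in> L2 \<mu>"
  by (induction n) (auto intro: A_L2)

lemma A_add:
  "x \<in> space \<mu> \<Longrightarrow> f \<in> L2 \<mu> \<Longrightarrow> g \<in> L2 \<mu> \<Longrightarrow> A (\<lambda>x. f x + g x) x = A f x + A g x"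
  by (simp add: A_eq L2_inner_add_right section_L2)

lemma A_diff:
  "x \<in> space \<mu> \<Longrightarrow> f \<in> L2 \<mu> \<Longrightarrow> g \<in> L2 \<mu> \<Longrightarrow> A (\<lambda>x. f x - g x) x = A f x - A g x"
  by (simp add: A_eq L2_inner_diff_right section_L2)

lemma A_scale: "A (\<lambda>x. c * f x) x = c * A f x"
  by (simp add: A_eq L2_inner_scale_right)

lemma A_sum:
  assumes "x \<in> space \<mu>" "\<And>i. i \<in> I \<Longrightarrow> f i \<in> L2 \<mu>"
  shows "A (\<lambda>x. \<Sum>i\<in>I. f i x) x = (\<Sum>i\<in>I. A (f i) x)"
  using assms by (simp add: A_eq L2_inner_commute[of _ "T x"] L2_inner_sum_left section_L2)

lemma A_self_adjoint:
  assumes f: "f \<in> L2 \<mu>" and g: "g \<in> L2 \<mu>"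
  shows "L2_inner \<mu> (A f) g = L2_inner \<mu> f (A g)"
proof -
  have [measurable]: "f \<in> borel_measurable \<mu>" "g \<in> borel_measurable \<mu>"
    using f g by (auto dest: L2_measurable)
  have fi: "integrable \<mu> f" "integrable \<mu> g"
    using f g by (auto intro!: L2_imp_integrable) unfold_locales
  have sf: "sigma_finite_measure \<mu>" by unfold_locales
  have "integrable (\<mu> \<Otimes>\<^sub>M \<mu>) (\<lambda>z. B * (case z of (x, y) \<Rightarrow> g x * f y))"
    using integrable_tensor[OF sf sf fi(2,1)] by simp
  then have i: "integrable (\<mu> \<Otimes>\<^sub>M \<mu>) (\<lambda>(x, y). T x y * f y * g x)"
  proof (rule Bochner_Integration.integrable_bound)
    have "\<bar>T x y * f y * g x\<bar> \<le> \<bar>B * (g x * f y)\<bar>" for x y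
      using mult_right_mono[OF T_bounded[of x y], of "\<bar>f y\<bar> * \<bar>g x\<bar>"] B_nonneg
      by (simp add: abs_mult ac_simps)
    then show "AE z in \<mu> \<Otimes>\<^sub>M \<mu>. norm (case z of (x, y) \<Rightarrow> T x y * f y * g x)
        \<le> norm (B * (case z of (x, y) \<Rightarrow> g x * f y))"
      by (auto simp: split_beta)
  qed simp
  have "L2_inner \<mu> (A f) g = (\<integral>x. (\<integral>y. T x y * f y * g x \<partial>\<mu>) \<partial>\<mu>)"
    by (simp add: L2_inner_def integral_operator_def)
  also have "\<dots> = (\<integral>y. (\<integral>x. T x y * f y * g x \<partial>\<mu>) \<partial>\<mu>)"
    using Fubini_integral[OF i] by simp
  also have "\<dots> = (\<integral>y. f y * (\<integral>x. T y x * g x \<partial>\<mu>) \<partial>\<mu>)"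
  proof -
    have "T x y * f y * g x = f y * (T y x * g x)" for x y
      using T_symmetric[of x y] by simp
    then show ?thesis by (simp only: integral_mult_right_zero)
  qed
  finally show ?thesis
    by (simp add: L2_inner_def integral_operator_def)
qed


text \<open>
  The squared norm of the \<open>n\<close>-th iterate, \<open>\<parallel>A\<^sup>n f\<parallel>\<^sup>2\<close>.
\<close>

definition iter_sq :: "nat \<Rightarrow> ('b \<Rightarrow> real) \<Rightarrow> real" where
  "iter_sq n f = L2_inner \<mu> ((A ^^ n) f) ((A ^^ n) f)"

text \<open>
  The squared Hilbert-Schmidt norm of \<open>A\<^sup>n\<^sup>+\<^sup>1\<close>: the functions \<open>A\<^sup>n (T y)\<close> are the columns of
  its kernel. Equivalently, the trace of \<open>A\<^sup>2\<^sup>n\<^sup>+\<^sup>2\<close>.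
\<close>

definition iter_trace :: "nat \<Rightarrow> real" where
  "iter_trace n = (\<integral>y. iter_sq n (T y) \<partial>\<mu>)"

text \<open>
  The square of the operator norm of \<open>A\<close>, as the least constant \<open>c\<close> with \<open>\<parallel>A f\<parallel>\<^sup>2 \<le> c * \<parallel>f\<parallel>\<^sup>2\<close>.
\<close>

definition opnorm_sq :: real where
  "opnorm_sq = Inf {c. 0 \<le> c \<and> (\<forall>f\<in>L2 \<mu>. iter_sq 1 f \<le> c * iter_sq 0 f)}"

lemma iter_sq_nonneg [simp]: "0 \<le> iter_sq n f"
  by (simp add: iter_sq_def)

lemma iter_sq_zero: "iter_sq 0 f = L2_inner \<mu> f f"
  by (simp add: iter_sq_def)

lemma iter_shift:
  assumes "f \<in> L2 \<mu>" "g \<in> L2 \<mu>"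
  shows "L2_inner \<mu> ((A ^^ (m + k)) f) g = L2_inner \<mu> ((A ^^ m) f) ((A ^^ k) g)"
  using assms(2)
proof (induction k arbitrary: g)
  case (Suc k)
  have "L2_inner \<mu> ((A ^^ (m + Suc k)) f) g = L2_inner \<mu> ((A ^^ (m + k)) f) (A g)"
    using A_self_adjoint[OF A_iter_L2[OF assms(1)] Suc.prems] by simp
  also have "\<dots> = L2_inner \<mu> ((A ^^ m) f) ((A ^^ k) (A g))"
    using Suc by (simp add: A_L2)
  finally show ?case by (simp add: funpow_swap1)
qed simp

lemma iter_sq_log_convex:
  assumes "f \<in> L2 \<mu>"
  shows "(iter_sq (Suc n) f)\<^sup>2 \<le> iter_sq n f * iter_sq (Suc (Suc n)) f"
proof -
  have "iter_sq (Suc n) f = L2_inner \<mu> ((A ^^ n) f) ((A ^^ Suc (Suc n)) f)"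
    unfolding iter_sq_def
    using A_self_adjoint[OF A_iter_L2[OF assms, of n] A_iter_L2[OF assms, of "Suc n"]] by simp
  then show ?thesis
    unfolding iter_sq_def using L2_Cauchy_Schwarz_square[OF A_iter_L2[OF assms] A_iter_L2[OF assms]]
    by metis
qed

lemma iter_sq_power_lower_bound:
  assumes f: "f \<in> L2 \<mu>" and pos: "0 < iter_sq 0 f" and r: "0 \<le> r" "r * iter_sq 0 f \<le> iter_sq 1 f"
  shows "r ^ n * iter_sq 0 f \<le> iter_sq n f"
proof (cases "r = 0")
  case True
  then show ?thesis by (cases n) auto
next
  case False
  have *: "0 < iter_sq n f \<and> r * iter_sq n f \<le> iter_sq (Suc n) f" for n
  proof (induction n)
    case (Suc n)
    then have n: "0 < iter_sq n f" "r * iter_sq n f \<le> iter_sq (Suc n) f" by auto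
    moreover have "0 < r * iter_sq n f" using n r False by simp
    ultimately have p: "0 < iter_sq (Suc n) f" by linarith
    have "(r * iter_sq n f) * iter_sq (Suc n) f \<le> iter_sq (Suc n) f * iter_sq (Suc n) f"
      using n p by (intro mult_right_mono) auto
    also have "\<dots> \<le> iter_sq n f * iter_sq (Suc (Suc n)) f"
      using iter_sq_log_convex[OF f, of n] by (simp add: power2_eq_square)
    finally have "iter_sq n f * (r * iter_sq (Suc n) f) \<le> iter_sq n f * iter_sq (Suc (Suc n)) f"
      by (simp add: ac_simps)
    then show ?case using n p by simp
  qed (use pos r in auto)
  show ?thesis
  proof (induction n)
    case (Suc n)
    have "r ^ Suc n * iter_sq 0 f \<le> r * iter_sq n f"
      using mult_left_mono[OF Suc r(1)] by (simp add: ac_simps)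
    then show ?case using * order_trans by blast
  qed simp
qed

lemma iter_joint_measurable [measurable]:
  "(\<lambda>(y, x). (A ^^ n) (T y) x) \<in> borel_measurable (\<mu> \<Otimes>\<^sub>M \<mu>)"
proof (induction n)
  case (Suc n)
  define H where "H = (\<lambda>(y, x). (A ^^ n) (T y) x)"
  have [measurable]: "H \<in> borel_measurable (\<mu> \<Otimes>\<^sub>M \<mu>)" using Suc by (simp add: H_def)
  have "(\<lambda>(y, x). (A ^^ Suc n) (T y) x) = (\<lambda>(y, x). \<integral>u. T x u * H (y, u) \<partial>\<mu>)"
    by (simp add: H_def integral_operator_def)
  then show ?case by simp
qed simp

lemma iter_sq_measurable [measurable]: "(\<lambda>y. iter_sq n (T y)) \<in> borel_measurable \<mu>"
  unfolding iter_sq_def L2_inner_def by measurable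

lemma section_sq_le:
  assumes "x \<in> space \<mu>"
  shows "iter_sq 0 (T x) \<le> B\<^sup>2 * measure \<mu> (space \<mu>)"
proof -
  have "T x y * T x y \<le> B\<^sup>2" for y
    using power_mono[OF T_bounded[of x y], of 2] by (simp add: power2_eq_square)
  then have "(\<integral>y. T x y * T x y \<partial>\<mu>) \<le> (\<integral>y. B\<^sup>2 \<partial>\<mu>)"
    by (intro integral_mono') auto
  then show ?thesis by (simp add: iter_sq_zero L2_inner_def mult.commute)
qed

text \<open>
  By symmetry, \<open>A\<^sup>n\<^sup>+\<^sup>1 f x\<close> is the inner product of \<open>f\<close> with the column \<open>A\<^sup>n (T x)\<close>. Integrating
  the resulting bound over \<open>x\<close> compares the operator norm of \<open>A\<^sup>n\<^sup>+\<^sup>1\<close> with its Hilbert-Schmidt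
  norm.
\<close>

lemma iter_pointwise:
  assumes "x \<in> space \<mu>" "f \<in> L2 \<mu>"
  shows "((A ^^ Suc n) f x)\<^sup>2 \<le> iter_sq n (T x) * iter_sq 0 f"
proof -
  have "(A ^^ Suc n) f x = L2_inner \<mu> ((A ^^ n) (T x)) f"
    using iter_shift[OF section_L2[OF assms(1)] assms(2), of 0 n] by (simp add: A_eq[of _ x])
  then show ?thesis
    using L2_Cauchy_Schwarz_square[OF A_iter_L2[OF section_L2[OF assms(1)], of n] assms(2)]
    by (simp add: iter_sq_def)
qed

lemma iter_sq_Suc_le_trace:
  assumes "integrable \<mu> (\<lambda>x. iter_sq n (T x))" "f \<in> L2 \<mu>"
  shows "iter_sq (Suc n) f \<le> iter_trace n * iter_sq 0 f"
proof -
  have "iter_sq (Suc n) f = (\<integral>x. ((A ^^ Suc n) f x)\<^sup>2 \<partial>\<mu>)"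
    by (simp add: iter_sq_def L2_inner_def power2_eq_square)
  also have "\<dots> \<le> (\<integral>x. iter_sq n (T x) * iter_sq 0 f \<partial>\<mu>)"
    using assms iter_pointwise[OF _ assms(2)] by (intro integral_mono') auto
  finally show ?thesis by (simp add: iter_trace_def)
qed

lemma section_sq_integrable: "integrable \<mu> (\<lambda>x. iter_sq 0 (T x))"
  by (rule integrable_const_bound[where B="B\<^sup>2 * measure \<mu> (space \<mu>)"])
     (use section_sq_le in auto)

lemma iter_trace_nonneg: "0 \<le> iter_trace n"
  by (simp add: iter_trace_def)

lemma opnorm_sq_bounds:
  shows opnorm_sq_nonneg: "0 \<le> opnorm_sq"
    and iter_sq_one_le: "f \<in> L2 \<mu> \<Longrightarrow> iter_sq 1 f \<le> opnorm_sq * iter_sq 0 f"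
proof -
  let ?S = "{c. 0 \<le> c \<and> (\<forall>f\<in>L2 \<mu>. iter_sq 1 f \<le> c * iter_sq 0 f)}"
  have ne: "iter_trace 0 \<in> ?S"
    using iter_sq_Suc_le_trace[OF section_sq_integrable] by (simp add: iter_trace_nonneg)
  then show "0 \<le> opnorm_sq"
    unfolding opnorm_sq_def by (intro cInf_greatest) auto
  assume f: "f \<in> L2 \<mu>"
  show "iter_sq 1 f \<le> opnorm_sq * iter_sq 0 f"
  proof (cases "iter_sq 0 f = 0")
    case True
    then show ?thesis using ne f by auto
  next
    case False
    then have p: "0 < iter_sq 0 f" by (simp add: less_le)
    have "iter_sq 1 f / iter_sq 0 f \<le> opnorm_sq"
      unfolding opnorm_sq_def using ne f p by (intro cInf_greatest) (auto simp: field_simps)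
    then show ?thesis using p by (simp add: field_simps)
  qed
qed

lemma opnorm_sq_le:
  assumes "0 \<le> c" "\<And>f. f \<in> L2 \<mu> \<Longrightarrow> iter_sq 1 f \<le> c * iter_sq 0 f"
  shows "opnorm_sq \<le> c"
  unfolding opnorm_sq_def using assms by (intro cInf_lower bdd_belowI[of _ 0]) auto

lemma iter_sq_Suc_le: "f \<in> L2 \<mu> \<Longrightarrow> iter_sq (Suc n) f \<le> opnorm_sq * iter_sq n f"
  using iter_sq_one_le[OF A_iter_L2, of f n] by (simp add: iter_sq_def)

lemma iter_sq_le: "f \<in> L2 \<mu> \<Longrightarrow> iter_sq n f \<le> opnorm_sq ^ n * iter_sq 0 f"
proof (induction n)
  case (Suc n)
  then show ?case
    using iter_sq_Suc_le[of f n] mult_left_mono[OF Suc.IH opnorm_sq_nonneg]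
    by (simp add: ac_simps)
qed simp

lemma iter_sq_section_le:
  assumes "x \<in> space \<mu>"
  shows "iter_sq n (T x) \<le> opnorm_sq ^ n * (B\<^sup>2 * measure \<mu> (space \<mu>))"
  using iter_sq_le[OF section_L2[OF assms], of n]
    mult_left_mono[OF section_sq_le[OF assms] zero_le_power[OF opnorm_sq_nonneg], of n]
  by linarith

lemma iter_sq_section_integrable: "integrable \<mu> (\<lambda>x. iter_sq n (T x))"
  by (rule integrable_const_bound[where B="opnorm_sq ^ n * (B\<^sup>2 * measure \<mu> (space \<mu>))"])
     (use iter_sq_section_le in auto)

text \<open>
  Hilbert-Schmidt norms of powers decay no faster than powers of the operator norm: log-convexity
  of \<open>n \<mapsto> \<parallel>A\<^sup>n f\<parallel>\<^sup>2\<close> gives \<open>(\<parallel>A f\<parallel>\<^sup>2 / \<parallel>f\<parallel>\<^sup>2)\<^sup>n\<^sup>+\<^sup>1 \<le> iter_trace n\<close> for every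
  nonzero \<open>f\<close>.
\<close>

lemma opnorm_sq_power_le_trace: "opnorm_sq ^ Suc n \<le> iter_trace n"
proof -
  define r where "r = root (Suc n) (iter_trace n)"
  have r: "0 \<le> r" "r ^ Suc n = iter_trace n"
    using iter_trace_nonneg by (simp_all add: r_def real_root_pow_pos2 del: power_Suc)
  have "opnorm_sq \<le> r"
  proof (rule opnorm_sq_le[OF r(1)])
    fix f assume f: "f \<in> L2 \<mu>"
    show "iter_sq 1 f \<le> r * iter_sq 0 f"
    proof (cases "iter_sq 0 f = 0")
      case True
      then show ?thesis using iter_sq_one_le[OF f] by simp
    next
      case False
      define q where "q = iter_sq 1 f / iter_sq 0 f"
      have p: "0 < iter_sq 0 f" using False by (simp add: less_le)
      have "q ^ Suc n * iter_sq 0 f \<le> iter_sq (Suc n) f"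
        using p by (intro iter_sq_power_lower_bound f) (auto simp: q_def)
      also have "\<dots> \<le> r ^ Suc n * iter_sq 0 f"
        using iter_sq_Suc_le_trace[OF iter_sq_section_integrable f, of n] r(2) by simp
      finally have "q ^ Suc n \<le> r ^ Suc n" using p by (simp del: power_Suc)
      then have "q \<le> r" using r(1) by (rule power_le_imp_le_base)
      then show ?thesis using p by (simp add: q_def field_simps)
    qed
  qed
  then have "opnorm_sq ^ Suc n \<le> r ^ Suc n" by (intro power_mono opnorm_sq_nonneg)
  then show ?thesis using r(2) by simp
qed

lemma A_dominated_convergence:
  assumes "\<And>n. u n \<in> borel_measurable \<mu>" "\<And>n y. y \<in> space \<mu> \<Longrightarrow> \<bar>u n y\<bar> \<le> E"
    and "\<And>y. y \<in> space \<mu> \<Longrightarrow> (\<lambda>n. u n y) \<longlonglongrightarrow> g y" and x: "x \<in> space \<mu>"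
  shows "(\<lambda>n. A (u n) x) \<longlonglongrightarrow> A g x"
  unfolding integral_operator_def
proof (rule integral_dominated_convergence[where w="\<lambda>_. B * E"])
  have g: "g \<in> borel_measurable \<mu>"
    using assms(3,1) by (rule borel_measurable_LIMSEQ_real)
  show "(\<lambda>y. T x y * g y) \<in> borel_measurable \<mu>" "(\<lambda>y. T x y * u n y) \<in> borel_measurable \<mu>" for n
    using g assms(1) section_measurable[OF x] by measurable
  show "AE y in \<mu>. (\<lambda>n. T x y * u n y) \<longlonglongrightarrow> T x y * g y"
    using assms(3) by (intro AE_I2 tendsto_mult_left)
  show "AE y in \<mu>. norm (T x y * u n y) \<le> B * E" for n
    using T_bounded assms(2) B_nonneg by (auto intro!: AE_I2 mult_mono simp: abs_mult)
qed simp

text \<open>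
  If the normalised iterates of every column tended to zero, then so would their average over all
  columns, the normalised squared Hilbert-Schmidt norm of the powers, which is bounded below.
\<close>

lemma ex_section_not_vanishing:
  assumes "0 < opnorm_sq"
  shows "\<exists>y\<in>space \<mu>. \<not> (\<lambda>n. iter_sq n (T y) / opnorm_sq ^ n) \<longlonglongrightarrow> 0"
proof (rule ccontr)
  assume "\<not> ?thesis"
  then have lim: "(\<lambda>n. iter_sq n (T y) / opnorm_sq ^ n) \<longlonglongrightarrow> 0" if "y \<in> space \<mu>" for y
    using that by auto
  have "(\<lambda>n. \<integral>y. iter_sq n (T y) / opnorm_sq ^ n \<partial>\<mu>) \<longlonglongrightarrow> (\<integral>y. 0 \<partial>\<mu>)"
  proof (rule integral_dominated_convergence[where w="\<lambda>_. B\<^sup>2 * measure \<mu> (space \<mu>)"])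
    show "AE y in \<mu>. norm (iter_sq n (T y) / opnorm_sq ^ n) \<le> B\<^sup>2 * measure \<mu> (space \<mu>)" for n
      using iter_sq_section_le[of _ n] assms by (auto intro!: AE_I2 simp: field_simps)
  qed (use lim in auto)
  moreover have "opnorm_sq \<le> (\<integral>y. iter_sq n (T y) / opnorm_sq ^ n \<partial>\<mu>)" for n
  proof -
    have "(\<integral>y. iter_sq n (T y) / opnorm_sq ^ n \<partial>\<mu>) = iter_trace n / opnorm_sq ^ n"
      by (simp add: iter_trace_def)
    then show ?thesis using opnorm_sq_power_le_trace[of n] assms by (simp add: field_simps)
  qed
  ultimately have "opnorm_sq \<le> 0"
    by (intro LIMSEQ_le_const[of _ 0 opnorm_sq]) auto
  then show False using assms by simp
qed

text \<open>
  Let \<open>f\<close> be a column with non-vanishing normalised iterates and \<open>c n = \<parallel>A\<^sup>n f\<parallel>\<^sup>2 / \<kappa>\<^sup>n\<close>, a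
  decreasing sequence with positive limit. The functions \<open>h n = A\<^sup>2\<^sup>n f / \<kappa>\<^sup>n\<close> have inner
  products \<open>c (n + m)\<close>, hence form a Cauchy sequence in \<open>L\<^sup>2(\<mu>)\<close>, and \<open>k n = A (h n)\<close> converges
  pointwise. The limit is the eigenfunction.
\<close>

theorem opnorm_sq_attained:
  assumes pos: "0 < opnorm_sq"
  shows "\<exists>g. g \<in> L2 \<mu> \<and> 0 < L2_inner \<mu> g g \<and> (\<forall>x\<in>space \<mu>. A (A g) x = opnorm_sq * g x)"
proof -
  let ?k = opnorm_sq
  obtain y where y: "y \<in> space \<mu>" and nl: "\<not> (\<lambda>n. iter_sq n (T y) / ?k ^ n) \<longlonglongrightarrow> 0"
    using ex_section_not_vanishing[OF pos] by blast
  define f where "f = T y"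
  define c where "c n = iter_sq n f / ?k ^ n" for n
  have f: "f \<in> L2 \<mu>" using section_L2[OF y] by (simp add: f_def)
  have c0: "0 \<le> c n" for n using pos by (simp add: c_def)
  have dec: "decseq c"
    using iter_sq_Suc_le[OF f] pos by (intro decseq_SucI) (auto simp: c_def field_simps)
  obtain L where L: "c \<longlonglongrightarrow> L" using decseq_convergent[OF dec] c0 by blast
  have "L \<noteq> 0" using nl L by (auto simp: c_def[abs_def] f_def)
  moreover have "0 \<le> L" using L c0 by (intro LIMSEQ_le_const[OF L]) auto
  ultimately have Lpos: "0 < L" by simp
  define h where "h n = (\<lambda>x. (1 / ?k ^ n) * (A ^^ (2 * n)) f x)" for n
  define k where "k n = (\<lambda>x. (1 / ?k ^ n) * (A ^^ (Suc (2 * n))) f x)" for n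
  have hL: "h n \<in> L2 \<mu>" and kL: "k n \<in> L2 \<mu>" for n
    unfolding h_def k_def by (intro L2_scale A_iter_L2 f)+
  have k_eq: "k n = A (h n)" for n
    by (rule ext) (simp only: k_def h_def A_scale funpow.simps o_apply)
  have inner_h: "L2_inner \<mu> (h n) (h m) = c (n + m)" for n m
  proof -
    have "L2_inner \<mu> ((A ^^ (2 * n)) f) ((A ^^ (2 * m)) f) = L2_inner \<mu> ((A ^^ (2 * n + 2 * m)) f) f"
      by (rule iter_shift[OF f f, symmetric])
    also have "2 * n + 2 * m = (n + m) + (n + m)" by simp
    also have "L2_inner \<mu> ((A ^^ ((n + m) + (n + m))) f) f = iter_sq (n + m) f"
      unfolding iter_sq_def by (rule iter_shift[OF f f])
    finally show ?thesis
      by (simp only: h_def L2_inner_scale_left L2_inner_scale_right c_def) (simp add: power_add)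
  qed
  have inner_self: "L2_inner \<mu> (h n) (h n) = c (2 * n)" for n
    by (simp only: inner_h mult_2)
  define D where "D = B\<^sup>2 * measure \<mu> (space \<mu>)"
  have D: "0 \<le> D" by (simp add: D_def)
  have A_le: "(A u x)\<^sup>2 \<le> D * L2_inner \<mu> u u" if "x \<in> space \<mu>" "u \<in> L2 \<mu>" for u x
  proof -
    have "(A u x)\<^sup>2 \<le> iter_sq 0 (T x) * L2_inner \<mu> u u"
      using iter_pointwise[OF that, of 0] by (simp add: iter_sq_zero)
    also have "\<dots> \<le> D * L2_inner \<mu> u u"
      unfolding D_def using section_sq_le[OF that(1)] by (intro mult_right_mono) auto
    finally show ?thesis .
  qed
  have conv: "convergent (\<lambda>n. k n x)" if x: "x \<in> space \<mu>" for x
  proof (rule Cauchy_convergent, rule CauchyI)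
    fix e :: real assume e: "0 < e"
    define d where "d = e\<^sup>2 / (4 * (D + 1))"
    have d: "0 < d" using e D by (simp add: d_def)
    obtain N where N: "\<And>n. n \<ge> N \<Longrightarrow> \<bar>c n - L\<bar> < d"
      using LIMSEQ_D[OF L d] by auto
    have "norm (k n x - k m x) < e" if nm: "n \<ge> N" "m \<ge> N" for n m
    proof -
      have "(k n x - k m x)\<^sup>2 = (A (\<lambda>z. h n z - h m z) x)\<^sup>2"
        using A_diff[OF x hL hL] by (simp add: k_eq)
      also have "\<dots> \<le> D * (c (2 * n) - 2 * c (n + m) + c (2 * m))"
        using A_le[OF x L2_diff[OF hL hL], of n m] L2_inner_diff_self[OF hL hL, of n m]
        by (simp only: inner_h mult_2)
      also have "\<dots> \<le> D * (4 * d)"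
        using N[of "2 * n"] N[of "n + m"] N[of "2 * m"] nm D by (intro mult_left_mono) auto
      also have "\<dots> < e\<^sup>2" using D e by (simp add: d_def field_simps)
      finally show ?thesis
        using e power2_less_imp_less[of "\<bar>k n x - k m x\<bar>" e] by simp
    qed
    then show "\<exists>M. \<forall>m\<ge>M. \<forall>n\<ge>M. norm (k m x - k n x) < e" by blast
  qed
  define g where "g x = lim (\<lambda>n. k n x)" for x
  have kg: "(\<lambda>n. k n x) \<longlonglongrightarrow> g x" if "x \<in> space \<mu>" for x
    using conv[OF that] by (simp add: convergent_LIMSEQ_iff g_def)
  define E where "E = sqrt (D * c 0)"
  have k_le: "\<bar>k n x\<bar> \<le> E" if "x \<in> space \<mu>" for n x
  proof -
    have "(k n x)\<^sup>2 \<le> D * c (2 * n)"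
      using A_le[OF that hL[of n]] by (simp only: k_eq inner_self)
    also have "\<dots> \<le> D * c 0" using decseqD[OF dec, of 0 "2 * n"] D by (intro mult_left_mono) auto
    finally show ?thesis unfolding E_def by (metis real_sqrt_abs real_sqrt_le_iff)
  qed
  have km: "k n \<in> borel_measurable \<mu>" for n using kL by (rule L2_measurable)
  have gm [measurable]: "g \<in> borel_measurable \<mu>" using kg km by (rule borel_measurable_LIMSEQ_real)
  have g_le: "\<bar>g x\<bar> \<le> E" if "x \<in> space \<mu>" for x
    using tendsto_rabs[OF kg[OF that]] k_le[OF that] by (intro LIMSEQ_le_const2) auto
  have gL: "g \<in> L2 \<mu>" using gm g_le by (intro L2_bounded[OF finite_measure_axioms]) auto
  have kA: "(\<lambda>n. A (k n) x) \<longlonglongrightarrow> A g x" if "x \<in> space \<mu>" for x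
    using km k_le kg that by (rule A_dominated_convergence)
  have kA_le: "\<bar>A (k n) x\<bar> \<le> B * (E * measure \<mu> (space \<mu>))" for n x
  proof -
    have "(\<integral>z. \<bar>k n z\<bar> \<partial>\<mu>) \<le> (\<integral>z. E \<partial>\<mu>)"
      using k_le order_trans[OF abs_ge_zero k_le] by (intro integral_mono') auto
    then have "B * (\<integral>z. \<bar>k n z\<bar> \<partial>\<mu>) \<le> B * (E * measure \<mu> (space \<mu>))"
      using B_nonneg by (intro mult_left_mono) (auto simp: mult.commute)
    then show ?thesis using A_bounded[OF kL, of n x] by linarith
  qed
  have eigen: "A (A g) x = ?k * g x" if x: "x \<in> space \<mu>" for x
  proof (rule LIMSEQ_unique)
    show "(\<lambda>n. A (A (k n)) x) \<longlonglongrightarrow> A (A g) x"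
      using A_measurable[OF km] kA_le kA x by (rule A_dominated_convergence)
    have "A (A (k n)) x = ?k * k (Suc n) x" for n
    proof -
      have "A (k n) = (\<lambda>x. (1 / ?k ^ n) * A ((A ^^ (Suc (2 * n))) f) x)"
        by (rule ext) (simp only: k_def A_scale)
      then have "A (A (k n)) x = (1 / ?k ^ n) * A (A ((A ^^ (Suc (2 * n))) f)) x"
        by (simp only: A_scale)
      then show ?thesis using pos by (simp add: k_def)
    qed
    then show "(\<lambda>n. A (A (k n)) x) \<longlonglongrightarrow> ?k * g x"
      using LIMSEQ_Suc[OF kg[OF x]] by (simp add: tendsto_mult_left)
  qed
  have "(\<lambda>n. \<integral>x. k n x * k n x \<partial>\<mu>) \<longlonglongrightarrow> (\<integral>x. g x * g x \<partial>\<mu>)"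
  proof (rule integral_dominated_convergence[where w="\<lambda>_. E * E"])
    show "AE x in \<mu>. norm (k n x * k n x) \<le> E * E" for n
    proof (rule AE_I2)
      fix x assume "x \<in> space \<mu>"
      then show "norm (k n x * k n x) \<le> E * E"
        using mult_mono'[OF k_le k_le] by (simp only: real_norm_def abs_mult abs_ge_zero)
    qed
    show "AE x in \<mu>. (\<lambda>n. k n x * k n x) \<longlonglongrightarrow> g x * g x"
      using kg by (intro AE_I2 tendsto_mult)
  qed (use km in auto)
  moreover have "(\<integral>x. k n x * k n x \<partial>\<mu>) = ?k * c (Suc (2 * n))" for n
  proof -
    have "(\<integral>x. k n x * k n x \<partial>\<mu>) = L2_inner \<mu> (k n) (k n)" by (simp add: L2_inner_def)
    also have "\<dots> = (1 / ?k ^ n) * ((1 / ?k ^ n) * iter_sq (Suc (2 * n)) f)"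
      unfolding k_def L2_inner_scale_left L2_inner_scale_right iter_sq_def by simp
    also have "\<dots> = ?k * c (Suc (2 * n))"
    proof -
      have "?k ^ (2 * n) = ?k ^ n * ?k ^ n" by (simp only: mult_2 power_add)
      then show ?thesis using pos by (simp add: c_def)
    qed
    finally show ?thesis .
  qed
  moreover have "(\<lambda>n. ?k * c (Suc (2 * n))) \<longlonglongrightarrow> ?k * L"
    using L by (intro tendsto_mult_left filterlim_compose[OF L]
        filterlim_subseq) (auto simp: strict_mono_def)
  ultimately have "L2_inner \<mu> g g = ?k * L"
    using LIMSEQ_unique by (simp add: L2_inner_def)
  then show ?thesis using gL eigen pos Lpos by auto
qed

end

section \<open>Perturbation of eigenvalues and eigenfunctions\<close>

text \<open>
  A homogeneous linear system with more unknowns than equations has a nontrivial solution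
  (Gaussian elimination of one unknown per equation).
\<close>

lemma ex_nontrivial_solution:
  fixes a :: "'i \<Rightarrow> 'l \<Rightarrow> real"
  assumes "finite L" "finite I" "card L < card I"
  shows "\<exists>c. (\<exists>i\<in>I. c i \<noteq> 0) \<and> (\<forall>l\<in>L. (\<Sum>i\<in>I. c i * a i l) = 0)"
  using assms
proof (induction L arbitrary: I a rule: finite_induct)
  case empty
  then obtain i where "i \<in> I" by fastforce
  then show ?case by (intro exI[of _ "\<lambda>_. 1"]) auto
next
  case (insert l L)
  show ?case
  proof (cases "\<forall>i\<in>I. a i l = 0")
    case True
    have "card L < card I" using insert by simp
    then obtain c where "\<exists>i\<in>I. c i \<noteq> 0" "\<forall>l\<in>L. (\<Sum>i\<in>I. c i * a i l) = 0"
      using insert.IH[OF insert.prems(1), of a] by auto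
    then show ?thesis using True by (intro exI[of _ c]) auto
  next
    case False
    then obtain k where k: "k \<in> I" "a k l \<noteq> 0" by blast
    define J where "J = I - {k}"
    have J: "finite J" "card L < card J" "k \<notin> J" and I: "I = insert k J"
      using insert k by (auto simp: J_def)
    obtain c where c: "\<exists>i\<in>J. c i \<noteq> 0"
        "\<forall>m\<in>L. (\<Sum>i\<in>J. c i * (a i m - a i l / a k l * a k m)) = 0"
      using insert.IH[OF J(1,2), of "\<lambda>i m. a i m - a i l / a k l * a k m"] by auto
    \<comment> \<open>The value of the eliminated unknown is chosen to satisfy equation \<open>l\<close>.\<close>
    define d where "d = c(k := - (\<Sum>i\<in>J. c i * a i l) / a k l)"
    have *: "(\<Sum>i\<in>I. d i * a i m) = (\<Sum>i\<in>J. c i * (a i m - a i l / a k l * a k m))" for m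
    proof -
      have "(\<Sum>i\<in>J. d i * a i m) = (\<Sum>i\<in>J. c i * a i m)"
        using J by (intro sum.cong) (auto simp: d_def)
      then have "(\<Sum>i\<in>I. d i * a i m) = (\<Sum>i\<in>J. c i * a i m) - (\<Sum>i\<in>J. c i * a i l) / a k l * a k m"
        using J I by (simp add: d_def)
      also have "\<dots> = (\<Sum>i\<in>J. c i * (a i m - a i l / a k l * a k m))"
        by (simp add: right_diff_distrib sum_subtractf sum_distrib_right sum_divide_distrib
            mult.assoc)
      finally show ?thesis .
    qed
    have "(\<Sum>i\<in>I. d i * a i m) = 0" if "m \<in> insert l L" for m
    proof (cases "m = l")
      case True
      then show ?thesis using k by (simp add: *)
    qed (use that c * in auto)
    moreover have "\<exists>i\<in>I. d i \<noteq> 0"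
      using c(1) J I by (auto simp: d_def)
    ultimately show ?thesis by blast
  qed
qed

text \<open>
  A positive semidefinite operator with bounded kernel, together with an eigensystem.
\<close>

locale psd_eigensystem = bounded_symmetric_kernel \<mu> T B
  for \<mu> :: "'b measure" and T B +
  fixes \<theta> :: "nat \<Rightarrow> real" and \<psi> :: "nat \<Rightarrow> 'b \<Rightarrow> real"
  assumes eigensystem: "eigensystem \<mu> T \<theta> \<psi>"
    and psd: "f \<in> L2 \<mu> \<Longrightarrow> 0 \<le> L2_inner \<mu> (A f) f"
begin

lemma \<theta>_antimono: "i \<le> j \<Longrightarrow> \<theta> j \<le> \<theta> i"
  using eigensystem by (auto simp: eigensystem_def decseq_def)

lemma \<psi>_L2: "\<psi> j \<in> L2 \<mu>"
  using eigensystem by (simp add: eigensystem_def)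

lemma \<psi>_orthonormal: "L2_inner \<mu> (\<psi> i) (\<psi> j) = (if i = j then 1 else 0)"
  using eigensystem by (simp add: eigensystem_def)

lemma \<psi>_eigen: "AE x in \<mu>. A (\<psi> j) x = \<theta> j * \<psi> j x"
  using eigensystem by (simp add: eigensystem_def)

lemma eigenspace_complete:
  "\<lbrakk>c \<noteq> 0; f \<in> L2 \<mu>; AE x in \<mu>. A f x = c * f x; \<And>j. \<theta> j = c \<Longrightarrow> L2_inner \<mu> f (\<psi> j) = 0\<rbrakk>
    \<Longrightarrow> AE x in \<mu>. f x = 0"
  using eigensystem unfolding eigensystem_def by blast

lemma inner_A_\<psi>: "f \<in> L2 \<mu> \<Longrightarrow> L2_inner \<mu> (A (\<psi> j)) f = \<theta> j * L2_inner \<mu> f (\<psi> j)"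
proof -
  assume f: "f \<in> L2 \<mu>"
  have "L2_inner \<mu> (A (\<psi> j)) f = L2_inner \<mu> (\<lambda>x. \<theta> j * \<psi> j x) f"
    using \<psi>_eigen f A_L2[OF \<psi>_L2] L2_scale[OF \<psi>_L2]
    by (intro L2_inner_cong_AE L2_measurable)
  then show ?thesis by (simp add: L2_inner_scale_left L2_inner_commute)
qed

lemma inner_A_\<psi>': "f \<in> L2 \<mu> \<Longrightarrow> L2_inner \<mu> (A f) (\<psi> j) = \<theta> j * L2_inner \<mu> f (\<psi> j)"
  using inner_A_\<psi>[of f j] A_self_adjoint[OF _ \<psi>_L2, of f j] by (simp add: L2_inner_commute)

lemma \<theta>_nonneg: "0 \<le> \<theta> j"
  using psd[OF \<psi>_L2, of j] inner_A_\<psi>[OF \<psi>_L2, of j j] by (simp add: \<psi>_orthonormal)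

text \<open>
  The kernel \<open>T - (\<Sum>i<j. \<theta> i * (\<psi> i \<otimes> \<psi> i))\<close>. The eigenfunction \<open>\<psi> i\<close> is replaced by the bounded
  function \<open>A (\<psi> i) / \<theta> i\<close>, equal to it almost everywhere, to keep the kernel bounded; an index with
  \<open>\<theta> i = 0\<close> contributes nothing because of \<open>x / 0 = 0\<close>.
\<close>

definition deflated :: "nat \<Rightarrow> 'b \<Rightarrow> 'b \<Rightarrow> real" where
  "deflated j x y = T x y - (\<Sum>i<j. A (\<psi> i) x * A (\<psi> i) y / \<theta> i)"

lemma deflated_bounded_symmetric_kernel: "\<exists>C. bounded_symmetric_kernel \<mu> (deflated j) C"
proof -
  define E where "E i = B * (\<integral>y. \<bar>\<psi> i y\<bar> \<partial>\<mu>)" for i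
  have E: "\<bar>A (\<psi> i) x\<bar> \<le> E i" for i x
    unfolding E_def by (rule A_bounded[OF \<psi>_L2])
  have [measurable]: "A (\<psi> i) \<in> borel_measurable \<mu>" for i
    by (intro A_measurable L2_measurable \<psi>_L2)
  have "bounded_symmetric_kernel \<mu> (deflated j) (B + (\<Sum>i<j. E i * E i / \<bar>\<theta> i\<bar>))"
  proof
    show "(\<lambda>(x, y). deflated j x y) \<in> borel_measurable (\<mu> \<Otimes>\<^sub>M \<mu>)"
      unfolding deflated_def by measurable
    show "deflated j x y = deflated j y x" for x y
      by (simp add: deflated_def T_symmetric[of x y] mult.commute)
    show "\<bar>deflated j x y\<bar> \<le> B + (\<Sum>i<j. E i * E i / \<bar>\<theta> i\<bar>)" for x y
    proof -
      have "\<bar>A (\<psi> i) x * A (\<psi> i) y / \<theta> i\<bar> \<le> E i * E i / \<bar>\<theta> i\<bar>" for i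
        unfolding abs_divide abs_mult by (intro divide_right_mono mult_mono' E) auto
      then have "\<bar>\<Sum>i<j. A (\<psi> i) x * A (\<psi> i) y / \<theta> i\<bar> \<le> (\<Sum>i<j. E i * E i / \<bar>\<theta> i\<bar>)"
        by (rule order_trans[OF sum_abs sum_mono])
      then show ?thesis unfolding deflated_def using T_bounded[of x y] by linarith
    qed
  qed
  then show ?thesis ..
qed

lemma deflated_eq_AE:
  assumes f: "f \<in> L2 \<mu>"
  shows "AE x in \<mu>. integral_operator \<mu> (deflated j) f x
    = A f x - (\<Sum>i<j. (\<theta> i * L2_inner \<mu> f (\<psi> i)) * \<psi> i x)"
proof -
  have "AE x in \<mu>. \<forall>i\<in>{..<j}. A (\<psi> i) x = \<theta> i * \<psi> i x"
    using \<psi>_eigen by (intro AE_finite_allI) auto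
  with AE_space show ?thesis
  proof eventually_elim
    fix x assume x: "x \<in> space \<mu>" and eq: "\<forall>i\<in>{..<j}. A (\<psi> i) x = \<theta> i * \<psi> i x"
    have i: "integrable \<mu> (\<lambda>y. A (\<psi> i) y * f y)" for i
      by (intro L2_integrable_mult A_L2 \<psi>_L2 f)
    have "integral_operator \<mu> (deflated j) f x
        = (\<integral>y. T x y * f y - (\<Sum>i<j. (A (\<psi> i) x / \<theta> i) * (A (\<psi> i) y * f y)) \<partial>\<mu>)"
      unfolding integral_operator_def deflated_def
      by (simp add: left_diff_distrib sum_distrib_right mult.assoc)
    also have "\<dots> = A f x - (\<Sum>i<j. (A (\<psi> i) x / \<theta> i) * L2_inner \<mu> (A (\<psi> i)) f)"
      using i L2_integrable_mult[OF section_L2[OF x] f]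
      by (subst Bochner_Integration.integral_diff)
         (auto intro!: Bochner_Integration.integrable_sum simp: integral_operator_def[of \<mu> T f]
           L2_inner_def[of \<mu> "A _" f] Bochner_Integration.integral_sum)
    also have "(\<Sum>i<j. (A (\<psi> i) x / \<theta> i) * L2_inner \<mu> (A (\<psi> i)) f)
        = (\<Sum>i<j. (\<theta> i * L2_inner \<mu> f (\<psi> i)) * \<psi> i x)"
      using eq by (intro sum.cong) (auto simp: inner_A_\<psi>[OF f])
    finally show "integral_operator \<mu> (deflated j) f x
      = A f x - (\<Sum>i<j. (\<theta> i * L2_inner \<mu> f (\<psi> i)) * \<psi> i x)" .
  qed
qed

lemma deflated_L2: "f \<in> L2 \<mu> \<Longrightarrow> integral_operator \<mu> (deflated j) f \<in> L2 \<mu>"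
  using deflated_bounded_symmetric_kernel[of j] bounded_symmetric_kernel.A_L2 by blast

lemma deflated_orthogonal:
  assumes f: "f \<in> L2 \<mu>" and l: "l < j"
  shows "L2_inner \<mu> (integral_operator \<mu> (deflated j) f) (\<psi> l) = 0"
proof -
  have sL: "(\<lambda>x. \<Sum>i<j. (\<theta> i * L2_inner \<mu> f (\<psi> i)) * \<psi> i x) \<in> L2 \<mu>"
    by (intro L2_sum L2_scale \<psi>_L2)
  have "L2_inner \<mu> (integral_operator \<mu> (deflated j) f) (\<psi> l)
      = L2_inner \<mu> (\<lambda>x. A f x - (\<Sum>i<j. (\<theta> i * L2_inner \<mu> f (\<psi> i)) * \<psi> i x)) (\<psi> l)"
    using deflated_eq_AE[OF f] deflated_L2[OF f] L2_diff[OF A_L2[OF f] sL] \<psi>_L2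
    by (intro L2_inner_cong_AE) (auto dest: L2_measurable)
  also have "\<dots> = L2_inner \<mu> (A f) (\<psi> l)
      - (\<Sum>i<j. L2_inner \<mu> (\<lambda>x. (\<theta> i * L2_inner \<mu> f (\<psi> i)) * \<psi> i x) (\<psi> l))"
    using sL by (simp add: L2_inner_diff_left A_L2 f \<psi>_L2 L2_inner_sum_left L2_scale)
  also have "(\<Sum>i<j. L2_inner \<mu> (\<lambda>x. (\<theta> i * L2_inner \<mu> f (\<psi> i)) * \<psi> i x) (\<psi> l))
      = \<theta> l * L2_inner \<mu> f (\<psi> l)"
    using l by (simp only: L2_inner_scale_left \<psi>_orthonormal) (simp add: if_distrib cong: if_cong)
  finally show ?thesis by (simp add: inner_A_\<psi>'[OF f])
qed

text \<open>
  An eigenvalue of the deflated operator whose modulus exceeds \<open>\<theta> j\<close> would be an eigenvalue of \<open>A\<close>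
  with an eigenfunction orthogonal to all \<open>\<psi> i\<close> of the same eigenvalue: a positive one contradicts
  the completeness of the eigensystem, a negative one contradicts positivity.
\<close>

lemma deflated_opnorm_sq_le:
  "bounded_symmetric_kernel.opnorm_sq \<mu> (deflated j) \<le> (\<theta> j)\<^sup>2"
proof (rule ccontr)
  assume *: "\<not> ?thesis"
  obtain C where "bounded_symmetric_kernel \<mu> (deflated j) C"
    using deflated_bounded_symmetric_kernel by blast
  then interpret D: bounded_symmetric_kernel \<mu> "deflated j" C .
  let ?k = "D.opnorm_sq"
  have kpos: "0 < ?k" using * zero_le_power2[of "\<theta> j"] by linarith
  define c where "c = sqrt ?k"
  have c2: "c * c = ?k" using kpos by (simp add: c_def)
  have c: "\<theta> j < c" using * unfolding c_def by (intro real_less_rsqrt) auto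
  have cpos: "0 < c" using kpos by (simp add: c_def)
  obtain g where g: "g \<in> L2 \<mu>" "0 < L2_inner \<mu> g g"
      "\<And>x. x \<in> space \<mu> \<Longrightarrow> D.A (D.A g) x = ?k * g x"
    using D.opnorm_sq_attained[OF kpos] by blast
  have Dg: "D.A g \<in> L2 \<mu>" "D.A (D.A g) \<in> L2 \<mu>" using g by (auto intro: D.A_L2)
  have orth1: "L2_inner \<mu> (D.A g) (\<psi> l) = 0" if "l < j" for l
    using deflated_orthogonal[OF g(1) that] .
  have orth0: "L2_inner \<mu> g (\<psi> l) = 0" if "l < j" for l
  proof -
    have "?k * L2_inner \<mu> g (\<psi> l) = L2_inner \<mu> (D.A (D.A g)) (\<psi> l)"
      unfolding L2_inner_scale_left[symmetric] using g(1,3) Dg(2) \<psi>_L2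
      by (intro L2_inner_cong_AE) (auto dest: L2_measurable)
    then show ?thesis using deflated_orthogonal[OF Dg(1) that] kpos by simp
  qed
  have eq: "AE x in \<mu>. A g x = D.A g x" "AE x in \<mu>. A (D.A g) x = ?k * g x"
    using deflated_eq_AE[OF g(1), of j] deflated_eq_AE[OF Dg(1), of j] AE_space g(3)
    by (auto simp: orth0 orth1)
  \<comment> \<open>\<open>g\<close> is an eigenfunction of the square of the deflated operator; \<open>h\<close> solves the eigenvalue
    equation for the positive root \<open>c\<close>, unless it vanishes and \<open>g\<close> itself belongs to \<open>- c\<close>.\<close>
  define h where "h = (\<lambda>x. D.A g x + c * g x)"
  have hL: "h \<in> L2 \<mu>" unfolding h_def using g Dg by (intro L2_add L2_scale)
  have "AE x in \<mu>. A h x = c * h x"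
    using eq AE_space
  proof eventually_elim
    case (elim x)
    have "A h x = A (D.A g) x + c * A g x"
      unfolding h_def using A_add[OF elim(3) Dg(1) L2_scale[OF g(1)], of c] by (simp add: A_scale)
    then show ?case using elim by (simp add: h_def distrib_left flip: c2)
  qed
  moreover have "L2_inner \<mu> h (\<psi> i) = 0" if "\<theta> i = c" for i
  proof -
    have "i < j" using \<theta>_antimono[of j i] c that by (meson not_le)
    then show ?thesis
      unfolding h_def using orth0 orth1 g(1) Dg(1) \<psi>_L2
      by (simp add: L2_inner_add_left L2_scale L2_inner_scale_left)
  qed
  ultimately have "AE x in \<mu>. h x = 0"
    using cpos hL by (intro eigenspace_complete[of c h]) auto
  with eq(1) have "AE x in \<mu>. A g x = (- c) * g x"
    by eventually_elim (simp add: h_def)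
  then have "L2_inner \<mu> (A g) g = L2_inner \<mu> (\<lambda>x. (- c) * g x) g"
    using A_L2[OF g(1)] L2_scale[OF g(1)] g(1) by (intro L2_inner_cong_AE) (auto dest: L2_measurable)
  then have "L2_inner \<mu> (A g) g = - (c * L2_inner \<mu> g g)"
    by (simp only: L2_inner_scale_left)
  then show False using psd[OF g(1)] mult_pos_pos[OF cpos g(2)] by linarith
qed

lemma norm_A_le:
  assumes f: "f \<in> L2 \<mu>" and orth: "\<And>i. i < j \<Longrightarrow> L2_inner \<mu> f (\<psi> i) = 0"
  shows "L2_norm \<mu> (A f) \<le> \<theta> j * L2_norm \<mu> f"
proof -
  obtain C where "bounded_symmetric_kernel \<mu> (deflated j) C"
    using deflated_bounded_symmetric_kernel by blast
  then interpret D: bounded_symmetric_kernel \<mu> "deflated j" C .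
  have "L2_norm \<mu> (A f) = L2_norm \<mu> (D.A f)"
    using deflated_eq_AE[OF f, of j] A_L2[OF f] D.A_L2[OF f]
    by (intro L2_norm_cong_AE) (auto simp: orth dest: L2_measurable)
  also have "\<dots> \<le> \<theta> j * L2_norm \<mu> f"
  proof (rule power2_le_imp_le)
    have "(L2_norm \<mu> (D.A f))\<^sup>2 \<le> D.opnorm_sq * (L2_norm \<mu> f)\<^sup>2"
      using D.iter_sq_one_le[OF f] by (simp add: D.iter_sq_def L2_norm_square)
    also have "\<dots> \<le> (\<theta> j)\<^sup>2 * (L2_norm \<mu> f)\<^sup>2"
      using deflated_opnorm_sq_le by (intro mult_right_mono) auto
    finally show "(L2_norm \<mu> (D.A f))\<^sup>2 \<le> (\<theta> j * L2_norm \<mu> f)\<^sup>2"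
      by (simp add: power_mult_distrib)
  qed (simp add: \<theta>_nonneg)
  finally show ?thesis .
qed

end

lemma HS_norm_bounds_operator:
  assumes "bounded_symmetric_kernel \<mu> K B" and f: "f \<in> L2 \<mu>"
  shows "L2_norm \<mu> (integral_operator \<mu> K f) \<le> HS_norm \<mu> K * L2_norm \<mu> f"
proof -
  interpret bounded_symmetric_kernel \<mu> K B by fact
  interpret P: finite_measure "\<mu> \<Otimes>\<^sub>M \<mu>"
    by (rule finite_measure_pair_measure) unfold_locales
  have i: "integrable (\<mu> \<Otimes>\<^sub>M \<mu>) (\<lambda>(x, y). K x y * K x y)"
  proof (rule P.integrable_const_bound[where B="B * B"])
    have "\<bar>K x y * K x y\<bar> \<le> B * B" for x y
      using mult_mono'[OF T_bounded T_bounded] by (simp only: abs_mult abs_ge_zero)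
    then show "AE z in \<mu> \<Otimes>\<^sub>M \<mu>. norm (case z of (x, y) \<Rightarrow> K x y * K x y) \<le> B * B"
      by (auto simp: split_beta)
  qed measurable
  have "iter_trace 0 = (\<integral>x. (\<integral>y. K x y * K x y \<partial>\<mu>) \<partial>\<mu>)"
    by (simp add: iter_trace_def iter_sq_zero L2_inner_def)
  also have "\<dots> = (\<integral>z. (case z of (x, y) \<Rightarrow> K x y * K x y) \<partial>(\<mu> \<Otimes>\<^sub>M \<mu>))"
    using integral_fst'[OF i] by simp
  also have "\<dots> = (HS_norm \<mu> K)\<^sup>2"
    by (simp add: HS_norm_def L2_norm_square L2_inner_def split_beta)
  finally have tr: "iter_trace 0 = (HS_norm \<mu> K)\<^sup>2" .
  show ?thesis
  proof (rule power2_le_imp_le)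
    show "(L2_norm \<mu> (A f))\<^sup>2 \<le> (HS_norm \<mu> K * L2_norm \<mu> f)\<^sup>2"
      using iter_sq_Suc_le_trace[OF section_sq_integrable f]
      by (simp add: tr iter_sq_def L2_norm_square power_mult_distrib)
  qed (simp add: HS_norm_def)
qed

text \<open>
  One half of Weyl's inequality, in the style of the min-max principle: some nonzero combination of
  \<open>\<psi>' 0, \<dots>, \<psi>' j\<close> is orthogonal to \<open>\<psi> 0, \<dots>, \<psi> (j - 1)\<close>, and the two quadratic forms are compared on
  it.
\<close>

lemma eigenvalue_le_perturbed_eigenvalue:
  assumes "psd_eigensystem \<mu> K B \<theta> \<psi>" and "psd_eigensystem \<mu> K' B' \<theta>' \<psi>'"
    and close: "\<And>f. f \<in> L2 \<mu> \<Longrightarrow>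
      L2_norm \<mu> (\<lambda>x. integral_operator \<mu> K' f x - integral_operator \<mu> K f x) \<le> \<delta> * L2_norm \<mu> f"
  shows "\<theta>' j \<le> \<theta> j + \<delta>"
proof -
  interpret K: psd_eigensystem \<mu> K B \<theta> \<psi> by fact
  interpret K': psd_eigensystem \<mu> K' B' \<theta>' \<psi>' by fact
  obtain c where c: "\<exists>i\<in>{..j}. c i \<noteq> 0"
      "\<forall>l\<in>{..<j}. (\<Sum>i\<in>{..j}. c i * L2_inner \<mu> (\<psi>' i) (\<psi> l)) = 0"
    using ex_nontrivial_solution[of "{..<j}" "{..j}" "\<lambda>i l. L2_inner \<mu> (\<psi>' i) (\<psi> l)"] by auto
  define f where "f = (\<lambda>x. \<Sum>i\<le>j. c i * \<psi>' i x)"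
  have cL: "(\<lambda>x. c i * \<psi>' i x) \<in> L2 \<mu>" for i by (intro L2_scale K'.\<psi>_L2)
  have fL: "f \<in> L2 \<mu>" unfolding f_def by (intro L2_sum cL)
  have f_inner: "L2_inner \<mu> f g = (\<Sum>i\<le>j. c i * L2_inner \<mu> (\<psi>' i) g)" if "g \<in> L2 \<mu>" for g
    unfolding f_def using that cL by (simp add: L2_inner_sum_left L2_inner_scale_left)
  have orth: "L2_inner \<mu> f (\<psi> l) = 0" if "l < j" for l
    using c(2) that by (simp add: f_inner[OF K.\<psi>_L2])
  have coef: "L2_inner \<mu> f (\<psi>' i) = c i" if "i \<le> j" for i
    using that by (simp add: f_inner[OF K'.\<psi>_L2] K'.\<psi>_orthonormal if_distrib cong: if_cong)
  have ff: "L2_inner \<mu> f f = (\<Sum>i\<le>j. c i * c i)"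
    unfolding f_inner[OF fL] by (intro sum.cong) (auto simp: coef L2_inner_commute[of \<mu> _ f])
  have pos: "0 < L2_inner \<mu> f f"
  proof -
    obtain i where "i \<le> j" "c i \<noteq> 0" using c(1) by auto
    then show ?thesis unfolding ff
      by (intro sum_pos2[of _ i]) (auto simp: not_sum_power2_lt_zero zero_less_mult_iff linorder_neq_iff)
  qed
  have "\<theta>' j * L2_inner \<mu> f f \<le> L2_inner \<mu> f (K'.A f)"
  proof -
    have "L2_inner \<mu> f (K'.A f) = (\<Sum>i\<le>j. \<theta>' i * (c i * c i))"
      unfolding f_inner[OF K'.A_L2[OF fL]]
      by (intro sum.cong) (auto simp: L2_inner_commute[of \<mu> _ "K'.A f"] K'.inner_A_\<psi>'[OF fL] coef)
    moreover have "\<theta>' j * L2_inner \<mu> f f \<le> \<dots>"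
      unfolding ff sum_distrib_left by (intro sum_mono mult_right_mono K'.\<theta>_antimono) auto
    ultimately show ?thesis by simp
  qed
  also have "\<dots> = L2_inner \<mu> f (K.A f) + L2_inner \<mu> f (\<lambda>x. K'.A f x - K.A f x)"
    using fL by (simp add: L2_inner_diff_right K.A_L2 K'.A_L2)
  also have "\<dots> \<le> L2_norm \<mu> f * (\<theta> j * L2_norm \<mu> f) + L2_norm \<mu> f * (\<delta> * L2_norm \<mu> f)"
  proof (rule add_mono)
    have "L2_inner \<mu> f (K.A f) \<le> L2_norm \<mu> f * L2_norm \<mu> (K.A f)"
      using L2_Cauchy_Schwarz[OF fL K.A_L2[OF fL]] by simp
    also have "\<dots> \<le> L2_norm \<mu> f * (\<theta> j * L2_norm \<mu> f)"
      using K.norm_A_le[OF fL orth] by (intro mult_left_mono) auto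
    finally show "L2_inner \<mu> f (K.A f) \<le> L2_norm \<mu> f * (\<theta> j * L2_norm \<mu> f)" .
    have "L2_inner \<mu> f (\<lambda>x. K'.A f x - K.A f x)
        \<le> L2_norm \<mu> f * L2_norm \<mu> (\<lambda>x. K'.A f x - K.A f x)"
      using L2_Cauchy_Schwarz[OF fL L2_diff[OF K'.A_L2[OF fL] K.A_L2[OF fL]]] by simp
    also have "\<dots> \<le> L2_norm \<mu> f * (\<delta> * L2_norm \<mu> f)"
      using close[OF fL] by (intro mult_left_mono) auto
    finally show "L2_inner \<mu> f (\<lambda>x. K'.A f x - K.A f x) \<le> L2_norm \<mu> f * (\<delta> * L2_norm \<mu> f)" .
  qed
  also have "\<dots> = (\<theta> j + \<delta>) * L2_inner \<mu> f f"
    by (simp add: L2_norm_square[symmetric] power2_eq_square algebra_simps)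
  finally show ?thesis using pos by simp
qed

lemma bounded_symmetric_kernel_diff:
  assumes "bounded_symmetric_kernel \<mu> K B" "bounded_symmetric_kernel \<mu> K' B'"
  shows "bounded_symmetric_kernel \<mu> (\<lambda>x y. K' x y - K x y) (B' + B)"
proof -
  interpret K: bounded_symmetric_kernel \<mu> K B by fact
  interpret K': bounded_symmetric_kernel \<mu> K' B' by fact
  show ?thesis
  proof
    show "\<bar>K' x y - K x y\<bar> \<le> B' + B" for x y
      using K.T_bounded[of x y] K'.T_bounded[of x y] by linarith
    show "K' x y - K x y = K' y x - K y x" for x y
      by (simp add: K.T_symmetric[of x y] K'.T_symmetric[of x y])
  qed measurable
qed

lemma operator_diff_le_HS_norm:
  assumes "bounded_symmetric_kernel \<mu> K B" "bounded_symmetric_kernel \<mu> K' B'" "f \<in> L2 \<mu>"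
  shows "L2_norm \<mu> (\<lambda>x. integral_operator \<mu> K' f x - integral_operator \<mu> K f x)
    \<le> HS_norm \<mu> (\<lambda>x y. K' x y - K x y) * L2_norm \<mu> f"
proof -
  interpret K: bounded_symmetric_kernel \<mu> K B by fact
  interpret K': bounded_symmetric_kernel \<mu> K' B' by fact
  interpret D: bounded_symmetric_kernel \<mu> "\<lambda>x y. K' x y - K x y" "B' + B"
    by (rule bounded_symmetric_kernel_diff[OF assms(1,2)])
  have "K'.A f x - K.A f x = D.A f x" if "x \<in> space \<mu>" for x
    using L2_inner_diff_left[OF K'.section_L2[OF that] K.section_L2[OF that] assms(3)]
    by (simp add: K.A_eq K'.A_eq D.A_eq)
  then have "L2_norm \<mu> (\<lambda>x. K'.A f x - K.A f x) = L2_norm \<mu> (D.A f)"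
    using assms(3) by (intro L2_norm_cong_AE) (auto intro!: K.A_L2 K'.A_L2 D.A_L2 L2_measurable L2_diff)
  then show ?thesis
    using HS_norm_bounds_operator[OF D.bounded_symmetric_kernel_axioms assms(3)] by simp
qed

text \<open>
  Weyl's inequality for the eigenvalues of positive semidefinite integral operators.
\<close>

theorem eigenvalue_perturbation:
  assumes "psd_eigensystem \<mu> K B \<theta> \<psi>" and "psd_eigensystem \<mu> K' B' \<theta>' \<psi>'"
  shows "\<bar>\<theta>' j - \<theta> j\<bar> \<le> HS_norm \<mu> (\<lambda>x y. K' x y - K x y)"
proof -
  have K: "bounded_symmetric_kernel \<mu> K B" "bounded_symmetric_kernel \<mu> K' B'"
    using assms by (auto dest: psd_eigensystem.axioms)
  have sym: "HS_norm \<mu> (\<lambda>x y. K x y - K' x y) = HS_norm \<mu> (\<lambda>x y. K' x y - K x y)"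
    unfolding HS_norm_def L2_norm_def L2_inner_def
    by (intro arg_cong[where f=sqrt] Bochner_Integration.integral_cong) (auto simp: algebra_simps)
  have "\<theta>' j \<le> \<theta> j + HS_norm \<mu> (\<lambda>x y. K' x y - K x y)"
    by (rule eigenvalue_le_perturbed_eigenvalue[OF assms]) (rule operator_diff_le_HS_norm[OF K])
  moreover have "\<theta> j \<le> \<theta>' j + HS_norm \<mu> (\<lambda>x y. K x y - K' x y)"
    by (rule eigenvalue_le_perturbed_eigenvalue[OF assms(2,1)]) (rule operator_diff_le_HS_norm[OF K(2,1)])
  ultimately show ?thesis using sym by auto
qed

text \<open>
  The perturbed eigenfunction \<open>v = \<psi>' j\<close> is almost an eigenfunction of the unperturbed operator:
  \<open>w = A v - \<theta> j * v\<close> has norm at most \<open>2 * d\<close>, where \<open>d\<close> is the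
  Hilbert-Schmidt distance of the kernels. The coefficients of \<open>v\<close> along \<open>\<psi> i\<close> for \<open>i < j\<close> and
  its component \<open>r\<close> orthogonal to \<open>\<psi> 0, \<dots>, \<psi> j\<close> are then small because \<open>A - \<theta> j\<close> is bounded below by
  the spectral gap \<open>g\<close> there. Hence \<open>v\<close> is close to its projection on \<open>\<psi> j\<close>, and the choice of
  sign makes it close to \<open>\<psi> j\<close> itself.
\<close>

theorem eigenvector_perturbation:
  assumes "psd_eigensystem \<mu> K B \<theta> \<psi>" and "psd_eigensystem \<mu> K' B' \<theta>' \<psi>'"
    and gap: "0 < g" "\<And>i. i < j \<Longrightarrow> g \<le> \<bar>\<theta> i - \<theta> j\<bar>" "g \<le> \<theta> j - \<theta> (Suc j)"
    and sign: "0 \<le> L2_inner \<mu> (\<psi>' j) (\<psi> j)"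
  shows "L2_norm \<mu> (\<lambda>x. \<psi>' j x - \<psi> j x)
    \<le> (8 * (real j + 1) / g) * HS_norm \<mu> (\<lambda>x y. K' x y - K x y)"
proof -
  interpret K: psd_eigensystem \<mu> K B \<theta> \<psi> by fact
  interpret K': psd_eigensystem \<mu> K' B' \<theta>' \<psi>' by fact
  define d where "d = HS_norm \<mu> (\<lambda>x y. K' x y - K x y)"
  have d0: "0 \<le> d" by (simp add: d_def HS_norm_def)
  define v where "v = \<psi>' j"
  have vL: "v \<in> L2 \<mu>" by (simp add: v_def K'.\<psi>_L2)
  have vn: "L2_inner \<mu> v v = 1" by (simp add: v_def K'.\<psi>_orthonormal)
  define b where "b i = L2_inner \<mu> v (\<psi> i)" for i
  define w where "w = (\<lambda>x. K.A v x - \<theta> j * v x)"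
  have AvL: "K.A v \<in> L2 \<mu>" by (intro K.A_L2 vL)
  have wL: "w \<in> L2 \<mu>" unfolding w_def by (intro L2_diff AvL L2_scale vL)
  have wn: "L2_norm \<mu> w \<le> 2 * d"
  proof -
    let ?u = "\<lambda>x. (\<theta>' j - \<theta> j) * v x"
    have uL: "?u \<in> L2 \<mu>" by (intro L2_scale vL)
    have eL: "(\<lambda>x. K'.A v x - K.A v x) \<in> L2 \<mu>" by (intro L2_diff K'.A_L2 AvL vL)
    have "AE x in \<mu>. w x = ?u x - (K'.A v x - K.A v x)"
      using K'.\<psi>_eigen[of j] by eventually_elim (simp add: w_def v_def algebra_simps)
    then have "L2_norm \<mu> w = L2_norm \<mu> (\<lambda>x. ?u x - (K'.A v x - K.A v x))"
      using wL uL eL by (intro L2_norm_cong_AE L2_measurable[OF L2_diff] L2_measurable)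
    also have "\<dots> \<le> L2_norm \<mu> ?u + L2_norm \<mu> (\<lambda>x. K'.A v x - K.A v x)"
      by (rule L2_norm_triangle_diff[OF uL eL])
    also have "L2_norm \<mu> ?u \<le> d"
      using eigenvalue_perturbation[OF assms(1,2), of j]
      by (simp only: L2_norm_scale d_def) (simp add: L2_norm_def vn)
    also have "L2_norm \<mu> (\<lambda>x. K'.A v x - K.A v x) \<le> d"
      using operator_diff_le_HS_norm[OF K.bounded_symmetric_kernel_axioms
          K'.bounded_symmetric_kernel_axioms vL]
      by (simp add: d_def L2_norm_def[of \<mu> v] vn)
    finally show ?thesis by simp
  qed
  have w_coef: "L2_inner \<mu> w (\<psi> i) = (\<theta> i - \<theta> j) * b i" for i
    unfolding w_def b_def using AvL vL K.\<psi>_L2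
    by (simp add: L2_inner_diff_left L2_scale L2_inner_scale_left K.inner_A_\<psi>' left_diff_distrib)
  have w_coef_le: "\<bar>(\<theta> i - \<theta> j) * b i\<bar> \<le> 2 * d" for i
    using L2_Cauchy_Schwarz[OF wL K.\<psi>_L2, of i] wn
    by (simp add: w_coef L2_norm_def[of \<mu> "\<psi> i"] K.\<psi>_orthonormal)
  have b_le: "\<bar>b i\<bar> \<le> 2 * d / g" if "i < j" for i
  proof -
    have "g * \<bar>b i\<bar> \<le> \<bar>(\<theta> i - \<theta> j) * b i\<bar>"
      unfolding abs_mult using gap(2)[OF that] by (intro mult_right_mono) auto
    then show ?thesis using w_coef_le[of i] gap(1) by (simp add: field_simps)
  qed
  define P where "P = (\<lambda>x. \<Sum>i\<le>j. b i * \<psi> i x)"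
  \<comment> \<open>\<open>P\<close> is the projection of \<open>v\<close> on the span of \<open>\<psi> 0, \<dots>, \<psi> j\<close>.\<close>
  define r where "r = (\<lambda>x. v x - P x)"
  have PL: "P \<in> L2 \<mu>" unfolding P_def by (intro L2_sum L2_scale K.\<psi>_L2)
  have rL: "r \<in> L2 \<mu>" unfolding r_def by (intro L2_diff vL PL)
  have P_coef: "L2_inner \<mu> P (\<psi> l) = b l" if "l \<le> j" for l
    unfolding P_def using that
    by (simp add: L2_inner_sum_left L2_scale K.\<psi>_L2 L2_inner_scale_left K.\<psi>_orthonormal
        if_distrib cong: if_cong)
  have r_orth: "L2_inner \<mu> r (\<psi> l) = 0" if "l < Suc j" for l
    unfolding r_def using that by (simp add: L2_inner_diff_left vL PL K.\<psi>_L2 P_coef b_def)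
  have ArL: "K.A r \<in> L2 \<mu>" by (intro K.A_L2 rL)
  define S where "S = (\<lambda>x. \<Sum>i\<le>j. ((\<theta> i - \<theta> j) * b i) * \<psi> i x)"
  have SL: "S \<in> L2 \<mu>" unfolding S_def by (intro L2_sum L2_scale K.\<psi>_L2)
  have "AE x in \<mu>. \<forall>i\<in>{..j}. K.A (\<psi> i) x = \<theta> i * \<psi> i x"
    using K.\<psi>_eigen by (intro AE_finite_allI) auto
  with AE_space have r_eq: "AE x in \<mu>. K.A r x - \<theta> j * r x = w x - S x"
  proof eventually_elim
    case (elim x)
    have "K.A r x = K.A v x - K.A P x"
      unfolding r_def using elim vL PL by (intro K.A_diff)
    also have "K.A P x = (\<Sum>i\<le>j. b i * K.A (\<psi> i) x)"
      unfolding P_def using elim(1) by (subst K.A_sum) (auto intro: L2_scale K.\<psi>_L2 simp: K.A_scale)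
    also have "\<dots> = S x + \<theta> j * P x"
      unfolding S_def P_def sum_distrib_left sum.distrib[symmetric]
      using elim(2) by (intro sum.cong) (auto simp: algebra_simps)
    finally show ?case by (simp add: w_def r_def algebra_simps)
  qed
  have S_le: "L2_norm \<mu> S \<le> (real j + 1) * (2 * d)"
  proof -
    have "L2_norm \<mu> S \<le> (\<Sum>i\<le>j. L2_norm \<mu> (\<lambda>x. ((\<theta> i - \<theta> j) * b i) * \<psi> i x))"
      unfolding S_def by (intro L2_norm_sum_le L2_scale K.\<psi>_L2)
    also have "\<dots> \<le> (\<Sum>i\<le>j. 2 * d)"
      using w_coef_le
      by (intro sum_mono) (simp only: L2_norm_scale, simp add: L2_norm_def K.\<psi>_orthonormal)
    finally show ?thesis by (simp add: add.commute)
  qed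
  have r_le: "g * L2_norm \<mu> r \<le> (real j + 2) * (2 * d)"
  proof -
    have "\<theta> j * L2_norm \<mu> r = L2_norm \<mu> (\<lambda>x. \<theta> j * r x)"
      by (simp only: L2_norm_scale abs_of_nonneg[OF K.\<theta>_nonneg])
    also have "\<dots> = L2_norm \<mu> (\<lambda>x. K.A r x - (w x - S x))"
      using r_eq rL ArL wL SL
      by (intro L2_norm_cong_AE L2_measurable L2_scale L2_diff) (auto simp: algebra_simps)
    also have "\<dots> \<le> L2_norm \<mu> (K.A r) + L2_norm \<mu> (\<lambda>x. w x - S x)"
      by (intro L2_norm_triangle_diff ArL L2_diff wL SL)
    also have "L2_norm \<mu> (K.A r) \<le> \<theta> (Suc j) * L2_norm \<mu> r"
      by (rule K.norm_A_le[OF rL r_orth])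
    also have "L2_norm \<mu> (\<lambda>x. w x - S x) \<le> 2 * d + (real j + 1) * (2 * d)"
      using L2_norm_triangle_diff[OF wL SL] wn S_le by linarith
    finally have "(\<theta> j - \<theta> (Suc j)) * L2_norm \<mu> r \<le> 2 * d + (real j + 1) * (2 * d)"
      by (simp add: algebra_simps)
    moreover have "g * L2_norm \<mu> r \<le> (\<theta> j - \<theta> (Suc j)) * L2_norm \<mu> r"
      using gap(3) by (intro mult_right_mono) auto
    ultimately show ?thesis by (simp add: algebra_simps)
  qed
  define e where "e = L2_norm \<mu> (\<lambda>x. v x - b j * \<psi> j x)"
  have bjL: "(\<lambda>x. b j * \<psi> j x) \<in> L2 \<mu>" by (intro L2_scale K.\<psi>_L2)
  have e_le: "e \<le> 4 * (real j + 1) * d / g"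
  proof -
    have sL: "(\<lambda>x. \<Sum>i<j. b i * \<psi> i x) \<in> L2 \<mu>" by (intro L2_sum L2_scale K.\<psi>_L2)
    have "(\<lambda>x. v x - b j * \<psi> j x) = (\<lambda>x. r x + (\<Sum>i<j. b i * \<psi> i x))"
      by (simp add: r_def P_def lessThan_Suc_atMost[symmetric] algebra_simps)
    then have "e \<le> L2_norm \<mu> r + L2_norm \<mu> (\<lambda>x. \<Sum>i<j. b i * \<psi> i x)"
      unfolding e_def using L2_norm_triangle[OF rL sL] by simp
    also have "L2_norm \<mu> (\<lambda>x. \<Sum>i<j. b i * \<psi> i x) \<le> (\<Sum>i<j. L2_norm \<mu> (\<lambda>x. b i * \<psi> i x))"
      by (intro L2_norm_sum_le L2_scale K.\<psi>_L2)
    also have "\<dots> \<le> (\<Sum>i<j. 2 * d / g)"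
      using b_le by (intro sum_mono) (simp only: L2_norm_scale, simp add: L2_norm_def K.\<psi>_orthonormal)
    also have "L2_norm \<mu> r \<le> (real j + 2) * (2 * d) / g"
      using r_le gap(1) by (simp add: field_simps)
    finally have "e \<le> (real j + 2) * (2 * d) / g + real j * (2 * d / g)" by simp
    also have "\<dots> = 4 * (real j + 1) * d / g" using gap(1) by (simp add: field_simps)
    finally show ?thesis .
  qed
  have e2: "e\<^sup>2 = 1 - (b j)\<^sup>2"
    unfolding e_def L2_norm_square L2_inner_diff_self[OF vL bjL] L2_inner_scale_left L2_inner_scale_right
    by (simp add: vn b_def K.\<psi>_orthonormal power2_eq_square)
  have bj: "0 \<le> b j" "b j \<le> 1"
  proof -
    show "0 \<le> b j" using sign by (simp add: b_def v_def)
    have "(b j)\<^sup>2 \<le> 1\<^sup>2" using e2 zero_le_power2[of e] by simp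
    then show "b j \<le> 1" by (rule power2_le_imp_le) simp
  qed
  have "(L2_norm \<mu> (\<lambda>x. v x - \<psi> j x))\<^sup>2 = 2 - 2 * b j"
    unfolding L2_norm_square L2_inner_diff_self[OF vL K.\<psi>_L2] by (simp add: vn b_def K.\<psi>_orthonormal)
  also have "\<dots> \<le> 2 * e\<^sup>2"
    using mult_left_mono[OF bj(2,1)] unfolding e2 by (simp add: power2_eq_square)
  also have "\<dots> \<le> (2 * e)\<^sup>2" by (simp add: power_mult_distrib)
  finally have "L2_norm \<mu> (\<lambda>x. v x - \<psi> j x) \<le> 2 * e"
    by (rule power2_le_imp_le) (simp add: e_def)
  also have "\<dots> \<le> 2 * (4 * (real j + 1) * d / g)" using e_le by simp
  also have "\<dots> = (8 * (real j + 1) / g) * d" by simp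
  finally show ?thesis by (simp add: v_def d_def)
qed

section \<open>Lagged kernels\<close>

lemma (in finite_measure) integrable_tensor_bounded:
  fixes f :: "'a \<Rightarrow> real" and H :: "'a \<Rightarrow> 'a \<Rightarrow> real"
  assumes f: "integrable M f" and [measurable]: "(\<lambda>(x, z). H x z) \<in> borel_measurable (M \<Otimes>\<^sub>M M)"
    and H: "\<And>x z. \<bar>H x z\<bar> \<le> c"
  shows "integrable (M \<Otimes>\<^sub>M M) (\<lambda>(x, z). f x * H x z)"
proof -
  have [measurable]: "f \<in> borel_measurable M" using f by auto
  have sf: "sigma_finite_measure M" by unfold_locales
  have "integrable (M \<Otimes>\<^sub>M M) (\<lambda>(x, z). f x * c)"
    by (rule integrable_tensor[OF sf sf f]) simp
  then show ?thesis
  proof (rule Bochner_Integration.integrable_bound)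
    have "\<bar>f x * H x z\<bar> \<le> \<bar>f x * c\<bar>" for x z
      unfolding abs_mult using H[of x z] by (intro mult_left_mono) auto
    then show "AE z in M \<Otimes>\<^sub>M M. norm (case z of (x, z) \<Rightarrow> f x * H x z)
        \<le> norm (case z of (x, z) \<Rightarrow> f x * c)"
      by (auto simp: split_beta)
  qed measurable
qed

text \<open>
  Lag covariance kernels \<open>C k\<close>, bounded by \<open>1\<close>, from which the kernel
  \<open>\<Sum>k=1..p. \<integral> C k (x, z) * C k (y, z) \<mu>(dz)\<close> is built.
\<close>

locale bounded_lag_kernels = finite_measure \<mu> for \<mu> :: "'b measure" +
  fixes C :: "nat \<Rightarrow> 'b \<Rightarrow> 'b \<Rightarrow> real" and p :: nat
  assumes C_measurable [measurable]: "(\<lambda>(x, y). C k x y) \<in> borel_measurable (\<mu> \<Otimes>\<^sub>M \<mu>)"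
    and C_bounded: "\<bar>C k x y\<bar> \<le> 1"
begin

sublocale pair_sigma_finite \<mu> \<mu> ..

lemma C_mult_bounded: "\<bar>C k x z * C k y z\<bar> \<le> 1"
  using mult_mono[OF C_bounded[of k x z] C_bounded[of k y z]] by (simp add: abs_mult)

lemma C_section_measurable: "x \<in> space \<mu> \<Longrightarrow> C k x \<in> borel_measurable \<mu>"
  using measurable_Pair2[OF C_measurable[of k], of x] by simp

lemma integrable_C_mult:
  assumes "x \<in> space \<mu>" "y \<in> space \<mu>"
  shows "integrable \<mu> (\<lambda>z. C k x z * C k y z)"
proof (rule integrable_const_bound[where B=1])
  show "AE z in \<mu>. norm (C k x z * C k y z) \<le> 1" using C_mult_bounded by auto
qed (use assms in \<open>intro borel_measurable_times C_section_measurable\<close>)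

lemma lag_kernel_measurable [measurable]:
  "(\<lambda>(x, y). lag_kernel \<mu> p C x y) \<in> borel_measurable (\<mu> \<Otimes>\<^sub>M \<mu>)"
  unfolding lag_kernel_def by measurable

lemma lag_kernel_bounded: "\<bar>lag_kernel \<mu> p C x y\<bar> \<le> real p * measure \<mu> (space \<mu>)"
proof -
  have "\<bar>\<integral>z. C k x z * C k y z \<partial>\<mu>\<bar> \<le> measure \<mu> (space \<mu>)" for k
  proof -
    have "\<bar>\<integral>z. C k x z * C k y z \<partial>\<mu>\<bar> \<le> (\<integral>z. \<bar>C k x z * C k y z\<bar> \<partial>\<mu>)"
      by (rule integral_abs_bound)
    also have "\<dots> \<le> (\<integral>z. 1 \<partial>\<mu>)"
      using C_mult_bounded by (intro integral_mono') auto
    finally show ?thesis by simp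
  qed
  then have "\<bar>lag_kernel \<mu> p C x y\<bar> \<le> (\<Sum>k=1..p. measure \<mu> (space \<mu>))"
    unfolding lag_kernel_def by (intro order_trans[OF sum_abs sum_mono])
  then show ?thesis by simp
qed

sublocale L: bounded_symmetric_kernel \<mu> "lag_kernel \<mu> p C" "real p * measure \<mu> (space \<mu>)"
proof
  show "lag_kernel \<mu> p C x y = lag_kernel \<mu> p C y x" for x y
    by (simp only: lag_kernel_def mult.commute)
qed (rule lag_kernel_measurable lag_kernel_bounded)+

text \<open>
  The quadratic form is \<open>\<Sum>k=1..p. \<integral> (g k)\<^sup>2 d\<mu>\<close>, where \<open>g k\<close> is the adjoint of the operator with
  kernel \<open>C k\<close> applied to \<open>f\<close>.
\<close>

lemma lag_kernel_psd:
  assumes f: "f \<in> L2 \<mu>"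
  shows "0 \<le> L2_inner \<mu> (integral_operator \<mu> (lag_kernel \<mu> p C) f) f"
proof -
  have [measurable]: "f \<in> borel_measurable \<mu>" using f by (rule L2_measurable)
  have fi: "integrable \<mu> f" using f by (intro L2_imp_integrable) unfold_locales
  define g where "g k z = (\<integral>y. f y * C k y z \<partial>\<mu>)" for k z
  have [measurable]: "g k \<in> borel_measurable \<mu>" for k
    unfolding g_def by measurable
  have g_le: "\<bar>g k z\<bar> \<le> (\<integral>y. \<bar>f y\<bar> \<partial>\<mu>)" for k z
  proof -
    have "\<bar>g k z\<bar> \<le> (\<integral>y. \<bar>f y * C k y z\<bar> \<partial>\<mu>)" unfolding g_def by (rule integral_abs_bound)
    also have "\<dots> \<le> (\<integral>y. \<bar>f y\<bar> \<partial>\<mu>)"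
      using fi mult_left_mono[OF C_bounded abs_ge_zero[of "f _"]]
      by (intro integral_mono') (auto simp: abs_mult)
    finally show ?thesis .
  qed
  have Cg_le: "\<bar>C k x z * g k z\<bar> \<le> (\<integral>y. \<bar>f y\<bar> \<partial>\<mu>)" for k x z
    using mult_mono[OF C_bounded[of k x z] g_le[of k z]] by (simp add: abs_mult)
  have inner: "integral_operator \<mu> (lag_kernel \<mu> p C) f x = (\<Sum>k=1..p. \<integral>z. C k x z * g k z \<partial>\<mu>)"
    if x: "x \<in> space \<mu>" for x
  proof -
    have i: "integrable (\<mu> \<Otimes>\<^sub>M \<mu>) (\<lambda>(y, z). f y * (C k x z * C k y z))" for k
    proof (rule integrable_tensor_bounded[OF fi, where c=1])
      note [measurable] = C_section_measurable[OF x]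
      show "(\<lambda>(y, z). C k x z * C k y z) \<in> borel_measurable (\<mu> \<Otimes>\<^sub>M \<mu>)" by measurable
    qed (rule C_mult_bounded)
    have "integral_operator \<mu> (lag_kernel \<mu> p C) f x
        = (\<integral>y. (\<Sum>k=1..p. \<integral>z. f y * (C k x z * C k y z) \<partial>\<mu>) \<partial>\<mu>)"
      unfolding integral_operator_def lag_kernel_def
      by (simp add: sum_distrib_left mult.commute[of _ "f _"])
    also have "\<dots> = (\<Sum>k=1..p. \<integral>y. (\<integral>z. f y * (C k x z * C k y z) \<partial>\<mu>) \<partial>\<mu>)"
      using integrable_fst'[OF i] by (intro Bochner_Integration.integral_sum) simp
    also have "\<dots> = (\<Sum>k=1..p. \<integral>z. (\<integral>y. f y * (C k x z * C k y z) \<partial>\<mu>) \<partial>\<mu>)"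
      using Fubini_integral[OF i] by simp
    also have "\<dots> = (\<Sum>k=1..p. \<integral>z. C k x z * g k z \<partial>\<mu>)"
    proof -
      have "f y * (C k x z * C k y z) = C k x z * (f y * C k y z)" for k y z by simp
      then show ?thesis unfolding g_def by (simp only: integral_mult_right_zero)
    qed
    finally show ?thesis .
  qed
  have i: "integrable (\<mu> \<Otimes>\<^sub>M \<mu>) (\<lambda>(x, z). f x * (C k x z * g k z))" for k
    by (rule integrable_tensor_bounded[OF fi _ Cg_le]) measurable
  have "L2_inner \<mu> (integral_operator \<mu> (lag_kernel \<mu> p C) f) f
      = (\<integral>x. (\<Sum>k=1..p. \<integral>z. f x * (C k x z * g k z) \<partial>\<mu>) \<partial>\<mu>)"
    unfolding L2_inner_def
    by (intro Bochner_Integration.integral_cong refl) (simp add: inner sum_distrib_left mult.commute[of _ "f _"])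
  also have "\<dots> = (\<Sum>k=1..p. \<integral>x. (\<integral>z. f x * (C k x z * g k z) \<partial>\<mu>) \<partial>\<mu>)"
    using integrable_fst'[OF i] by (intro Bochner_Integration.integral_sum) simp
  also have "\<dots> = (\<Sum>k=1..p. \<integral>z. (\<integral>x. f x * (C k x z * g k z) \<partial>\<mu>) \<partial>\<mu>)"
    using Fubini_integral[OF i] by simp
  also have "\<dots> = (\<Sum>k=1..p. \<integral>z. g k z * g k z \<partial>\<mu>)"
  proof -
    have "f x * (C k x z * g k z) = f x * C k x z * g k z" for k x z by simp
    then show ?thesis by (simp only: g_def[symmetric] integral_mult_left_zero)
  qed
  also have "0 \<le> \<dots>" by (intro sum_nonneg integral_nonneg) auto
  finally show ?thesis .
qed

lemma lag_kernel_psd_eigensystem: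
  assumes "eigensystem \<mu> (lag_kernel \<mu> p C) \<theta> \<psi>"
  shows "psd_eigensystem \<mu> (lag_kernel \<mu> p C) (real p * measure \<mu> (space \<mu>)) \<theta> \<psi>"
  by unfold_locales (use assms lag_kernel_psd in auto)

end

text \<open>
  As the lag kernels are bounded, \<open>L\<^sup>1\<close> distances between them control the Hilbert-Schmidt distance.
\<close>

lemma lag_kernel_HS_norm_le:
  assumes "bounded_lag_kernels \<mu> C" "bounded_lag_kernels \<mu> C'"
  shows "(HS_norm \<mu> (\<lambda>x y. lag_kernel \<mu> p C' x y - lag_kernel \<mu> p C x y))\<^sup>2
    \<le> 4 * real p * (measure \<mu> (space \<mu>))\<^sup>2 *
      (\<Sum>k=1..p. \<integral>z. \<bar>C' k (fst z) (snd z) - C k (fst z) (snd z)\<bar> \<partial>(\<mu> \<Otimes>\<^sub>M \<mu>))"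
proof -
  interpret K: bounded_lag_kernels \<mu> C p by fact
  interpret K': bounded_lag_kernels \<mu> C' p by fact
  interpret P: finite_measure "\<mu> \<Otimes>\<^sub>M \<mu>"
    by (rule finite_measure_pair_measure) unfold_locales
  define m where "m = measure \<mu> (space \<mu>)"
  define D where "D k x z = \<bar>C' k x z - C k x z\<bar>" for k x z
  define d where "d k x = (\<integral>z. D k x z \<partial>\<mu>)" for k x
  define R where "R x y = \<bar>lag_kernel \<mu> p C' x y - lag_kernel \<mu> p C x y\<bar>" for x y
  have D_le: "D k x z \<le> 2" for k x z
    using K.C_bounded[of k x z] K'.C_bounded[of k x z] by (simp add: D_def)
  have D0: "0 \<le> D k x z" for k x z by (simp add: D_def)
  have [measurable]: "(\<lambda>(x, z). D k x z) \<in> borel_measurable (\<mu> \<Otimes>\<^sub>M \<mu>)" for k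
    unfolding D_def by measurable
  have [measurable]: "d k \<in> borel_measurable \<mu>" for k unfolding d_def by measurable
  have d_le: "d k x \<le> 2 * m" for k x
  proof -
    have "d k x \<le> (\<integral>z. 2 \<partial>\<mu>)" unfolding d_def using D_le by (intro integral_mono') auto
    then show ?thesis by (simp add: m_def mult.commute)
  qed
  have d0: "0 \<le> d k x" for k x by (simp add: d_def D0)
  have iD: "integrable (\<mu> \<Otimes>\<^sub>M \<mu>) (\<lambda>(x, z). D k x z)" for k
    using D_le D0 by (intro P.integrable_const_bound[where B=2]) (auto simp: split_beta)
  have id: "integrable \<mu> (d k)" for k
    using K.integrable_fst'[OF iD] by (simp add: d_def[abs_def])
  have sf: "sigma_finite_measure \<mu>" by unfold_locales
  have id1: "integrable (\<mu> \<Otimes>\<^sub>M \<mu>) (\<lambda>(x, y). d k x)" and id2: "integrable (\<mu> \<Otimes>\<^sub>M \<mu>) (\<lambda>(x, y). d k y)" for k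
    using integrable_tensor[OF sf sf id, of "\<lambda>_. 1" k] integrable_tensor[OF sf sf _ id, of "\<lambda>_. 1" k]
    by simp_all
  have id1': "integrable (\<mu> \<Otimes>\<^sub>M \<mu>) (\<lambda>z. d k (fst z))"
    and id2': "integrable (\<mu> \<Otimes>\<^sub>M \<mu>) (\<lambda>z. d k (snd z))" for k
    using id1[of k] id2[of k] by (simp_all add: split_beta')
  have R_le: "R x y \<le> (\<Sum>k=1..p. d k x + d k y)" if xy: "x \<in> space \<mu>" "y \<in> space \<mu>" for x y
  proof -
    have i: "integrable \<mu> (\<lambda>z. D k w z)" if "w \<in> space \<mu>" for w k
    proof (rule K.integrable_const_bound[where B=2])
      show "(\<lambda>z. D k w z) \<in> borel_measurable \<mu>" using that by measurable
    qed (use D_le D0 in auto)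
    have "\<bar>(\<integral>z. C' k x z * C' k y z \<partial>\<mu>) - (\<integral>z. C k x z * C k y z \<partial>\<mu>)\<bar> \<le> d k x + d k y" for k
    proof -
      have "\<bar>(\<integral>z. C' k x z * C' k y z \<partial>\<mu>) - (\<integral>z. C k x z * C k y z \<partial>\<mu>)\<bar>
          = \<bar>\<integral>z. C' k x z * C' k y z - C k x z * C k y z \<partial>\<mu>\<bar>"
        using K.integrable_C_mult[OF xy, of k] K'.integrable_C_mult[OF xy, of k] by simp
      also have "\<dots> \<le> (\<integral>z. \<bar>C' k x z * C' k y z - C k x z * C k y z\<bar> \<partial>\<mu>)"
        by (rule integral_abs_bound)
      also have "\<dots> \<le> (\<integral>z. D k x z + D k y z \<partial>\<mu>)"
      proof (rule integral_mono')
        show "integrable \<mu> (\<lambda>z. D k x z + D k y z)" using i xy by simp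
        show "\<bar>C' k x z * C' k y z - C k x z * C k y z\<bar> \<le> D k x z + D k y z" for z
        proof -
          have "C' k x z * C' k y z - C k x z * C k y z
              = (C' k x z - C k x z) * C' k y z + C k x z * (C' k y z - C k y z)"
            by (simp add: algebra_simps)
          also have "\<bar>\<dots>\<bar> \<le> D k x z * \<bar>C' k y z\<bar> + \<bar>C k x z\<bar> * D k y z"
            unfolding D_def by (simp add: abs_mult[symmetric] abs_triangle_ineq)
          also have "\<dots> \<le> D k x z * 1 + 1 * D k y z"
            using K.C_bounded K'.C_bounded D0 by (intro add_mono mult_left_mono mult_right_mono) auto
          finally show ?thesis by simp
        qed
      qed (simp add: D0)
      also have "\<dots> = d k x + d k y" using i xy by (simp add: d_def)
      finally show ?thesis .
    qed
    then show ?thesis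
      unfolding R_def lag_kernel_def sum_subtractf[symmetric]
      by (intro order_trans[OF sum_abs sum_mono])
  qed
  have R_bounded: "R x y \<le> 2 * real p * m" for x y
    using K.lag_kernel_bounded[of x y] K'.lag_kernel_bounded[of x y] by (simp add: R_def m_def)
  have R0: "0 \<le> R x y" and m0: "0 \<le> m" for x y by (simp_all add: R_def m_def)
  have "(HS_norm \<mu> (\<lambda>x y. lag_kernel \<mu> p C' x y - lag_kernel \<mu> p C x y))\<^sup>2
      = (\<integral>z. (case z of (x, y) \<Rightarrow> R x y * R x y) \<partial>(\<mu> \<Otimes>\<^sub>M \<mu>))"
    by (simp add: HS_norm_def L2_norm_square L2_inner_def split_beta R_def abs_mult_self_eq)
  also have "\<dots> \<le> (\<integral>z. 2 * real p * m * (\<Sum>k=1..p. d k (fst z) + d k (snd z)) \<partial>(\<mu> \<Otimes>\<^sub>M \<mu>))"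
  proof (rule integral_mono')
    show "integrable (\<mu> \<Otimes>\<^sub>M \<mu>) (\<lambda>z. 2 * real p * m * (\<Sum>k=1..p. d k (fst z) + d k (snd z)))"
      using id1' id2' by simp
    fix z assume z: "z \<in> space (\<mu> \<Otimes>\<^sub>M \<mu>)"
    then show "(case z of (x, y) \<Rightarrow> R x y * R x y) \<le> 2 * real p * m * (\<Sum>k=1..p. d k (fst z) + d k (snd z))"
      using mult_mono[OF R_bounded R_le[of "fst z" "snd z"], of "fst z" "snd z"] R0 m0
      by (auto simp: space_pair_measure)
    show "0 \<le> 2 * real p * m * (\<Sum>k=1..p. d k (fst z) + d k (snd z))"
      by (auto simp: m_def d0 intro!: mult_nonneg_nonneg sum_nonneg add_nonneg_nonneg)
  qed
  also have "\<dots> = 2 * real p * m * (\<Sum>k=1..p. (\<integral>z. d k (fst z) \<partial>(\<mu> \<Otimes>\<^sub>M \<mu>)) + (\<integral>z. d k (snd z) \<partial>(\<mu> \<Otimes>\<^sub>M \<mu>)))"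
    using id1' id2' by (simp add: Bochner_Integration.integral_sum)
  also have "\<dots> = 2 * real p * m * (\<Sum>k=1..p. 2 * m * (\<integral>z. D k (fst z) (snd z) \<partial>(\<mu> \<Otimes>\<^sub>M \<mu>)))"
  proof -
    have "(\<integral>z. d k (fst z) \<partial>(\<mu> \<Otimes>\<^sub>M \<mu>)) = m * (\<integral>x. d k x \<partial>\<mu>)" for k
      using K.integral_fst'[OF id1'[of k]] by (simp add: m_def)
    moreover have "(\<integral>z. d k (snd z) \<partial>(\<mu> \<Otimes>\<^sub>M \<mu>)) = m * (\<integral>x. d k x \<partial>\<mu>)" for k
      using K.integral_fst'[OF id2'[of k]] by (simp add: m_def)
    moreover have "(\<integral>x. d k x \<partial>\<mu>) = (\<integral>z. D k (fst z) (snd z) \<partial>(\<mu> \<Otimes>\<^sub>M \<mu>))" for k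
      unfolding d_def using K.integral_fst'[OF iD[of k]] by (simp add: split_beta')
    ultimately show ?thesis by (simp add: mult.assoc)
  qed
  also have "\<dots> = 4 * real p * m\<^sup>2 * (\<Sum>k=1..p. \<integral>z. D k (fst z) (snd z) \<partial>(\<mu> \<Otimes>\<^sub>M \<mu>))"
    by (simp add: sum_distrib_left[symmetric] power2_eq_square)
  finally show ?thesis by (simp add: D_def m_def)
qed

section \<open>Convergence to zero in probability\<close>

text \<open>
  If a small value of \<open>Z\<close> forces a small value of \<open>W\<close>, for all large \<open>n\<close> and with uniform moduli, then
  convergence of \<open>Z\<close> carries over to \<open>W\<close>, whether or not \<open>W\<close> is measurable.
\<close>

lemma tendsto_zero_in_prob_dominated:
  assumes Z: "tendsto_zero_in_prob M Z"
    and dom: "\<And>e. 0 < e \<Longrightarrow> \<exists>d>0. \<exists>N. \<forall>n\<ge>N. \<forall>\<omega>\<in>space M. \<bar>Z n \<omega>\<bar> < d \<longrightarrow> \<bar>W n \<omega>\<bar> < e"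
  shows "tendsto_zero_in_prob M W"
  unfolding tendsto_zero_in_prob_def
proof (intro allI impI)
  fix e :: real assume "0 < e"
  then obtain d N where d: "0 < d"
      "\<And>n \<omega>. n \<ge> N \<Longrightarrow> \<omega> \<in> space M \<Longrightarrow> \<bar>Z n \<omega>\<bar> < d \<Longrightarrow> \<bar>W n \<omega>\<bar> < e"
    using dom by meson
  obtain A where A: "\<And>n. A n \<in> sets M" "\<And>n. {\<omega> \<in> space M. d \<le> \<bar>Z n \<omega>\<bar>} \<subseteq> A n"
      "(\<lambda>n. measure M (A n)) \<longlonglongrightarrow> 0"
    using Z d(1) unfolding tendsto_zero_in_prob_def by meson
  define A' where "A' n = (if n < N then space M else A n)" for n
  have "(\<lambda>n. measure M (A' n)) \<longlonglongrightarrow> 0"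
    using A(3) by (rule Lim_transform_eventually)
      (auto simp: A'_def eventually_sequentially intro!: exI[of _ N])
  moreover have "A' n \<in> sets M \<and> {\<omega> \<in> space M. e \<le> \<bar>W n \<omega>\<bar>} \<subseteq> A' n" for n
  proof (cases "n < N")
    case False
    have "\<omega> \<in> A n" if "\<omega> \<in> space M" "e \<le> \<bar>W n \<omega>\<bar>" for \<omega>
      using d(2)[of n \<omega>] A(2)[of n] False that by fastforce
    then show ?thesis using A(1) False by (auto simp: A'_def)
  qed (auto simp: A'_def)
  ultimately show "\<exists>A. (\<forall>n. A n \<in> sets M \<and> {\<omega> \<in> space M. e \<le> \<bar>W n \<omega>\<bar>} \<subseteq> A n) \<and>
      (\<lambda>n. measure M (A n)) \<longlonglongrightarrow> 0"
    by blast
qed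

lemma tendsto_zero_in_prob_mono:
  assumes Z: "tendsto_zero_in_prob M Z" and c: "0 \<le> c"
    and le: "\<And>n \<omega>. n \<ge> N \<Longrightarrow> \<omega> \<in> space M \<Longrightarrow> \<bar>W n \<omega>\<bar> \<le> c * \<bar>Z n \<omega>\<bar>"
  shows "tendsto_zero_in_prob M W"
proof (rule tendsto_zero_in_prob_dominated[OF Z])
  fix e :: real assume e: "0 < e"
  have "\<bar>W n \<omega>\<bar> < e" if "n \<ge> N" "\<omega> \<in> space M" "\<bar>Z n \<omega>\<bar> < e / (c + 1)" for n \<omega>
  proof -
    have "c * \<bar>Z n \<omega>\<bar> \<le> c * (e / (c + 1))" using that c by (intro mult_left_mono) auto
    also have "\<dots> < e" using c e by (simp add: field_simps)
    finally show ?thesis using le[OF that(1,2)] by linarith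
  qed
  then show "\<exists>d>0. \<exists>N. \<forall>n\<ge>N. \<forall>\<omega>\<in>space M. \<bar>Z n \<omega>\<bar> < d \<longrightarrow> \<bar>W n \<omega>\<bar> < e"
    using e c by (intro exI[of _ "e / (c + 1)"] conjI exI[of _ N]) auto
qed

lemma tendsto_zero_in_prob_sqrt:
  assumes "tendsto_zero_in_prob M Z"
  shows "tendsto_zero_in_prob M (\<lambda>n \<omega>. sqrt (Z n \<omega>))"
proof (rule tendsto_zero_in_prob_dominated[OF assms])
  fix e :: real assume e: "0 < e"
  have "\<bar>sqrt z\<bar> < e" if "\<bar>z\<bar> < e\<^sup>2" for z :: real
  proof -
    have "\<bar>sqrt z\<bar> = sqrt \<bar>z\<bar>" by (cases "0 \<le> z") (auto simp: real_sqrt_minus)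
    then show ?thesis using real_sqrt_less_mono[OF that] e by simp
  qed
  then show "\<exists>d>0. \<exists>N. \<forall>n\<ge>N. \<forall>\<omega>\<in>space M. \<bar>Z n \<omega>\<bar> < d \<longrightarrow> \<bar>sqrt (Z n \<omega>)\<bar> < e"
    using e by (intro exI[of _ "e\<^sup>2"]) auto
qed

lemma tendsto_zero_in_prob_const:
  assumes "a \<longlonglongrightarrow> 0"
  shows "tendsto_zero_in_prob M (\<lambda>n \<omega>. a n)"
proof -
  have "tendsto_zero_in_prob M (\<lambda>n \<omega>. 0)"
    unfolding tendsto_zero_in_prob_def by (auto intro!: exI[of _ "\<lambda>_. {}"])
  then show ?thesis
  proof (rule tendsto_zero_in_prob_dominated)
    fix e :: real assume "0 < e"
    then obtain N where "\<forall>n\<ge>N. \<bar>a n\<bar> < e" using LIMSEQ_D[OF assms, of e] by auto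
    then show "\<exists>d>0. \<exists>N. \<forall>n\<ge>N. \<forall>\<omega>\<in>space M. \<bar>0 :: real\<bar> < d \<longrightarrow> \<bar>a n\<bar> < e"
      by (intro exI[of _ 1]) auto
  qed
qed

lemma (in prob_space) tendsto_zero_in_prob_add:
  assumes "tendsto_zero_in_prob M Z" "tendsto_zero_in_prob M W"
  shows "tendsto_zero_in_prob M (\<lambda>n \<omega>. Z n \<omega> + W n \<omega>)"
  unfolding tendsto_zero_in_prob_def
proof (intro allI impI)
  fix e :: real assume "0 < e"
  then have e: "0 < e / 2" by simp
  obtain A where A: "\<And>n. A n \<in> sets M" "\<And>n. {\<omega> \<in> space M. e / 2 \<le> \<bar>Z n \<omega>\<bar>} \<subseteq> A n"
      "(\<lambda>n. measure M (A n)) \<longlonglongrightarrow> 0"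
    using assms(1) e unfolding tendsto_zero_in_prob_def by meson
  obtain B where B: "\<And>n. B n \<in> sets M" "\<And>n. {\<omega> \<in> space M. e / 2 \<le> \<bar>W n \<omega>\<bar>} \<subseteq> B n"
      "(\<lambda>n. measure M (B n)) \<longlonglongrightarrow> 0"
    using assms(2) e unfolding tendsto_zero_in_prob_def by meson
  have "(\<lambda>n. measure M (A n \<union> B n)) \<longlonglongrightarrow> 0"
  proof (rule tendsto_sandwich[OF _ _ tendsto_const])
    show "\<forall>\<^sub>F n in sequentially. measure M (A n \<union> B n) \<le> measure M (A n) + measure M (B n)"
      using A(1) B(1) by (simp add: measure_Un_le)
    show "(\<lambda>n. measure M (A n) + measure M (B n)) \<longlonglongrightarrow> 0"
      using tendsto_add[OF A(3) B(3)] by simp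
  qed simp
  moreover have "{\<omega> \<in> space M. e \<le> \<bar>Z n \<omega> + W n \<omega>\<bar>} \<subseteq> A n \<union> B n" for n
  proof safe
    fix \<omega> assume w: "\<omega> \<in> space M" "e \<le> \<bar>Z n \<omega> + W n \<omega>\<bar>" "\<omega> \<notin> B n"
    then have "\<bar>W n \<omega>\<bar> < e / 2" using B(2)[of n] by fastforce
    then have "e / 2 \<le> \<bar>Z n \<omega>\<bar>" using w(2) by linarith
    then show "\<omega> \<in> A n" using A(2)[of n] w(1) by auto
  qed
  ultimately show "\<exists>A. (\<forall>n. A n \<in> sets M \<and> {\<omega> \<in> space M. e \<le> \<bar>Z n \<omega> + W n \<omega>\<bar>} \<subseteq> A n) \<and>
      (\<lambda>n. measure M (A n)) \<longlonglongrightarrow> 0"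
    using A(1) B(1) by (intro exI[of _ "\<lambda>n. A n \<union> B n"]) auto
qed

lemma (in prob_space) tendsto_zero_in_prob_sum:
  "(\<And>i. i \<in> I \<Longrightarrow> tendsto_zero_in_prob M (Z i)) \<Longrightarrow>
    tendsto_zero_in_prob M (\<lambda>n \<omega>. \<Sum>i\<in>I. Z i n \<omega>)"
proof (induction I rule: infinite_finite_induct)
  case (insert i I)
  then show ?case
    using tendsto_zero_in_prob_add[of "Z i" "\<lambda>n \<omega>. \<Sum>i\<in>I. Z i n \<omega>"] by simp
qed (simp_all add: tendsto_zero_in_prob_const)

lemma (in prob_space) tendsto_zero_in_prob_of_mean:
  assumes int: "\<And>n. integrable M (Z n)" and nonneg: "\<And>n \<omega>. \<omega> \<in> space M \<Longrightarrow> 0 \<le> Z n \<omega>"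
    and lim: "(\<lambda>n. \<integral>\<omega>. Z n \<omega> \<partial>M) \<longlonglongrightarrow> 0"
  shows "tendsto_zero_in_prob M Z"
  unfolding tendsto_zero_in_prob_def
proof (intro allI impI)
  fix e :: real assume e: "0 < e"
  let ?A = "\<lambda>n. {\<omega> \<in> space M. e \<le> Z n \<omega>}"
  have [measurable]: "Z n \<in> borel_measurable M" for n using int by auto
  have "(\<lambda>n. measure M (?A n)) \<longlonglongrightarrow> 0"
  proof (rule tendsto_sandwich[OF _ _ tendsto_const])
    show "\<forall>\<^sub>F n in sequentially. measure M (?A n) \<le> (\<integral>\<omega>. Z n \<omega> \<partial>M) / e"
      using integral_Markov_inequality_measure[OF int, where A="{}" and c=e] nonneg e by auto
    show "(\<lambda>n. (\<integral>\<omega>. Z n \<omega> \<partial>M) / e) \<longlonglongrightarrow> 0"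
      using tendsto_divide[OF lim tendsto_const[of e]] e by simp
  qed simp
  then show "\<exists>A. (\<forall>n. A n \<in> sets M \<and> {\<omega> \<in> space M. e \<le> \<bar>Z n \<omega>\<bar>} \<subseteq> A n) \<and>
      (\<lambda>n. measure M (A n)) \<longlonglongrightarrow> 0"
    using nonneg by (intro exI[of _ ?A]) auto
qed

lemma (in prob_space) tendsto_zero_in_prob_L1_of_second_moment:
  fixes W :: "nat \<Rightarrow> 'a \<Rightarrow> 'z \<Rightarrow> real"
  assumes N: "finite_measure N"
    and meas: "\<And>n. (\<lambda>(\<omega>, z). W n \<omega> z) \<in> borel_measurable (M \<Otimes>\<^sub>M N)"
    and bounded: "\<And>n \<omega> z. \<omega> \<in> space M \<Longrightarrow> z \<in> space N \<Longrightarrow> \<bar>W n \<omega> z\<bar> \<le> c"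
    and moment: "\<And>n z. z \<in> space N \<Longrightarrow> (\<integral>\<omega>. (W n \<omega> z)\<^sup>2 \<partial>M) \<le> e n"
    and lim: "e \<longlonglongrightarrow> 0"
  shows "tendsto_zero_in_prob M (\<lambda>n \<omega>. \<integral>z. \<bar>W n \<omega> z\<bar> \<partial>N)"
proof -
  interpret N: finite_measure N by fact
  interpret MN: pair_sigma_finite M N ..
  interpret P: finite_measure "M \<Otimes>\<^sub>M N" by (rule finite_measure_pair_measure) unfold_locales
  note [measurable] = meas
  have b2: "(W n \<omega> z)\<^sup>2 \<le> c\<^sup>2" if "\<omega> \<in> space M" "z \<in> space N" for n \<omega> z
    using power_mono[OF bounded[OF that, of n], of 2] by simp
  have int: "integrable (M \<Otimes>\<^sub>M N) (\<lambda>(\<omega>, z). (W n \<omega> z)\<^sup>2)" for n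
    using b2 by (intro P.integrable_const_bound[where B="c\<^sup>2"])
      (auto intro!: AE_I2 simp: space_pair_measure)
  define V where "V n \<omega> = (\<integral>z. (W n \<omega> z)\<^sup>2 \<partial>N)" for n \<omega>
  have V: "tendsto_zero_in_prob M V"
  proof (rule tendsto_zero_in_prob_of_mean)
    show "integrable M (V n)" for n
      unfolding V_def using MN.integrable_fst'[OF int[of n]] by simp
    show "0 \<le> V n \<omega>" for n \<omega> by (simp add: V_def)
    show "(\<lambda>n. \<integral>\<omega>. V n \<omega> \<partial>M) \<longlonglongrightarrow> 0"
    proof (rule tendsto_sandwich[OF _ _ tendsto_const])
      show "\<forall>\<^sub>F n in sequentially. 0 \<le> (\<integral>\<omega>. V n \<omega> \<partial>M)" by (simp add: V_def)
      have "(\<integral>\<omega>. V n \<omega> \<partial>M) \<le> e n * measure N (space N)" for n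
      proof -
        have "(\<integral>\<omega>. V n \<omega> \<partial>M) = (\<integral>z. (\<integral>\<omega>. (W n \<omega> z)\<^sup>2 \<partial>M) \<partial>N)"
          unfolding V_def using MN.Fubini_integral[OF int[of n]] by simp
        also have "\<dots> \<le> (\<integral>z. e n \<partial>N)"
        proof (rule integral_mono')
          fix z assume z: "z \<in> space N"
          show "(\<integral>\<omega>. (W n \<omega> z)\<^sup>2 \<partial>M) \<le> e n" by (rule moment[OF z])
          have "0 \<le> (\<integral>\<omega>. (W n \<omega> z)\<^sup>2 \<partial>M)" by simp
          then show "0 \<le> e n" using moment[OF z, of n] by linarith
        qed simp
        finally show ?thesis by (simp add: mult.commute)
      qed
      then show "\<forall>\<^sub>F n in sequentially. (\<integral>\<omega>. V n \<omega> \<partial>M) \<le> e n * measure N (space N)" by simp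
      show "(\<lambda>n. e n * measure N (space N)) \<longlonglongrightarrow> 0"
        using tendsto_mult_right[OF lim] by simp
    qed
  qed
  show ?thesis
  proof (rule tendsto_zero_in_prob_mono[OF tendsto_zero_in_prob_sqrt[OF V], of "sqrt (measure N (space N))" 0])
    fix n \<omega> assume w: "\<omega> \<in> space M"
    have "W n \<omega> \<in> borel_measurable N" using w by measurable
    then have L: "W n \<omega> \<in> L2 N" using bounded[OF w] by (intro L2_bounded[OF N]) auto
    have "(\<integral>z. \<bar>W n \<omega> z\<bar> \<partial>N) \<le> L2_norm N (W n \<omega>) * sqrt (measure N (space N))"
      by (rule integral_abs_le_L2_norm[OF N L])
    also have "L2_norm N (W n \<omega>) = sqrt (V n \<omega>)"
      by (simp add: V_def L2_norm_def L2_inner_def power2_eq_square)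
    finally show "\<bar>\<integral>z. \<bar>W n \<omega> z\<bar> \<partial>N\<bar> \<le> sqrt (measure N (space N)) * \<bar>sqrt (V n \<omega>)\<bar>"
      by (simp add: V_def mult.commute)
  qed simp
qed

section \<open>Samples from a cyclic-independent conjugate process\<close>

lemma cdf_joint_measurable:
  assumes [measurable]: "\<zeta> \<in> measurable N (prob_algebra borel)"
  shows "(\<lambda>(\<omega>, x). cdf (\<zeta> \<omega>) x) \<in> borel_measurable (N \<Otimes>\<^sub>M borel)"
proof -
  have \<zeta>': "(\<lambda>z. \<zeta> (fst z)) \<in> measurable (N \<Otimes>\<^sub>M borel) (subprob_algebra borel)"
    by (rule measurable_prob_algebraD) measurable
  have "(\<lambda>z. measure (\<zeta> (fst z)) {..snd z}) \<in> borel_measurable (N \<Otimes>\<^sub>M (borel :: real measure))"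
  proof (rule measure_measurable_subprob_algebra2[OF _ \<zeta>'])
    have "{z \<in> space ((N \<Otimes>\<^sub>M (borel :: real measure)) \<Otimes>\<^sub>M (borel :: real measure)).
        snd z \<le> snd (fst z)} \<in> sets ((N \<Otimes>\<^sub>M borel) \<Otimes>\<^sub>M borel)"
      by measurable
    also have "{z \<in> space ((N \<Otimes>\<^sub>M (borel :: real measure)) \<Otimes>\<^sub>M (borel :: real measure)).
        snd z \<le> snd (fst z)} = (SIGMA z:space (N \<Otimes>\<^sub>M borel). {..snd z})"
      by (auto simp: space_pair_measure)
    finally show "(SIGMA z:space (N \<Otimes>\<^sub>M borel). {..snd z}) \<in> sets ((N \<Otimes>\<^sub>M borel) \<Otimes>\<^sub>M (borel :: real measure))" .
  qed
  then show ?thesis by (simp add: cdf_def split_beta')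
qed

text \<open>
  A sequence of random probability measures on the line; \<open>F t\<close> are their random distribution
  functions and \<open>\<Xi>\<close> is the sigma-algebra that they generate.
\<close>

locale random_distributions = prob_space M for M :: "'a measure" +
  fixes \<xi> :: "nat \<Rightarrow> 'a \<Rightarrow> real measure"
  assumes \<xi>_measurable [measurable]: "\<xi> t \<in> measurable M (prob_algebra borel)"
begin

abbreviation \<Xi> :: "'a measure" where
  "\<Xi> \<equiv> generated_sigma M (prob_algebra borel) \<xi>"

abbreviation F :: "nat \<Rightarrow> 'a \<Rightarrow> real \<Rightarrow> real" where
  "F t \<omega> \<equiv> cdf (\<xi> t \<omega>)"

lemma \<xi>_real_distribution: "\<omega> \<in> space M \<Longrightarrow> real_distribution (\<xi> t \<omega>)"
  using measurable_space[OF \<xi>_measurable, of \<omega> t]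
  by (auto simp: space_prob_algebra real_distribution_def real_distribution_axioms_def
      dest: sets_eq_imp_space_eq)

lemma F_bounds:
  assumes "\<omega> \<in> space M"
  shows F_nonneg: "0 \<le> F t \<omega> x" and F_le_1: "F t \<omega> x \<le> 1"
  using real_distribution.cdf_bounded_prob[OF \<xi>_real_distribution[OF assms]]
  by (simp_all add: cdf_def)

lemma F_measurable_pair [measurable]:
  "(\<lambda>(\<omega>, x). F t \<omega> x) \<in> borel_measurable (M \<Otimes>\<^sub>M borel)"
  by (rule cdf_joint_measurable) measurable

lemma F_measurable [measurable]: "(\<lambda>\<omega>. F t \<omega> x) \<in> borel_measurable M"
  using measurable_compose[of "\<lambda>\<omega>. (\<omega>, x)" M "M \<Otimes>\<^sub>M borel" "\<lambda>(\<omega>, x). F t \<omega> x" borel] by simp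

lemma space_\<Xi>: "space \<Xi> = space M"
  by (simp add: generated_sigma_def space_measure_of_conv)

lemma sets_\<Xi>: "sets \<Xi> =
    sigma_sets (space M) {\<xi> t -` A \<inter> space M | t A. A \<in> sets (prob_algebra borel)}"
  unfolding generated_sigma_def by (rule sets_measure_of) auto

lemma \<Xi>_subalgebra: "subalgebra M \<Xi>"
  unfolding subalgebra_def space_\<Xi> sets_\<Xi>
  by (intro conjI refl sets.sigma_sets_subset)
     (use measurable_sets[OF \<xi>_measurable] in blast)

sublocale \<Xi>: finite_measure_subalgebra M \<Xi>
  by unfold_locales (rule \<Xi>_subalgebra)

lemma F_measurable_\<Xi> [measurable]: "(\<lambda>\<omega>. F t \<omega> x) \<in> borel_measurable \<Xi>"
proof -
  have "\<xi> t \<in> measurable \<Xi> (prob_algebra borel)"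
  proof (rule measurableI)
    fix A assume "A \<in> sets (prob_algebra (borel :: real measure))"
    then show "\<xi> t -` A \<inter> space \<Xi> \<in> sets \<Xi>"
      unfolding space_\<Xi> sets_\<Xi> by (intro sigma_sets.Basic) auto
  qed (use measurable_space[OF \<xi>_measurable] in \<open>auto simp: space_\<Xi>\<close>)
  from cdf_joint_measurable[OF this] show ?thesis
    using measurable_compose[of "\<lambda>\<omega>. (\<omega>, x)" \<Xi> "\<Xi> \<Otimes>\<^sub>M borel" "\<lambda>(\<omega>, x). F t \<omega> x" borel] by simp
qed

end

text \<open>
  A cyclic-independent conjugate process observed at the times \<open>s t i\<close>, \<open>i = 1, \<dots>, q t\<close>, of cycle
  \<open>t\<close>; the times need not be distinct.
\<close>

locale sampled_conjugate_process = random_distributions M \<xi>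
  for M :: "'a measure" and \<xi> +
  fixes X :: "real \<Rightarrow> 'a \<Rightarrow> real" and q :: "nat \<Rightarrow> nat" and s :: "nat \<Rightarrow> nat \<Rightarrow> real"
  assumes conjugate: "conjugate_process M \<xi> X"
    and cyclic: "cyclic_independent M \<xi> X"
    and q_pos: "q t \<ge> 1"
    and s_cycle: "i \<in> {1..q t} \<Longrightarrow> s t i \<in> {real t..<real t + 1}"
begin

abbreviation Fh :: "nat \<Rightarrow> 'a \<Rightarrow> real \<Rightarrow> real" where
  "Fh \<equiv> emp_cdf X q s"

lemma X_measurable: "0 \<le> \<tau> \<Longrightarrow> X \<tau> \<in> borel_measurable M"
  using conjugate by (simp add: conjugate_process_def)

lemma X_sample_measurable: "i \<in> {1..q t} \<Longrightarrow> X (s t i) \<in> borel_measurable M"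
  using s_cycle[of i t] by (intro X_measurable) (auto intro: order_trans[of _ "real t"])

lemma Fh_measurable_pair [measurable]:
  "(\<lambda>(\<omega>, x). Fh t \<omega> x) \<in> borel_measurable (M \<Otimes>\<^sub>M borel)"
proof -
  have "(\<lambda>(\<omega>, x). indicator {..x} (X (s t i) \<omega>) :: real) \<in> borel_measurable (M \<Otimes>\<^sub>M borel)"
    if "i \<in> {1..q t}" for i
  proof -
    note [measurable] = X_sample_measurable[OF that]
    have "(\<lambda>(\<omega>, x). indicator {..x} (X (s t i) \<omega>) :: real)
        = (\<lambda>z. if X (s t i) (fst z) \<le> snd z then 1 else 0)"
      by (auto simp: fun_eq_iff indicator_def)
    then show ?thesis by simp
  qed
  then show ?thesis
    unfolding emp_cdf_def split_beta' by (intro borel_measurable_times borel_measurable_sum) auto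
qed

lemma Fh_measurable [measurable]: "(\<lambda>\<omega>. Fh t \<omega> x) \<in> borel_measurable M"
  using measurable_compose[of "\<lambda>\<omega>. (\<omega>, x)" M "M \<Otimes>\<^sub>M borel" "\<lambda>(\<omega>, x). Fh t \<omega> x" borel] by simp

lemma Fh_bounds: "0 \<le> Fh t \<omega> x" "Fh t \<omega> x \<le> 1"
proof -
  have "(\<Sum>i=1..q t. indicator {..x} (X (s t i) \<omega>)) \<le> (\<Sum>i=1..q t. (1 :: real))"
    by (intro sum_mono) (auto simp: indicator_def)
  then show "Fh t \<omega> x \<le> 1"
    using q_pos[of t] by (simp add: emp_cdf_def field_simps)
qed (simp add: emp_cdf_def sum_nonneg)

text \<open>
  Conditionally on \<open>\<Xi>\<close>, one observation in each of finitely many cycles gives independent variables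
  with distribution functions \<open>F j\<close>. The conditioning appears through the weight \<open>H\<close>.
\<close>

lemma expectation_prod_indicators:
  assumes J: "finite J" "J \<noteq> {}" and \<tau>: "\<And>j. j \<in> J \<Longrightarrow> \<tau> j \<in> {real j..<real j + 1}"
    and H: "H \<in> borel_measurable \<Xi>" "\<And>\<omega>. \<omega> \<in> space M \<Longrightarrow> \<bar>H \<omega>\<bar> \<le> c"
  shows "(\<integral>\<omega>. H \<omega> * (\<Prod>j\<in>J. indicator {..x j} (X (\<tau> j) \<omega>)) \<partial>M)
    = (\<integral>\<omega>. H \<omega> * (\<Prod>j\<in>J. F j \<omega> (x j)) \<partial>M)"
proof -
  define E where "E j = X (\<tau> j) -` {..x j} \<inter> space M" for j
  define D where "D = (\<Inter>j\<in>J. E j)"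
  have \<tau>0: "0 \<le> \<tau> j" if "j \<in> J" for j
    using \<tau>[OF that] by (auto intro: order_trans[of _ "real j"])
  have E: "E j \<in> sets M" if "j \<in> J" for j
    using X_measurable[OF \<tau>0[OF that]] unfolding E_def by measurable
  have D [measurable]: "D \<in> sets M" unfolding D_def using J E by (intro sets.finite_INT) auto
  have [measurable]: "H \<in> borel_measurable M"
    using H(1) \<Xi>_subalgebra by (rule measurable_from_subalg[rotated])
  define N where "N t = PiM {real t..<real t + 1} (\<lambda>_. borel :: real measure)" for t :: nat
  define Y where "Y t \<omega> = (\<lambda>\<tau>\<in>{real t..<real t + 1}. X \<tau> \<omega>)" for t :: nat and \<omega>
  define A where "A j = {f \<in> space (N j). f (\<tau> j) \<le> x j}" for j
  have A: "A \<in> Pi J (\<lambda>j. sets (N j))"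
  proof (rule Pi_I)
    fix j assume j: "j \<in> J"
    have "(\<lambda>f. f (\<tau> j)) \<in> measurable (N j) borel"
      unfolding N_def using \<tau>[OF j] by (rule measurable_component_singleton)
    then show "A j \<in> sets (N j)" unfolding A_def by measurable
  qed
  have Y: "Y j -` A j \<inter> space M = E j" if "j \<in> J" for j
    using \<tau>[OF that] by (auto simp: Y_def A_def E_def N_def space_PiM)
  have "AE \<omega> in M. real_cond_exp M \<Xi> (indicator (\<Inter>j\<in>J. Y j -` A j \<inter> space M)) \<omega>
      = (\<Prod>j\<in>J. real_cond_exp M \<Xi> (indicator (Y j -` A j \<inter> space M)) \<omega>)"
    using cyclic J A unfolding cyclic_independent_def cond_indep_vars_def N_def[symmetric] Y_def[abs_def, symmetric]
    by (auto simp: fun_eq_iff)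
  then have "AE \<omega> in M. real_cond_exp M \<Xi> (indicator D) \<omega>
      = (\<Prod>j\<in>J. real_cond_exp M \<Xi> (indicator (E j)) \<omega>)"
    using Y by (simp add: D_def cong: prod.cong INF_cong)
  moreover have "AE \<omega> in M. \<forall>j\<in>J. real_cond_exp M \<Xi> (indicator (E j)) \<omega> = F j \<omega> (x j)"
    using conjugate \<tau> J(1) unfolding E_def conjugate_process_def cdf_def
    by (intro AE_finite_allI) auto
  ultimately have AE: "AE \<omega> in M. real_cond_exp M \<Xi> (indicator D) \<omega> = (\<Prod>j\<in>J. F j \<omega> (x j))"
    by eventually_elim (auto intro: prod.cong)
  \<comment> \<open>The product of the indicators is the indicator of the intersection \<open>D\<close>.\<close>
  have D_eq: "(\<Prod>j\<in>J. indicator {..x j} (X (\<tau> j) \<omega>)) = (indicator D \<omega> :: real)"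
    if "\<omega> \<in> space M" for \<omega>
  proof (cases "\<omega> \<in> D")
    case True
    then have "X (\<tau> j) \<omega> \<in> {..x j}" if "j \<in> J" for j
      using INT_D[OF True[unfolded D_def] that] by (simp add: E_def)
    then show ?thesis using True by (simp add: indicator_def)
  next
    case False
    then obtain j where "j \<in> J" "\<omega> \<notin> E j" unfolding D_def by blast
    then have "j \<in> J" "X (\<tau> j) \<omega> \<notin> {..x j}" using that by (auto simp: E_def)
    then have "\<exists>j\<in>J. indicator {..x j} (X (\<tau> j) \<omega>) = (0 :: real)" by (intro bexI[of _ j]) auto
    then show ?thesis using False prod_zero[OF J(1)] by simp
  qed
  have "(\<integral>\<omega>. H \<omega> * (\<Prod>j\<in>J. indicator {..x j} (X (\<tau> j) \<omega>)) \<partial>M) = (\<integral>\<omega>. H \<omega> * indicator D \<omega> \<partial>M)"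
    by (intro Bochner_Integration.integral_cong) (auto simp: D_eq)
  also have "\<dots> = (\<integral>\<omega>. H \<omega> * real_cond_exp M \<Xi> (indicator D) \<omega> \<partial>M)"
  proof (rule \<Xi>.real_cond_exp_intg(2)[symmetric])
    show "integrable M (\<lambda>\<omega>. H \<omega> * indicator D \<omega>)"
      using H(2) order_trans[OF abs_ge_zero H(2)]
      by (intro integrable_const_bound[where B=c]) (auto intro!: AE_I2 simp: indicator_def)
  qed (use H D in auto)
  also have "\<dots> = (\<integral>\<omega>. H \<omega> * (\<Prod>j\<in>J. F j \<omega> (x j)) \<partial>M)"
    using AE by (intro integral_cong_AE) auto
  finally show ?thesis .
qed

lemma expectation_prod_Fh:
  assumes J: "finite J" "J \<noteq> {}"
    and H: "H \<in> borel_measurable \<Xi>" "\<And>\<omega>. \<omega> \<in> space M \<Longrightarrow> \<bar>H \<omega>\<bar> \<le> c"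
  shows "(\<integral>\<omega>. H \<omega> * (\<Prod>j\<in>J. Fh j \<omega> (x j)) \<partial>M) = (\<integral>\<omega>. H \<omega> * (\<Prod>j\<in>J. F j \<omega> (x j)) \<partial>M)"
proof -
  \<comment> \<open>Expanding the product of averages: \<open>G\<close> selects one observation in each cycle, and every
    selection has the same weight \<open>w\<close>.\<close>
  define G where "G = PiE J (\<lambda>j. {1..q j})"
  define w where "w = (\<Prod>j\<in>J. 1 / real (q j))"
  define I where "I g \<omega> = (\<Prod>j\<in>J. indicator {..x j} (X (s j (g j)) \<omega>) :: real)" for g \<omega>
  have G: "finite G" "real (card G) * w = 1"
  proof -
    show "finite G" unfolding G_def using J by (intro finite_PiE) auto
    have "real (card G) = (\<Prod>j\<in>J. real (q j))"
      unfolding G_def using J by (simp add: card_PiE)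
    moreover have "q j \<noteq> 0" for j using q_pos[of j] by simp
    ultimately show "real (card G) * w = 1"
      using J(1) by (simp add: w_def prod_dividef)
  qed
  have [measurable]: "H \<in> borel_measurable M"
    using H(1) \<Xi>_subalgebra by (rule measurable_from_subalg[rotated])
  have I_measurable: "I g \<in> borel_measurable M" if "g \<in> G" for g
    unfolding I_def
  proof (rule borel_measurable_prod)
    fix j assume "j \<in> J"
    then have [measurable]: "X (s j (g j)) \<in> borel_measurable M"
      using that by (intro X_sample_measurable) (auto simp: G_def)
    show "(\<lambda>\<omega>. indicator {..x j} (X (s j (g j)) \<omega>) :: real) \<in> borel_measurable M"
      by measurable
  qed
  have I_le: "\<bar>I g \<omega>\<bar> \<le> 1" for g \<omega>
    unfolding I_def abs_prod by (intro prod_le_1) (auto simp: indicator_def)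
  have int: "integrable M (\<lambda>\<omega>. H \<omega> * I g \<omega>)" if "g \<in> G" for g
  proof (rule integrable_const_bound[where B=c])
    have "\<bar>H \<omega> * I g \<omega>\<bar> \<le> c" if "\<omega> \<in> space M" for \<omega>
      using mult_mono[OF H(2)[OF that] I_le[of g \<omega>]] order_trans[OF abs_ge_zero H(2)[OF that]]
      by (simp add: abs_mult)
    then show "AE \<omega> in M. norm (H \<omega> * I g \<omega>) \<le> c" by simp
  qed (use I_measurable[OF that] in measurable)
  have "(\<Prod>j\<in>J. Fh j \<omega> (x j)) = w * (\<Sum>g\<in>G. I g \<omega>)" for \<omega>
    unfolding emp_cdf_def prod.distrib w_def G_def I_def using J by (subst prod_sum_PiE) auto
  then have "(\<integral>\<omega>. H \<omega> * (\<Prod>j\<in>J. Fh j \<omega> (x j)) \<partial>M) = (\<integral>\<omega>. w * (\<Sum>g\<in>G. H \<omega> * I g \<omega>) \<partial>M)"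
    by (simp add: sum_distrib_left ac_simps)
  also have "\<dots> = w * (\<Sum>g\<in>G. (\<integral>\<omega>. H \<omega> * I g \<omega> \<partial>M))"
    using int by (simp add: Bochner_Integration.integral_sum)
  also have "(\<Sum>g\<in>G. (\<integral>\<omega>. H \<omega> * I g \<omega> \<partial>M))
      = (\<Sum>g\<in>G. (\<integral>\<omega>. H \<omega> * (\<Prod>j\<in>J. F j \<omega> (x j)) \<partial>M))"
  proof (rule sum.cong[OF refl])
    fix g assume g: "g \<in> G"
    have "s j (g j) \<in> {real j..<real j + 1}" if "j \<in> J" for j
      using g that by (intro s_cycle) (auto simp: G_def)
    then show "(\<integral>\<omega>. H \<omega> * I g \<omega> \<partial>M) = (\<integral>\<omega>. H \<omega> * (\<Prod>j\<in>J. F j \<omega> (x j)) \<partial>M)"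
      unfolding I_def by (rule expectation_prod_indicators[OF J _ H])
  qed
  finally show ?thesis using G(2) by (simp add: mult.commute mult.left_commute)
qed

text \<open>
  Up to sign, all four terms of the expanded product have the expectation of
  \<open>\<Prod>j\<in>J \<union> J'. F j (x j)\<close>: conditionally on \<open>\<Xi>\<close>, products over disjoint sets of cycles are
  independent and unbiased.
\<close>

lemma centred_products_orthogonal:
  assumes J: "finite J" "J \<noteq> {}" and J': "finite J'" "J' \<noteq> {}" and disj: "J \<inter> J' = {}"
  shows "(\<integral>\<omega>. ((\<Prod>j\<in>J. Fh j \<omega> (x j)) - (\<Prod>j\<in>J. F j \<omega> (x j))) *
      ((\<Prod>j\<in>J'. Fh j \<omega> (x j)) - (\<Prod>j\<in>J'. F j \<omega> (x j))) \<partial>M) = 0"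
proof -
  define P where "P K \<omega> = (\<Prod>j\<in>K. Fh j \<omega> (x j))" for K \<omega>
  define p where "p K \<omega> = (\<Prod>j\<in>K. F j \<omega> (x j))" for K \<omega>
  have [measurable]: "P K \<in> borel_measurable M" "p K \<in> borel_measurable M" for K
    unfolding P_def p_def by measurable
  have pX: "p K \<in> borel_measurable \<Xi>" for K unfolding p_def by measurable
  have p01: "\<bar>p K \<omega>\<bar> \<le> 1" if "\<omega> \<in> space M" for K \<omega>
    unfolding p_def abs_prod using F_bounds[OF that] by (intro prod_le_1) (simp add: abs_of_nonneg)
  have P01: "\<bar>P K \<omega>\<bar> \<le> 1" for K \<omega>
    unfolding P_def abs_prod using Fh_bounds by (intro prod_le_1) (simp add: abs_of_nonneg)
  have int: "integrable M (\<lambda>\<omega>. u \<omega> * v \<omega>)"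
    if "u \<in> borel_measurable M" "v \<in> borel_measurable M"
      "\<And>\<omega>. \<omega> \<in> space M \<Longrightarrow> \<bar>u \<omega>\<bar> \<le> 1" "\<And>\<omega>. \<omega> \<in> space M \<Longrightarrow> \<bar>v \<omega>\<bar> \<le> 1" for u v :: "'a \<Rightarrow> real"
  proof (rule integrable_const_bound[where B=1])
    have "\<bar>u \<omega> * v \<omega>\<bar> \<le> 1" if "\<omega> \<in> space M" for \<omega>
      using mult_mono[of "\<bar>u \<omega>\<bar>" 1 "\<bar>v \<omega>\<bar>" 1] \<open>\<And>\<omega>. \<omega> \<in> space M \<Longrightarrow> \<bar>u \<omega>\<bar> \<le> 1\<close>[OF that]
        \<open>\<And>\<omega>. \<omega> \<in> space M \<Longrightarrow> \<bar>v \<omega>\<bar> \<le> 1\<close>[OF that] by (simp add: abs_mult)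
    then show "AE \<omega> in M. norm (u \<omega> * v \<omega>) \<le> 1" by simp
  qed (use that in measurable)
  have PP: "(\<integral>\<omega>. P J \<omega> * P J' \<omega> \<partial>M) = (\<integral>\<omega>. p J \<omega> * p J' \<omega> \<partial>M)"
    using expectation_prod_Fh[of "J \<union> J'" "\<lambda>_. 1" 1 x] J J' disj
    by (simp add: P_def p_def prod.union_disjoint)
  have pP: "(\<integral>\<omega>. p J \<omega> * P J' \<omega> \<partial>M) = (\<integral>\<omega>. p J \<omega> * p J' \<omega> \<partial>M)"
    using expectation_prod_Fh[OF J' pX p01, of J x] by (simp add: P_def p_def)
  have Pp: "(\<integral>\<omega>. P J \<omega> * p J' \<omega> \<partial>M) = (\<integral>\<omega>. p J \<omega> * p J' \<omega> \<partial>M)"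
    using expectation_prod_Fh[OF J pX p01, of J' x] by (simp add: P_def p_def mult.commute)
  have "(\<integral>\<omega>. (P J \<omega> - p J \<omega>) * (P J' \<omega> - p J' \<omega>) \<partial>M)
      = (\<integral>\<omega>. (P J \<omega> * P J' \<omega> - P J \<omega> * p J' \<omega>) - (p J \<omega> * P J' \<omega> - p J \<omega> * p J' \<omega>) \<partial>M)"
    by (simp add: algebra_simps)
  also have "\<dots> = ((\<integral>\<omega>. P J \<omega> * P J' \<omega> \<partial>M) - (\<integral>\<omega>. P J \<omega> * p J' \<omega> \<partial>M))
      - ((\<integral>\<omega>. p J \<omega> * P J' \<omega> \<partial>M) - (\<integral>\<omega>. p J \<omega> * p J' \<omega> \<partial>M))"
    using p01 P01 by (simp add: int)
  also have "\<dots> = 0" by (simp add: PP pP Pp)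
  finally show ?thesis by (simp add: P_def p_def)
qed

end

text \<open>
  Each \<open>Z t\<close> can be correlated only with itself, \<open>Z (t + k)\<close> and \<open>Z (t - k)\<close>, so every row of the matrix of
  second moments has at most three nonzero entries, each at most \<open>1\<close>.
\<close>

lemma (in prob_space) second_moment_of_almost_orthogonal_mean:
  fixes Z :: "nat \<Rightarrow> 'a \<Rightarrow> real"
  assumes meas: "\<And>t. Z t \<in> borel_measurable M"
    and bounded: "\<And>t \<omega>. \<omega> \<in> space M \<Longrightarrow> \<bar>Z t \<omega>\<bar> \<le> 1"
    and orth: "\<And>t u. u \<noteq> t \<Longrightarrow> u \<noteq> t + k \<Longrightarrow> t \<noteq> u + k \<Longrightarrow> (\<integral>\<omega>. Z t \<omega> * Z u \<omega> \<partial>M) = 0"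
    and n: "0 < n"
  shows "(\<integral>\<omega>. ((1 / real n) * (\<Sum>t=1..n. Z t \<omega>))\<^sup>2 \<partial>M) \<le> 3 / real n"
proof -
  note [measurable] = meas
  have zz: "\<bar>Z t \<omega> * Z u \<omega>\<bar> \<le> 1" if "\<omega> \<in> space M" for t u \<omega>
    using mult_mono[OF bounded[OF that, of t] bounded[OF that, of u]] by (simp add: abs_mult)
  have int: "integrable M (\<lambda>\<omega>. Z t \<omega> * Z u \<omega>)" for t u
    using zz by (intro integrable_const_bound[where B=1]) auto
  have le1: "(\<integral>\<omega>. Z t \<omega> * Z u \<omega> \<partial>M) \<le> 1" for t u
  proof -
    have "(\<integral>\<omega>. Z t \<omega> * Z u \<omega> \<partial>M) \<le> (\<integral>\<omega>. 1 \<partial>M)"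
      using zz by (intro integral_mono int) (auto simp: abs_le_iff)
    then show ?thesis by (simp add: prob_space)
  qed
  have row: "(\<Sum>u=1..n. (\<integral>\<omega>. Z t \<omega> * Z u \<omega> \<partial>M)) \<le> 3" for t
  proof -
    have "(\<Sum>u=1..n. (\<integral>\<omega>. Z t \<omega> * Z u \<omega> \<partial>M))
        = (\<Sum>u\<in>{1..n} \<inter> {t, t + k, t - k}. (\<integral>\<omega>. Z t \<omega> * Z u \<omega> \<partial>M))"
      by (intro sum.mono_neutral_right) (auto intro!: orth)
    also have "\<dots> \<le> (\<Sum>u\<in>{1..n} \<inter> {t, t + k, t - k}. 1)"
      by (intro sum_mono le1)
    also have "\<dots> \<le> real (card {t, t + k, t - k})"
      by (simp add: card_mono)
    also have "\<dots> \<le> 3"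
      using card_length[of "[t, t + k, t - k]"] by simp
    finally show ?thesis .
  qed
  have "(\<integral>\<omega>. ((1 / real n) * (\<Sum>t=1..n. Z t \<omega>))\<^sup>2 \<partial>M)
      = (\<integral>\<omega>. (1 / (real n)\<^sup>2) * (\<Sum>t=1..n. \<Sum>u=1..n. Z t \<omega> * Z u \<omega>) \<partial>M)"
    by (simp add: power2_eq_square sum_product)
  also have "\<dots> = (1 / (real n)\<^sup>2) * (\<Sum>t=1..n. \<Sum>u=1..n. (\<integral>\<omega>. Z t \<omega> * Z u \<omega> \<partial>M))"
    by (simp add: int Bochner_Integration.integral_sum)
  also have "\<dots> \<le> (1 / (real n)\<^sup>2) * (\<Sum>t=1..n. 3)"
    by (intro mult_left_mono sum_mono row) auto
  also have "\<dots> = 3 / real n" using n by (simp add: power2_eq_square)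
  finally show ?thesis .
qed

section \<open>Distribution functions under weak convergence\<close>

text \<open>
  Testing the Levy-Prohorov metric on half-lines gives the Levy inequalities
  \<open>cdf \<kappa> (x - e) - e \<le> cdf \<nu> x \<le> cdf \<kappa> (x + e) + e\<close>.
\<close>

lemma levy_prohorov_less_imp_cdf_bounds:
  assumes \<nu>: "real_distribution \<nu>" and \<kappa>: "real_distribution \<kappa>" and less: "levy_prohorov \<nu> \<kappa> < e"
  shows "\<bar>cdf \<nu> x - cdf \<kappa> x\<bar> \<le> (cdf \<kappa> (x + e) - cdf \<kappa> (x - e)) + e"
proof -
  interpret N: real_distribution \<nu> by fact
  interpret K: real_distribution \<kappa> by fact
  let ?S = "{e. 0 < e \<and> (\<forall>A\<in>sets borel.
      measure \<nu> A \<le> measure \<kappa> (\<Union>a\<in>A. ball a e) + e \<and>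
      measure \<kappa> A \<le> measure \<nu> (\<Union>a\<in>A. ball a e) + e)}"
  \<comment> \<open>The defining set is nonempty, so its infimum is approached by elements below \<open>e\<close>.\<close>
  have "1 \<in> ?S" by (auto intro!: add_increasing)
  then obtain d where d: "d \<in> ?S" "d < e"
    using cInf_lessD[of ?S e] less unfolding levy_prohorov_def by blast
  have d0: "0 < d" using d by simp
  have sub: "(\<Union>a\<in>{..y}. ball a d) \<subseteq> {..y + e}" for y
    using d(2) by (auto simp: dist_real_def)
  have U: "(\<Union>a\<in>{..y}. ball a d) \<in> sets borel" for y :: real
    by (intro borel_open open_UN) auto
  have upper: "cdf \<nu> y \<le> cdf \<kappa> (y + e) + e" for y
  proof -
    have "measure \<nu> {..y} \<le> measure \<kappa> (\<Union>a\<in>{..y}. ball a d) + d" using d(1) by auto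
    also have "measure \<kappa> (\<Union>a\<in>{..y}. ball a d) \<le> measure \<kappa> {..y + e}"
      using sub by (intro K.finite_measure_mono) auto
    finally show ?thesis using d(2) by (simp add: cdf_def)
  qed
  have lower: "cdf \<kappa> y \<le> cdf \<nu> (y + e) + e" for y
  proof -
    have "measure \<kappa> {..y} \<le> measure \<nu> (\<Union>a\<in>{..y}. ball a d) + d" using d(1) by auto
    also have "measure \<nu> (\<Union>a\<in>{..y}. ball a d) \<le> measure \<nu> {..y + e}"
      using sub by (intro N.finite_measure_mono) auto
    finally show ?thesis using d(2) by (simp add: cdf_def)
  qed
  have "cdf \<kappa> (x - e) \<le> cdf \<kappa> x" "cdf \<kappa> x \<le> cdf \<kappa> (x + e)"
    using d0 d(2) by (auto intro!: K.cdf_nondecreasing)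
  then show ?thesis using upper[of x] lower[of "x - e"] by (simp add: abs_le_iff)
qed

lemma cdf_borel_measurable:
  assumes "real_distribution \<kappa>"
  shows "cdf \<kappa> \<in> borel_measurable borel"
proof -
  interpret real_distribution \<kappa> by fact
  show ?thesis by (intro borel_measurable_mono monoI cdf_nondecreasing)
qed

text \<open>
  The increments tend to zero at every continuity point of the distribution function, that is
  outside a countable set, which is null for a measure without atoms.
\<close>

lemma integral_cdf_increment_small:
  assumes \<kappa>: "real_distribution \<kappa>" and \<mu>: "finite_measure \<mu>" "sets \<mu> = sets borel"
    and atomless: "\<And>x. {x} \<in> null_sets \<mu>" and e: "0 < e"
  shows "\<exists>d>0. (\<integral>x. (cdf \<kappa> (x + d) - cdf \<kappa> (x - d)) + d \<partial>\<mu>) < e"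
proof -
  interpret K: real_distribution \<kappa> by fact
  interpret finite_measure \<mu> by fact
  note [measurable_cong] = \<mu>(2)
  note [measurable] = cdf_borel_measurable[OF \<kappa>]
  define r where "r n = 1 / real (Suc n)" for n
  have r: "r \<longlonglongrightarrow> 0" "0 < r n" "r n \<le> 1" for n
    using LIMSEQ_inverse_real_of_nat by (auto simp: r_def[abs_def] inverse_eq_divide)
  have "mono (cdf \<kappa>)" by (intro monoI K.cdf_nondecreasing)
  then have "countable {x. \<not> isCont (cdf \<kappa>) x}" by (rule mono_ctble_discont)
  then have "(\<Union>x\<in>{x. \<not> isCont (cdf \<kappa>) x}. {x}) \<in> null_sets \<mu>"
    using atomless by (intro null_sets_UN') auto
  then have cont: "AE x in \<mu>. isCont (cdf \<kappa>) x"
    by (intro AE_I'[of "{x. \<not> isCont (cdf \<kappa>) x}"]) auto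
  have "(\<lambda>n. \<integral>x. (cdf \<kappa> (x + r n) - cdf \<kappa> (x - r n)) + r n \<partial>\<mu>) \<longlonglongrightarrow> (\<integral>x. 0 \<partial>\<mu>)"
  proof (rule integral_dominated_convergence[where w="\<lambda>_. 3"])
    show "AE x in \<mu>. (\<lambda>n. (cdf \<kappa> (x + r n) - cdf \<kappa> (x - r n)) + r n) \<longlonglongrightarrow> 0"
      using cont
    proof eventually_elim
      case (elim x)
      have "(\<lambda>n. x + r n) \<longlonglongrightarrow> x" "(\<lambda>n. x - r n) \<longlonglongrightarrow> x"
        using tendsto_add[OF tendsto_const[of x] r(1)] tendsto_diff[OF tendsto_const[of x] r(1)] by simp_all
      then have "(\<lambda>n. (cdf \<kappa> (x + r n) - cdf \<kappa> (x - r n)) + r n) \<longlonglongrightarrow> (cdf \<kappa> x - cdf \<kappa> x) + 0"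
        by (intro tendsto_add tendsto_diff isCont_tendsto_compose[OF elim] r(1))
      then show ?case by simp
    qed
    show "AE x in \<mu>. norm ((cdf \<kappa> (x + r n) - cdf \<kappa> (x - r n)) + r n) \<le> 3" for n
    proof (rule AE_I2)
      fix x
      show "norm ((cdf \<kappa> (x + r n) - cdf \<kappa> (x - r n)) + r n) \<le> 3"
        using K.cdf_bounded_prob[of "x + r n"] K.cdf_bounded_prob[of "x - r n"]
          K.cdf_nonneg[of "x + r n"] K.cdf_nonneg[of "x - r n"] r(2,3)[of n]
        by (simp add: abs_le_iff)
    qed
  qed auto
  then have "(\<lambda>n. \<integral>x. (cdf \<kappa> (x + r n) - cdf \<kappa> (x - r n)) + r n \<partial>\<mu>) \<longlonglongrightarrow> 0" by simp
  from LIMSEQ_D[OF this e] obtain n where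
    "norm ((\<integral>x. (cdf \<kappa> (x + r n) - cdf \<kappa> (x - r n)) + r n \<partial>\<mu>) - 0) < e" by auto
  then show ?thesis using r(2) by (intro exI[of _ "r n"]) auto
qed

lemma tendsto_zero_in_prob_cdf_of_levy_prohorov:
  assumes \<nu>: "\<And>n \<omega>. 0 < n \<Longrightarrow> \<omega> \<in> space M \<Longrightarrow> real_distribution (\<nu> n \<omega>)"
    and \<kappa>: "real_distribution \<kappa>" and \<mu>: "finite_measure \<mu>" "sets \<mu> = sets borel"
    and atomless: "\<And>x. {x} \<in> null_sets \<mu>"
    and lp: "tendsto_zero_in_prob M (\<lambda>n \<omega>. levy_prohorov (\<nu> n \<omega>) \<kappa>)"
  shows "tendsto_zero_in_prob M (\<lambda>n \<omega>. \<integral>x. \<bar>cdf (\<nu> n \<omega>) x - cdf \<kappa> x\<bar> \<partial>\<mu>)"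
proof (rule tendsto_zero_in_prob_dominated[OF lp])
  interpret finite_measure \<mu> by fact
  interpret K: real_distribution \<kappa> by fact
  note [measurable_cong] = \<mu>(2)
  note [measurable] = cdf_borel_measurable[OF \<kappa>]
  fix e :: real assume "0 < e"
  then obtain d where d: "0 < d" "(\<integral>x. (cdf \<kappa> (x + d) - cdf \<kappa> (x - d)) + d \<partial>\<mu>) < e"
    using integral_cdf_increment_small[OF \<kappa> \<mu> atomless] by blast
  have "\<bar>\<integral>x. \<bar>cdf (\<nu> n \<omega>) x - cdf \<kappa> x\<bar> \<partial>\<mu>\<bar> < e"
    if n: "n \<ge> 1" "\<omega> \<in> space M" "\<bar>levy_prohorov (\<nu> n \<omega>) \<kappa>\<bar> < d" for n \<omega>
  proof -
    have R: "real_distribution (\<nu> n \<omega>)" using n by (intro \<nu>) auto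
    have *: "\<bar>cdf (\<nu> n \<omega>) x - cdf \<kappa> x\<bar> \<le> (cdf \<kappa> (x + d) - cdf \<kappa> (x - d)) + d" for x
      using n(3) by (intro levy_prohorov_less_imp_cdf_bounds R \<kappa>) auto
    have "integrable \<mu> (\<lambda>x. (cdf \<kappa> (x + d) - cdf \<kappa> (x - d)) + d)"
    proof (rule integrable_const_bound[where B="2 + d"])
      show "AE x in \<mu>. norm ((cdf \<kappa> (x + d) - cdf \<kappa> (x - d)) + d) \<le> 2 + d"
      proof (rule AE_I2)
        fix x
        show "norm ((cdf \<kappa> (x + d) - cdf \<kappa> (x - d)) + d) \<le> 2 + d"
          using K.cdf_bounded_prob[of "x + d"] K.cdf_bounded_prob[of "x - d"]
            K.cdf_nonneg[of "x + d"] K.cdf_nonneg[of "x - d"] d(1)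
          by (simp add: abs_le_iff)
      qed
    qed measurable
    then have "(\<integral>x. \<bar>cdf (\<nu> n \<omega>) x - cdf \<kappa> x\<bar> \<partial>\<mu>)
        \<le> (\<integral>x. (cdf \<kappa> (x + d) - cdf \<kappa> (x - d)) + d \<partial>\<mu>)"
      using * order_trans[OF abs_ge_zero *] by (intro integral_mono') auto
    then show ?thesis using d(2) by simp
  qed
  then show "\<exists>d>0. \<exists>N. \<forall>n\<ge>N. \<forall>\<omega>\<in>space M. \<bar>levy_prohorov (\<nu> n \<omega>) \<kappa>\<bar> < d \<longrightarrow>
      \<bar>\<integral>x. \<bar>cdf (\<nu> n \<omega>) x - cdf \<kappa> x\<bar> \<partial>\<mu>\<bar> < e"
    using d(1) by (intro exI[of _ d] conjI exI[of _ 1]) auto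
qed

lemma mean_measure_real_distribution:
  assumes n: "0 < n" and \<nu>: "\<And>t. real_distribution (\<nu> t)"
  shows "real_distribution (mean_measure n \<nu>)"
    and "cdf (mean_measure n \<nu>) x = (1 / real n) * (\<Sum>t=1..n. cdf (\<nu> t) x)"
proof -
  have s: "sets (\<nu> t) = sets borel" for t
    using \<nu> by (simp add: real_distribution.events_eq_borel)
  have em: "emeasure (\<nu> t) B = ennreal (measure (\<nu> t) B)" for t B
  proof -
    interpret real_distribution "\<nu> t" by (rule \<nu>)
    show ?thesis by (rule emeasure_eq_measure)
  qed
  have E: "emeasure (mean_measure n \<nu>) B = ennreal ((1 / real n) * (\<Sum>t=1..n. measure (\<nu> t) B))"
    if "B \<in> sets borel" for B
  proof -
    have "emeasure (mean_measure n \<nu>) B = (\<Sum>t=1..n. ennreal (measure (\<nu> t) B)) / of_nat n"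
      using emeasure_mean_measure[OF n, of \<nu> B] s that em by simp
    also have "\<dots> = ennreal (\<Sum>t=1..n. measure (\<nu> t) B) / ennreal (real n)"
      by (simp add: sum_ennreal ennreal_of_nat_eq_real_of_nat)
    also have "\<dots> = ennreal ((\<Sum>t=1..n. measure (\<nu> t) B) / real n)"
      using n by (intro divide_ennreal) (auto intro: sum_nonneg)
    finally show ?thesis by simp
  qed
  have sm: "sets (mean_measure n \<nu>) = sets borel"
    unfolding mean_measure_def using sets.sigma_sets_eq[of borel] by simp
  have sp: "space (mean_measure n \<nu>) = UNIV" using sets_eq_imp_space_eq[OF sm] by simp
  have "measure (\<nu> t) UNIV = 1" for t
  proof -
    interpret real_distribution "\<nu> t" by (rule \<nu>)
    show ?thesis using prob_space by simp
  qed
  then have "emeasure (mean_measure n \<nu>) UNIV = 1" using n E[of UNIV] by simp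
  then show "real_distribution (mean_measure n \<nu>)"
    using sm sp by (auto simp: real_distribution_def real_distribution_axioms_def intro!: prob_spaceI)
  show "cdf (mean_measure n \<nu>) x = (1 / real n) * (\<Sum>t=1..n. cdf (\<nu> t) x)"
    using E[of "{..x}"] by (simp add: cdf_def measure_def[of "mean_measure n \<nu>"] sum_nonneg)
qed

lemma is_diffraction_atomless:
  assumes "is_diffraction M \<xi> \<mu>"
  shows "{x} \<in> null_sets \<mu>"
proof -
  obtain I where I: "is_interval I" "absolutely_continuous (density lborel (indicator I)) \<mu>"
    using assms unfolding is_diffraction_def by blast
  have [measurable]: "I \<in> sets borel"
    using I(1) by (rule real_interval_borel_measurable)
  have "{x} \<in> null_sets (density lborel (indicator I))"
  proof (subst null_sets_density_iff, safe)
    show "AE y in lborel. y \<in> {x} \<longrightarrow> (indicator I y :: ennreal) = 0"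
      using AE_lborel_singleton[of x] by eventually_elim simp
  qed auto
  then show ?thesis using I(2) by (auto simp: absolutely_continuous_def)
qed

context random_distributions
begin

lemma baricenter_real_distribution: "real_distribution (baricenter M (\<xi> t))"
  and cdf_baricenter: "cdf (baricenter M (\<xi> t)) x = (\<integral>\<omega>. F t \<omega> x \<partial>M)"
proof -
  have m: "\<xi> t \<in> measurable M (subprob_algebra borel)"
    by (rule measurable_prob_algebraD) measurable
  have eq: "baricenter M (\<xi> t) = M \<bind> \<xi> t"
    by (rule baricenter_eq_bind) (unfold_locales, measurable)
  have sb: "sets (M \<bind> \<xi> t) = sets borel"
    by (rule sets_bind[OF sets_kernel[OF m] not_empty])
  have "prob_space (M \<bind> \<xi> t)"
    using \<xi>_real_distribution by (intro prob_space_bind[OF _ m] AE_I2) (auto simp: real_distribution_def)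
  then show "real_distribution (baricenter M (\<xi> t))"
    unfolding eq real_distribution_def real_distribution_axioms_def
    using sb sets_eq_imp_space_eq[OF sb] by simp
  show "cdf (baricenter M (\<xi> t)) x = (\<integral>\<omega>. F t \<omega> x \<partial>M)"
    unfolding eq cdf_def by (rule measure_bind[OF m]) simp
qed

lemma stationary_mean:
  assumes "strictly_stationary M (prob_algebra borel) \<xi>"
  shows "(\<integral>\<omega>. F k \<omega> x \<partial>M) = (\<integral>\<omega>. F 0 \<omega> x \<partial>M)"
proof -
  let ?N = "prob_algebra (borel :: real measure)"
  have "distr M (PiM UNIV (\<lambda>_. ?N)) (\<lambda>\<omega> t. \<xi> (t + k) \<omega>) = distr M (PiM UNIV (\<lambda>_. ?N)) (\<lambda>\<omega> t. \<xi> t \<omega>)"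
    using assms by (simp add: strictly_stationary_def)
  then have "distr (distr M (PiM UNIV (\<lambda>_. ?N)) (\<lambda>\<omega> t. \<xi> (t + k) \<omega>)) ?N (\<lambda>f. f 0)
      = distr (distr M (PiM UNIV (\<lambda>_. ?N)) (\<lambda>\<omega> t. \<xi> t \<omega>)) ?N (\<lambda>f. f 0)" by simp
  moreover have "(\<lambda>\<omega> t. \<xi> (t + h) \<omega>) \<in> measurable M (PiM UNIV (\<lambda>_. ?N))" for h
    by (rule measurable_PiM_single') (use measurable_space[OF \<xi>_measurable] in auto)
  from this this[of 0] have "(\<lambda>\<omega> t. \<xi> (t + h) \<omega>) \<in> measurable M (PiM UNIV (\<lambda>_. ?N))"
    "(\<lambda>\<omega> t. \<xi> t \<omega>) \<in> measurable M (PiM UNIV (\<lambda>_. ?N))" for h by simp_all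
  ultimately have d: "distr M ?N (\<xi> k) = distr M ?N (\<xi> 0)"
    by (simp add: distr_distr o_def)
  have "(\<lambda>(\<nu>, x). cdf \<nu> x) \<in> borel_measurable (?N \<Otimes>\<^sub>M borel)"
    using cdf_joint_measurable[of "\<lambda>\<nu>. \<nu>" ?N] by simp
  from measurable_compose[OF _ this, of "\<lambda>\<nu>. (\<nu>, x)" ?N] have "(\<lambda>\<nu>. cdf \<nu> x) \<in> borel_measurable ?N"
    by simp
  then have "(\<integral>\<omega>. F t \<omega> x \<partial>M) = (\<integral>\<nu>. cdf \<nu> x \<partial>distr M ?N (\<xi> t))" for t
    by (intro integral_distr[symmetric]) auto
  then show ?thesis by (simp add: d)
qed

lemma cov_kernel_eq:
  assumes "strictly_stationary M (prob_algebra borel) \<xi>"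
  shows "cov_kernel M \<xi> k x y
    = (\<integral>\<omega>. F 0 \<omega> x * F k \<omega> y \<partial>M) - (\<integral>\<omega>. F 0 \<omega> x \<partial>M) * (\<integral>\<omega>. F 0 \<omega> y \<partial>M)"
proof -
  define a where "a = (\<integral>\<omega>. F 0 \<omega> x \<partial>M)"
  define b where "b = (\<integral>\<omega>. F 0 \<omega> y \<partial>M)"
  have i: "integrable M (F' t)" if "F' = (\<lambda>t \<omega>. F t \<omega> z)" for F' z t
    using F_bounds unfolding that by (intro integrable_const_bound[where B=1]) (auto simp: abs_of_nonneg)
  have i1: "integrable M (\<lambda>\<omega>. F t \<omega> z)" for t z using i by blast
  have i2: "integrable M (\<lambda>\<omega>. F 0 \<omega> x * F k \<omega> y)"
    using F_bounds by (intro integrable_const_bound[where B=1]) (auto simp: abs_of_nonneg mult_le_one)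
  have bk: "(\<integral>\<omega>. F k \<omega> y \<partial>M) = b" unfolding b_def by (rule stationary_mean[OF assms])
  have "cov_kernel M \<xi> k x y = (\<integral>\<omega>. F 0 \<omega> x * F k \<omega> y - b * F 0 \<omega> x - a * F k \<omega> y + a * b \<partial>M)"
    unfolding cov_kernel_def covariance_def bk a_def[symmetric] by (simp add: algebra_simps)
  also have "\<dots> = (\<integral>\<omega>. F 0 \<omega> x * F k \<omega> y \<partial>M) - b * a - a * b + a * b"
    using i1 i2 by (simp add: bk a_def prob_space)
  finally show ?thesis by (simp add: a_def b_def)
qed

end

section \<open>Consistency of the empirical lag operator\<close>

text \<open>
  The average over \<open>N\<close> of \<open>n\<close> terms in \<open>[0, 1]\<close> differs little from the average over all of them.
\<close>

lemma subset_average_close: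
  fixes c :: "nat \<Rightarrow> real"
  assumes A: "A \<subseteq> {1..n}" "card A = N" "0 < N" and c: "\<And>t. 0 \<le> c t" "\<And>t. c t \<le> 1"
  shows "\<bar>(1 / real N) * (\<Sum>t\<in>A. c t) - (1 / real n) * (\<Sum>t=1..n. c t)\<bar> \<le> real (n - N) / real n"
proof -
  have fin: "finite A" using A(1) finite_subset by blast
  have Nn: "N \<le> n" using card_mono[OF _ A(1)] A(2) by simp
  have n: "0 < n" using A(3) Nn by simp
  define S where "S = (\<Sum>t\<in>A. c t)"
  define R where "R = (\<Sum>t\<in>{1..n} - A. c t)"
  have SR: "(\<Sum>t=1..n. c t) = R + S"
    unfolding S_def R_def by (rule sum.subset_diff[OF A(1)]) simp
  have S: "0 \<le> S" "S \<le> real N"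
    using c sum_bounded_above[of A c 1] A(2) by (auto simp: S_def intro!: sum_nonneg)
  have "card ({1..n} - A) = n - N" using A fin by (simp add: card_Diff_subset)
  then have R: "0 \<le> R" "R \<le> real (n - N)"
    using c sum_bounded_above[of "{1..n} - A" c 1] by (auto simp: R_def intro!: sum_nonneg)
  have "(1 / real N) * S - (1 / real n) * (R + S) = (S / real N) * (real (n - N) / real n) - R / real n"
    using A(3) n Nn by (simp add: field_simps of_nat_diff)
  moreover have "0 \<le> (S / real N) * (real (n - N) / real n)"
    using S by simp
  moreover have "(S / real N) * (real (n - N) / real n) \<le> 1 * (real (n - N) / real n)"
    using S A(3) by (intro mult_right_mono) auto
  moreover have "0 \<le> R / real n" "R / real n \<le> real (n - N) / real n"
    using R by (auto intro!: divide_right_mono)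
  ultimately show ?thesis unfolding S_def[symmetric] SR by (simp add: abs_le_iff)
qed

text \<open>
  Replacing the three averages over \<open>n - p\<close> terms in the expanded product by averages over \<open>n\<close>
  terms costs \<open>p / n\<close> each.
\<close>

lemma lagged_covariance_expansion:
  fixes a b :: "nat \<Rightarrow> real"
  assumes ab: "\<And>t. 0 \<le> a t" "\<And>t. a t \<le> 1" "\<And>t. 0 \<le> b t" "\<And>t. b t \<le> 1"
    and p: "p < n" and k: "k \<le> p"
  defines "ma \<equiv> (1 / real n) * (\<Sum>t=1..n. a t)" and "mb \<equiv> (1 / real n) * (\<Sum>t=1..n. b t)"
  shows "\<bar>(1 / real (n - p)) * (\<Sum>t=1..n - p. (a t - ma) * (b (t + k) - mb))
      - ((1 / real n) * (\<Sum>t=1..n. a t * b (t + k)) - ma * mb)\<bar> \<le> 3 * real p / real n"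
proof -
  define N where "N = n - p"
  have N: "0 < N" "n - N = p" using p by (auto simp: N_def)
  have n: "0 < n" using p by simp
  define A where "A = (1 / real N) * (\<Sum>t=1..N. a t)"
  define B where "B = (1 / real N) * (\<Sum>t=1..N. b (t + k))"
  define P where "P = (1 / real N) * (\<Sum>t=1..N. a t * b (t + k))"
  define Q where "Q = (1 / real n) * (\<Sum>t=1..n. a t * b (t + k))"
  have m01: "0 \<le> ma" "ma \<le> 1" "0 \<le> mb" "mb \<le> 1"
    using n ab sum_bounded_above[of "{1..n}" a 1] sum_bounded_above[of "{1..n}" b 1]
    by (auto simp: ma_def mb_def field_simps intro!: sum_nonneg)
  have sub: "{1..N} \<subseteq> {1..n}" by (auto simp: N_def)
  have dA: "\<bar>A - ma\<bar> \<le> real p / real n"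
    unfolding A_def ma_def using subset_average_close[OF sub _ N(1), of a] ab N(2) by simp
  have dB: "\<bar>B - mb\<bar> \<le> real p / real n"
  proof -
    have "(\<Sum>t=1..N. b (t + k)) = (\<Sum>t\<in>{1 + k..N + k}. b t)"
      using sum.shift_bounds_cl_nat_ivl[of b 1 k N] by simp
    moreover have "{1 + k..N + k} \<subseteq> {1..n}" using k p by (auto simp: N_def)
    ultimately show ?thesis
      unfolding B_def mb_def using subset_average_close[of "{1 + k..N + k}" n N b] N ab by simp
  qed
  have dP: "\<bar>P - Q\<bar> \<le> real p / real n"
    unfolding P_def Q_def
    using subset_average_close[OF sub _ N(1), of "\<lambda>t. a t * b (t + k)"] ab N(2)
    by (simp add: mult_le_one)
  have e0: "(\<Sum>t=1..N. (a t - ma) * (b (t + k) - mb))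
      = (\<Sum>t=1..N. a t * b (t + k)) - mb * (\<Sum>t=1..N. a t) - ma * (\<Sum>t=1..N. b (t + k)) + real N * (ma * mb)"
    by (simp add: algebra_simps sum.distrib sum_subtractf sum_distrib_left)
  have "(1 / real N) * (\<Sum>t=1..N. (a t - ma) * (b (t + k) - mb)) = P - mb * A - ma * B + ma * mb"
    unfolding e0 P_def A_def B_def using N(1) by (simp add: field_simps)
  then have "(1 / real N) * (\<Sum>t=1..N. (a t - ma) * (b (t + k) - mb)) - (Q - ma * mb)
      = (P - Q) - mb * (A - ma) - ma * (B - mb)"
    by (simp add: algebra_simps)
  moreover have "\<bar>mb * (A - ma)\<bar> \<le> real p / real n"
    using mult_mono[of mb 1 "\<bar>A - ma\<bar>" "real p / real n"] m01 dA by (simp add: abs_mult)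
  moreover have "\<bar>ma * (B - mb)\<bar> \<le> real p / real n"
    using mult_mono[of ma 1 "\<bar>B - mb\<bar>" "real p / real n"] m01 dB by (simp add: abs_mult)
  ultimately have "\<bar>(1 / real N) * (\<Sum>t=1..N. (a t - ma) * (b (t + k) - mb)) - (Q - ma * mb)\<bar>
      \<le> 3 * (real p / real n)"
    using dP by linarith
  then show ?thesis by (simp add: N_def Q_def)
qed

text \<open>
  The complete setting: a stationary sequence of random distributions, a sampled conjugate process
  and a diffraction \<open>\<mu>\<close>. \<open>Ch\<close> and \<open>C\<close> are the empirical and the true lag covariances, and \<open>mF\<close> is
  the overall empirical distribution function.
\<close>

locale sampled_diffraction = sampled_conjugate_process M \<xi> X q s
  for M :: "'a measure" and \<xi> X q s +
  fixes \<mu> :: "real measure" and p :: nat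
  assumes stationary: "strictly_stationary M (prob_algebra borel) \<xi>"
    and diffraction: "is_diffraction M \<xi> \<mu>"
begin

lemma sets_\<mu> [measurable_cong, simp]: "sets \<mu> = sets borel"
  using diffraction by (simp add: is_diffraction_def)

sublocale \<mu>: finite_measure \<mu>
  using diffraction by (simp add: is_diffraction_def)

sublocale \<mu>\<mu>: pair_sigma_finite \<mu> \<mu> ..

sublocale P: finite_measure "\<mu> \<Otimes>\<^sub>M \<mu>"
  by (rule finite_measure_pair_measure) unfold_locales

abbreviation Ch :: "nat \<Rightarrow> 'a \<Rightarrow> nat \<Rightarrow> real \<Rightarrow> real \<Rightarrow> real" where
  "Ch n \<omega> \<equiv> emp_cov X q s p n \<omega>"

abbreviation C :: "nat \<Rightarrow> real \<Rightarrow> real \<Rightarrow> real" where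
  "C \<equiv> cov_kernel M \<xi>"

abbreviation mF :: "nat \<Rightarrow> 'a \<Rightarrow> real \<Rightarrow> real" where
  "mF \<equiv> mean_emp_cdf X q s"

text \<open>
  The mean distribution function, that is the distribution function of the barycentre of \<open>\<xi> 0\<close>.
\<close>

definition EF :: "real \<Rightarrow> real" where
  "EF x = (\<integral>\<omega>. F 0 \<omega> x \<partial>M)"

text \<open>
  The mean product of the random distribution functions at lag \<open>k\<close>.
\<close>

definition EFF :: "nat \<Rightarrow> real \<Rightarrow> real \<Rightarrow> real" where
  "EFF k x y = (\<integral>\<omega>. F 0 \<omega> x * F k \<omega> y \<partial>M)"

text \<open>
  The sampling error of the averaged products of empirical distribution functions at lag \<open>k\<close>.
\<close>

definition pair_noise :: "nat \<Rightarrow> nat \<Rightarrow> 'a \<Rightarrow> real \<times> real \<Rightarrow> real" where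
  "pair_noise k n \<omega> z = (1 / real n) * (\<Sum>t=1..n.
      Fh t \<omega> (fst z) * Fh (t + k) \<omega> (snd z) - F t \<omega> (fst z) * F (t + k) \<omega> (snd z))"

text \<open>
  The sampling error of the averaged empirical distribution functions.
\<close>

definition noise :: "nat \<Rightarrow> 'a \<Rightarrow> real \<Rightarrow> real" where
  "noise n \<omega> x = (1 / real n) * (\<Sum>t=1..n. Fh t \<omega> x - F t \<omega> x)"

text \<open>
  The deviation of the averaged products of true distribution functions at lag \<open>k\<close> from their mean.
\<close>

definition pair_ergodic :: "nat \<Rightarrow> nat \<Rightarrow> 'a \<Rightarrow> real \<times> real \<Rightarrow> real" where
  "pair_ergodic k n \<omega> z = (1 / real n) * (\<Sum>t=1..n. F t \<omega> (fst z) * F (t + k) \<omega> (snd z))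
      - EFF k (fst z) (snd z)"

text \<open>
  The deviation of the averaged true distribution functions from their mean.
\<close>

definition ergodic :: "nat \<Rightarrow> 'a \<Rightarrow> real \<Rightarrow> real" where
  "ergodic n \<omega> x = (1 / real n) * (\<Sum>t=1..n. F t \<omega> x) - EF x"

lemma EF_bounds: "0 \<le> EF x" "EF x \<le> 1"
  and EFF_bounds: "0 \<le> EFF k x y" "EFF k x y \<le> 1"
proof -
  show "0 \<le> EF x" unfolding EF_def by (intro integral_nonneg_AE AE_I2 F_nonneg)
  show "0 \<le> EFF k x y" unfolding EFF_def
    by (intro integral_nonneg_AE AE_I2 mult_nonneg_nonneg F_nonneg)
  have "EF x \<le> (\<integral>\<omega>. 1 \<partial>M)" unfolding EF_def using F_bounds by (intro integral_mono') auto
  then show "EF x \<le> 1" by (simp add: prob_space)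
  have "EFF k x y \<le> (\<integral>\<omega>. 1 \<partial>M)"
    unfolding EFF_def using F_bounds by (intro integral_mono') (auto simp: mult_le_one)
  then show "EFF k x y \<le> 1" by (simp add: prob_space)
qed

lemma C_eq: "C k x y = EFF k x y - EF x * EF y"
  unfolding EFF_def EF_def by (rule cov_kernel_eq[OF stationary])

lemma mF_bounds: "0 \<le> mF n \<omega> x" "mF n \<omega> x \<le> 1"
proof -
  have "(\<Sum>t=1..n. Fh t \<omega> x) \<le> (\<Sum>t=1..n. 1)" by (intro sum_mono Fh_bounds)
  then show "mF n \<omega> x \<le> 1" by (cases "n = 0") (auto simp: mean_emp_cdf_def field_simps)
qed (simp add: mean_emp_cdf_def sum_nonneg Fh_bounds)

lemma EF_measurable [measurable]: "EF \<in> borel_measurable borel"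
  and EFF_measurable [measurable]: "(\<lambda>(x, y). EFF k x y) \<in> borel_measurable (\<mu> \<Otimes>\<^sub>M \<mu>)"
proof -
  show "EF \<in> borel_measurable borel" unfolding EF_def by measurable
  show "(\<lambda>(x, y). EFF k x y) \<in> borel_measurable (\<mu> \<Otimes>\<^sub>M \<mu>)" unfolding EFF_def by measurable
qed

lemma F_section_measurable [measurable]: "\<omega> \<in> space M \<Longrightarrow> F t \<omega> \<in> borel_measurable borel"
  using cdf_borel_measurable[OF \<xi>_real_distribution] .

lemma Fh_section_measurable [measurable]: "\<omega> \<in> space M \<Longrightarrow> Fh t \<omega> \<in> borel_measurable borel"
  using measurable_Pair2[OF Fh_measurable_pair, of \<omega> t] by simp

lemma mF_section_measurable [measurable]: "\<omega> \<in> space M \<Longrightarrow> mF n \<omega> \<in> borel_measurable borel"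
  unfolding mean_emp_cdf_def by measurable

lemma bounded_lag_kernels_C: "bounded_lag_kernels \<mu> C"
proof
  show "(\<lambda>(x, y). C k x y) \<in> borel_measurable (\<mu> \<Otimes>\<^sub>M \<mu>)" for k
    unfolding C_eq by measurable
  show "\<bar>C k x y\<bar> \<le> 1" for k x y
    using EFF_bounds[of k x y] EF_bounds[of x] EF_bounds[of y] mult_le_one[of "EF x" "EF y"]
    unfolding C_eq by (simp add: abs_le_iff) (smt (verit) mult_nonneg_nonneg)
qed

lemma bounded_lag_kernels_Ch:
  assumes "\<omega> \<in> space M"
  shows "bounded_lag_kernels \<mu> (Ch n \<omega>)"
proof
  show "(\<lambda>(x, y). Ch n \<omega> k x y) \<in> borel_measurable (\<mu> \<Otimes>\<^sub>M \<mu>)" for k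
    using assms unfolding emp_cov_def by measurable
  have dev: "\<bar>Fh t \<omega> x - mF n \<omega> x\<bar> \<le> 1" for t x
    using Fh_bounds[of t \<omega> x] mF_bounds[of n \<omega> x] by (simp add: abs_le_iff)
  show "\<bar>Ch n \<omega> k x y\<bar> \<le> 1" for k x y
  proof -
    have "\<bar>(Fh t \<omega> x - mF n \<omega> x) * (Fh (t + k) \<omega> y - mF n \<omega> y)\<bar> \<le> 1" for t
      using mult_mono[OF dev[of t x] dev[of "t + k" y]] by (simp add: abs_mult)
    then have "\<bar>\<Sum>t=1..n - p. (Fh t \<omega> x - mF n \<omega> x) * (Fh (t + k) \<omega> y - mF n \<omega> y)\<bar>
        \<le> (\<Sum>t=1..n - p. 1)"
      by (intro order_trans[OF sum_abs sum_mono])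
    then show ?thesis
      by (cases "n - p = 0") (auto simp: emp_cov_def abs_mult field_simps)
  qed
qed

lemma noise_to_zero: "tendsto_zero_in_prob M (\<lambda>n \<omega>. \<integral>x. \<bar>noise n \<omega> x\<bar> \<partial>\<mu>)"
proof (rule tendsto_zero_in_prob_L1_of_second_moment[where c=1 and e="\<lambda>n. 3 / real n"])
  have Z1: "\<bar>Fh t \<omega> x - F t \<omega> x\<bar> \<le> 1" if "\<omega> \<in> space M" for t \<omega> x
    using F_bounds[OF that, of t x] Fh_bounds[of t \<omega> x] by (simp add: abs_le_iff)
  show "(\<lambda>(\<omega>, x). noise n \<omega> x) \<in> borel_measurable (M \<Otimes>\<^sub>M \<mu>)" for n
    unfolding noise_def by measurable
  show "\<bar>noise n \<omega> x\<bar> \<le> 1" if "\<omega> \<in> space M" for n \<omega> x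
  proof -
    have "\<bar>\<Sum>t=1..n. Fh t \<omega> x - F t \<omega> x\<bar> \<le> (\<Sum>t=1..n. 1)"
      by (intro order_trans[OF sum_abs sum_mono] Z1[OF that])
    then show ?thesis by (cases "n = 0") (auto simp: noise_def abs_mult field_simps)
  qed
  show "(\<integral>\<omega>. (noise n \<omega> x)\<^sup>2 \<partial>M) \<le> 3 / real n" for n x
  proof (cases "n = 0")
    case False
    then show ?thesis
      unfolding noise_def
    proof (intro second_moment_of_almost_orthogonal_mean[where k=0] Z1)
      fix t u :: nat assume "u \<noteq> t"
      then show "(\<integral>\<omega>. (Fh t \<omega> x - F t \<omega> x) * (Fh u \<omega> x - F u \<omega> x) \<partial>M) = 0"
        using centred_products_orthogonal[of "{t}" "{u}" "\<lambda>_. x"] by auto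
    qed auto
  qed (simp add: noise_def)
  show "(\<lambda>n. 3 / real n) \<longlonglongrightarrow> 0" by (rule lim_const_over_n)
qed unfold_locales

lemma pair_noise_to_zero:
  assumes k: "1 \<le> k"
  shows "tendsto_zero_in_prob M (\<lambda>n \<omega>. \<integral>z. \<bar>pair_noise k n \<omega> z\<bar> \<partial>(\<mu> \<Otimes>\<^sub>M \<mu>))"
proof (rule tendsto_zero_in_prob_L1_of_second_moment[where c=1 and e="\<lambda>n. 3 / real n"])
  let ?Z = "\<lambda>t \<omega> z. Fh t \<omega> (fst z) * Fh (t + k) \<omega> (snd z) - F t \<omega> (fst z) * F (t + k) \<omega> (snd z)"
  have Z1: "\<bar>?Z t \<omega> z\<bar> \<le> 1" if "\<omega> \<in> space M" for t \<omega> z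
  proof -
    have "0 \<le> Fh t \<omega> (fst z) * Fh (t + k) \<omega> (snd z)" "Fh t \<omega> (fst z) * Fh (t + k) \<omega> (snd z) \<le> 1"
      "0 \<le> F t \<omega> (fst z) * F (t + k) \<omega> (snd z)" "F t \<omega> (fst z) * F (t + k) \<omega> (snd z) \<le> 1"
      using F_bounds[OF that] Fh_bounds by (auto intro!: mult_le_one)
    then show ?thesis by (simp add: abs_le_iff)
  qed
  show "(\<lambda>(\<omega>, z). pair_noise k n \<omega> z) \<in> borel_measurable (M \<Otimes>\<^sub>M (\<mu> \<Otimes>\<^sub>M \<mu>))" for n
    unfolding pair_noise_def by measurable
  show "\<bar>pair_noise k n \<omega> z\<bar> \<le> 1" if "\<omega> \<in> space M" for n \<omega> z
  proof -
    have "\<bar>\<Sum>t=1..n. ?Z t \<omega> z\<bar> \<le> (\<Sum>t=1..n. 1)"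
      by (intro order_trans[OF sum_abs sum_mono] Z1[OF that])
    then show ?thesis by (cases "n = 0") (auto simp: pair_noise_def abs_mult field_simps)
  qed
  show "(\<integral>\<omega>. (pair_noise k n \<omega> z)\<^sup>2 \<partial>M) \<le> 3 / real n" for n z
  proof (cases "n = 0")
    case False
    then show ?thesis
      unfolding pair_noise_def
    proof (intro second_moment_of_almost_orthogonal_mean[where k=k] Z1)
      fix t u :: nat assume tu: "u \<noteq> t" "u \<noteq> t + k" "t \<noteq> u + k"
      have "(\<Prod>j\<in>{v, v + k}. f j (if j = t \<or> j = u then fst z else snd z)) = f v (fst z) * f (v + k) (snd z)"
        if "v = t \<or> v = u" for v and f :: "nat \<Rightarrow> real \<Rightarrow> real"
        using that tu k by auto
      then show "(\<integral>\<omega>. ?Z t \<omega> z * ?Z u \<omega> z \<partial>M) = 0"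
        using centred_products_orthogonal[of "{t, t + k}" "{u, u + k}"
            "\<lambda>j. if j = t \<or> j = u then fst z else snd z"] tu k
        by auto
    qed auto
  qed (simp add: pair_noise_def)
  show "(\<lambda>n. 3 / real n) \<longlonglongrightarrow> 0" by (rule lim_const_over_n)
qed unfold_locales

lemma ergodic_to_zero:
  assumes "tendsto_zero_in_prob M
    (\<lambda>n \<omega>. levy_prohorov (mean_measure n (\<lambda>t. \<xi> t \<omega>)) (baricenter M (\<xi> 0)))"
  shows "tendsto_zero_in_prob M (\<lambda>n \<omega>. \<integral>x. \<bar>ergodic n \<omega> x\<bar> \<partial>\<mu>)"
proof -
  have "tendsto_zero_in_prob M (\<lambda>n \<omega>.
      \<integral>x. \<bar>cdf (mean_measure n (\<lambda>t. \<xi> t \<omega>)) x - cdf (baricenter M (\<xi> 0)) x\<bar> \<partial>\<mu>)"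
    using assms
    by (intro tendsto_zero_in_prob_cdf_of_levy_prohorov mean_measure_real_distribution
        \<xi>_real_distribution baricenter_real_distribution is_diffraction_atomless[OF diffraction])
      (auto intro: \<mu>.finite_measure_axioms)
  then show ?thesis
  proof (rule tendsto_zero_in_prob_mono[where c=1 and N=1])
    fix n :: nat and \<omega> assume n: "1 \<le> n" and w: "\<omega> \<in> space M"
    have "ergodic n \<omega> x = cdf (mean_measure n (\<lambda>t. \<xi> t \<omega>)) x - cdf (baricenter M (\<xi> 0)) x" for x
      using n mean_measure_real_distribution(2)[of n "\<lambda>t. \<xi> t \<omega>" x] \<xi>_real_distribution[OF w]
      by (simp add: ergodic_def EF_def cdf_baricenter)
    then show "\<bar>\<integral>x. \<bar>ergodic n \<omega> x\<bar> \<partial>\<mu>\<bar> \<le> 1 *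
        \<bar>\<integral>x. \<bar>cdf (mean_measure n (\<lambda>t. \<xi> t \<omega>)) x - cdf (baricenter M (\<xi> 0)) x\<bar> \<partial>\<mu>\<bar>"
      by simp
  qed simp
qed

lemma Ch_error_le:
  assumes n: "p < n" and k: "k \<le> p" and w: "\<omega> \<in> space M"
  shows "\<bar>Ch n \<omega> k x y - C k x y\<bar> \<le> 3 * real p / real n + \<bar>pair_noise k n \<omega> (x, y)\<bar>
    + \<bar>pair_ergodic k n \<omega> (x, y)\<bar> + (\<bar>noise n \<omega> x\<bar> + \<bar>ergodic n \<omega> x\<bar>) + (\<bar>noise n \<omega> y\<bar> + \<bar>ergodic n \<omega> y\<bar>)"
proof -
  define U where "U = (1 / real n) * (\<Sum>t=1..n. Fh t \<omega> x * Fh (t + k) \<omega> y)"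
  define e where "e = Ch n \<omega> k x y - (U - mF n \<omega> x * mF n \<omega> y)"
  define d where "d = mF n \<omega> x * mF n \<omega> y - EF x * EF y"
  have e: "\<bar>e\<bar> \<le> 3 * real p / real n"
    unfolding e_def emp_cov_def mean_emp_cdf_def U_def
    by (rule lagged_covariance_expansion) (use n k Fh_bounds in auto)
  have U: "U - EFF k x y = pair_noise k n \<omega> (x, y) + pair_ergodic k n \<omega> (x, y)"
    by (simp add: U_def pair_noise_def pair_ergodic_def sum_subtractf right_diff_distrib)
  have dm: "\<bar>mF n \<omega> v - EF v\<bar> \<le> \<bar>noise n \<omega> v\<bar> + \<bar>ergodic n \<omega> v\<bar>" for v
  proof -
    have "mF n \<omega> v - EF v = noise n \<omega> v + ergodic n \<omega> v"
      by (simp add: mean_emp_cdf_def noise_def ergodic_def sum_subtractf right_diff_distrib)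
    then show ?thesis by (simp only: abs_triangle_ineq)
  qed
  have d: "\<bar>d\<bar> \<le> \<bar>mF n \<omega> x - EF x\<bar> + \<bar>mF n \<omega> y - EF y\<bar>"
  proof -
    have "d = (mF n \<omega> x - EF x) * mF n \<omega> y + EF x * (mF n \<omega> y - EF y)"
      by (simp add: d_def algebra_simps)
    moreover have "\<bar>(mF n \<omega> x - EF x) * mF n \<omega> y\<bar> \<le> \<bar>mF n \<omega> x - EF x\<bar>"
      using mult_left_mono[OF mF_bounds(2)[of n \<omega> y] abs_ge_zero[of "mF n \<omega> x - EF x"]]
        mF_bounds(1)[of n \<omega> y]
      by (simp add: abs_mult)
    moreover have "\<bar>EF x * (mF n \<omega> y - EF y)\<bar> \<le> \<bar>mF n \<omega> y - EF y\<bar>"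
      using mult_right_mono[OF EF_bounds(2)[of x] abs_ge_zero[of "mF n \<omega> y - EF y"]] EF_bounds(1)[of x]
      by (simp add: abs_mult)
    ultimately show ?thesis by linarith
  qed
  have "Ch n \<omega> k x y - C k x y = e + (U - EFF k x y) - d"
    by (simp add: e_def d_def C_eq)
  then have "\<bar>Ch n \<omega> k x y - C k x y\<bar>
      \<le> \<bar>e\<bar> + (\<bar>pair_noise k n \<omega> (x, y)\<bar> + \<bar>pair_ergodic k n \<omega> (x, y)\<bar>) + \<bar>d\<bar>"
    unfolding U by linarith
  moreover have "\<bar>d\<bar> \<le> (\<bar>noise n \<omega> x\<bar> + \<bar>ergodic n \<omega> x\<bar>) + (\<bar>noise n \<omega> y\<bar> + \<bar>ergodic n \<omega> y\<bar>)"
    by (rule order_trans[OF d add_mono[OF dm dm]])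
  ultimately show ?thesis
    unfolding add.assoc
    by (elim order_trans) (intro add_mono order_refl e, simp only: add.assoc)
qed

text \<open>
  Integrating the pointwise bound \<open>Ch_error_le\<close> over \<open>\<mu> \<otimes> \<mu>\<close>; the one-variable errors are collected
  in \<open>u\<close> and occur once for each coordinate.
\<close>

lemma emp_cov_consistent:
  assumes k: "k \<in> {1..p}"
    and lp: "tendsto_zero_in_prob M
      (\<lambda>n \<omega>. levy_prohorov (mean_measure n (\<lambda>t. \<xi> t \<omega>)) (baricenter M (\<xi> 0)))"
    and erg: "tendsto_zero_in_prob M (\<lambda>n \<omega>. L2_norm (\<mu> \<Otimes>\<^sub>M \<mu>) (\<lambda>(x, y).
      (1 / real n) * (\<Sum>t=1..n. F t \<omega> x * F (t + k) \<omega> y) - (\<integral>\<omega>'. F 0 \<omega>' x * F k \<omega>' y \<partial>M)))"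
  shows "tendsto_zero_in_prob M (\<lambda>n \<omega>. \<integral>z. \<bar>Ch n \<omega> k (fst z) (snd z) - C k (fst z) (snd z)\<bar> \<partial>(\<mu> \<Otimes>\<^sub>M \<mu>))"
proof -
  define m where "m = measure \<mu> (space \<mu>)"
  have m0: "0 \<le> m" by (simp add: m_def)
  define c where "c n = 3 * real p / real n * measure (\<mu> \<Otimes>\<^sub>M \<mu>) (space (\<mu> \<Otimes>\<^sub>M \<mu>))" for n
  define u where "u n \<omega> x = \<bar>noise n \<omega> x\<bar> + \<bar>ergodic n \<omega> x\<bar>" for n \<omega> x
  have c: "tendsto_zero_in_prob M (\<lambda>n \<omega>. c n)"
    unfolding c_def using tendsto_mult_right[OF lim_const_over_n[of "3 * real p"]]
    by (intro tendsto_zero_in_prob_const) simp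
  have noise_int: "integrable \<mu> (\<lambda>x. \<bar>noise n \<omega> x\<bar>)" and erg_int: "integrable \<mu> (\<lambda>x. \<bar>ergodic n \<omega> x\<bar>)"
    if w: "\<omega> \<in> space M" for n \<omega>
  proof -
    have N1: "\<bar>(1 / real n) * (\<Sum>t=1..n. F t \<omega> x)\<bar> \<le> 1" "\<bar>mF n \<omega> x\<bar> \<le> 1" "\<bar>EF x\<bar> \<le> 1" for x
    proof -
      have "\<bar>\<Sum>t=1..n. F t \<omega> x\<bar> \<le> (\<Sum>t=1..n. 1)"
        using F_bounds[OF w] by (intro order_trans[OF sum_abs sum_mono]) (simp add: abs_of_nonneg)
      then show "\<bar>(1 / real n) * (\<Sum>t=1..n. F t \<omega> x)\<bar> \<le> 1"
        by (cases "n = 0") (auto simp: abs_mult field_simps)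
    qed (use mF_bounds EF_bounds in \<open>auto simp: abs_of_nonneg\<close>)
    have noise_eq: "noise n \<omega> x = mF n \<omega> x - (1 / real n) * (\<Sum>t=1..n. F t \<omega> x)" for x
      by (simp add: mean_emp_cdf_def noise_def sum_subtractf right_diff_distrib)
    have "\<bar>noise n \<omega> x\<bar> \<le> 2" for x
      using noise_eq[of x] N1[of x] by linarith
    moreover have "\<bar>ergodic n \<omega> x\<bar> \<le> 2" for x
      using N1[of x] unfolding ergodic_def by linarith
    moreover have "noise n \<omega> \<in> borel_measurable \<mu>" "ergodic n \<omega> \<in> borel_measurable \<mu>"
      using w unfolding noise_def ergodic_def by measurable
    ultimately show "integrable \<mu> (\<lambda>x. \<bar>noise n \<omega> x\<bar>)" "integrable \<mu> (\<lambda>x. \<bar>ergodic n \<omega> x\<bar>)"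
      by (auto intro!: \<mu>.integrable_const_bound[where B=2])
  qed
  have u_int: "integrable \<mu> (u n \<omega>)" if "\<omega> \<in> space M" for n \<omega>
    unfolding u_def using that by (intro Bochner_Integration.integrable_add noise_int erg_int)
  have u0: "0 \<le> u n \<omega> x" for n \<omega> x by (simp add: u_def)
  have u_lim: "tendsto_zero_in_prob M (\<lambda>n \<omega>. \<integral>x. u n \<omega> x \<partial>\<mu>)"
  proof (rule tendsto_zero_in_prob_mono[where c=1 and N=0])
    show "tendsto_zero_in_prob M (\<lambda>n \<omega>. (\<integral>x. \<bar>noise n \<omega> x\<bar> \<partial>\<mu>) + (\<integral>x. \<bar>ergodic n \<omega> x\<bar> \<partial>\<mu>))"
      by (intro tendsto_zero_in_prob_add noise_to_zero ergodic_to_zero lp)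
    show "\<bar>\<integral>x. u n \<omega> x \<partial>\<mu>\<bar> \<le> 1 * \<bar>(\<integral>x. \<bar>noise n \<omega> x\<bar> \<partial>\<mu>) + (\<integral>x. \<bar>ergodic n \<omega> x\<bar> \<partial>\<mu>)\<bar>"
      if "\<omega> \<in> space M" for n \<omega>
      unfolding u_def using noise_int[OF that] erg_int[OF that] by simp
  qed simp
  have pe_L2: "pair_ergodic k n \<omega> \<in> L2 (\<mu> \<Otimes>\<^sub>M \<mu>)" and pn_int: "integrable (\<mu> \<Otimes>\<^sub>M \<mu>) (pair_noise k n \<omega>)"
    if w: "\<omega> \<in> space M" for n \<omega>
  proof -
    have S: "\<bar>(1 / real n) * (\<Sum>t=1..n. f t)\<bar> \<le> 1" if "\<And>t. 0 \<le> f t" "\<And>t. f t \<le> 1" for f :: "nat \<Rightarrow> real"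
    proof -
      have "\<bar>\<Sum>t=1..n. f t\<bar> \<le> (\<Sum>t=1..n. 1)"
        using that by (intro order_trans[OF sum_abs sum_mono]) (simp add: abs_of_nonneg)
      then show ?thesis by (cases "n = 0") (auto simp: abs_mult field_simps)
    qed
    have S1: "\<bar>(1 / real n) * (\<Sum>t=1..n. F t \<omega> (fst z) * F (t + k) \<omega> (snd z))\<bar> \<le> 1" for z
      using F_bounds[OF w] by (intro S) (auto intro!: mult_le_one)
    have S2: "\<bar>(1 / real n) * (\<Sum>t=1..n. Fh t \<omega> (fst z) * Fh (t + k) \<omega> (snd z))\<bar> \<le> 1" for z
      using Fh_bounds by (intro S) (auto intro!: mult_le_one)
    have "\<bar>pair_ergodic k n \<omega> z\<bar> \<le> 2" for z
      using S1[of z] EFF_bounds[of k "fst z" "snd z"] unfolding pair_ergodic_def by linarith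
    moreover have "pair_ergodic k n \<omega> \<in> borel_measurable (\<mu> \<Otimes>\<^sub>M \<mu>)"
      using w unfolding pair_ergodic_def by measurable
    ultimately show "pair_ergodic k n \<omega> \<in> L2 (\<mu> \<Otimes>\<^sub>M \<mu>)"
      by (intro L2_bounded[where B=2] P.finite_measure_axioms)
    have noise_eq: "pair_noise k n \<omega> z = (1 / real n) * (\<Sum>t=1..n. Fh t \<omega> (fst z) * Fh (t + k) \<omega> (snd z))
        - (1 / real n) * (\<Sum>t=1..n. F t \<omega> (fst z) * F (t + k) \<omega> (snd z))" for z
      by (simp add: pair_noise_def sum_subtractf right_diff_distrib)
    have "\<bar>pair_noise k n \<omega> z\<bar> \<le> 2" for z
      using noise_eq[of z] S1[of z] S2[of z] by linarith
    moreover have "pair_noise k n \<omega> \<in> borel_measurable (\<mu> \<Otimes>\<^sub>M \<mu>)"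
      using w unfolding pair_noise_def by measurable
    ultimately show "integrable (\<mu> \<Otimes>\<^sub>M \<mu>) (pair_noise k n \<omega>)"
      by (intro P.integrable_const_bound[where B=2]) auto
  qed
  have pe_lim: "tendsto_zero_in_prob M (\<lambda>n \<omega>. \<integral>z. \<bar>pair_ergodic k n \<omega> z\<bar> \<partial>(\<mu> \<Otimes>\<^sub>M \<mu>))"
  proof (rule tendsto_zero_in_prob_mono[OF erg, where N=0])
    fix n \<omega> assume w: "\<omega> \<in> space M"
    have "(\<lambda>(x, y). (1 / real n) * (\<Sum>t=1..n. F t \<omega> x * F (t + k) \<omega> y) - (\<integral>\<omega>'. F 0 \<omega>' x * F k \<omega>' y \<partial>M))
        = pair_ergodic k n \<omega>"
      by (simp add: pair_ergodic_def EFF_def fun_eq_iff)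
    then show "\<bar>\<integral>z. \<bar>pair_ergodic k n \<omega> z\<bar> \<partial>(\<mu> \<Otimes>\<^sub>M \<mu>)\<bar>
        \<le> sqrt (measure (\<mu> \<Otimes>\<^sub>M \<mu>) (space (\<mu> \<Otimes>\<^sub>M \<mu>))) * \<bar>L2_norm (\<mu> \<Otimes>\<^sub>M \<mu>) (\<lambda>(x, y).
        (1 / real n) * (\<Sum>t=1..n. F t \<omega> x * F (t + k) \<omega> y) - (\<integral>\<omega>'. F 0 \<omega>' x * F k \<omega>' y \<partial>M))\<bar>"
      using integral_abs_le_L2_norm[OF P.finite_measure_axioms pe_L2[OF w, of n]]
      by (simp add: mult.commute)
  qed simp
  have lim: "tendsto_zero_in_prob M (\<lambda>n \<omega>. c n + (\<integral>z. \<bar>pair_noise k n \<omega> z\<bar> \<partial>(\<mu> \<Otimes>\<^sub>M \<mu>))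
      + (\<integral>z. \<bar>pair_ergodic k n \<omega> z\<bar> \<partial>(\<mu> \<Otimes>\<^sub>M \<mu>)) + (2 * m) * (\<integral>x. u n \<omega> x \<partial>\<mu>))"
    using k m0
    by (intro tendsto_zero_in_prob_add c pair_noise_to_zero pe_lim tendsto_zero_in_prob_mono[OF u_lim, of "2 * m"])
      (auto simp: abs_mult)
  show ?thesis
  proof (rule tendsto_zero_in_prob_mono[OF lim, where c=1 and N="Suc p"])
    fix n \<omega> assume n: "Suc p \<le> n" and w: "\<omega> \<in> space M"
    have sf: "sigma_finite_measure \<mu>" by unfold_locales
    have i1: "integrable (\<mu> \<Otimes>\<^sub>M \<mu>) (\<lambda>z. u n \<omega> (fst z))" and i2: "integrable (\<mu> \<Otimes>\<^sub>M \<mu>) (\<lambda>z. u n \<omega> (snd z))"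
      using integrable_tensor[OF sf sf u_int[OF w], of "\<lambda>_. 1" n]
        integrable_tensor[OF sf sf _ u_int[OF w], of "\<lambda>_. 1" n]
      by (simp_all add: split_beta')
    have v1: "(\<integral>z. u n \<omega> (fst z) \<partial>(\<mu> \<Otimes>\<^sub>M \<mu>)) = m * (\<integral>x. u n \<omega> x \<partial>\<mu>)"
      and v2: "(\<integral>z. u n \<omega> (snd z) \<partial>(\<mu> \<Otimes>\<^sub>M \<mu>)) = m * (\<integral>x. u n \<omega> x \<partial>\<mu>)"
      using \<mu>\<mu>.integral_fst'[OF i1] \<mu>\<mu>.integral_fst'[OF i2] by (simp_all add: m_def)
    have ie: "integrable (\<mu> \<Otimes>\<^sub>M \<mu>) (\<lambda>z. \<bar>pair_ergodic k n \<omega> z\<bar>)"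
      "integrable (\<mu> \<Otimes>\<^sub>M \<mu>) (\<lambda>z. \<bar>pair_noise k n \<omega> z\<bar>)"
      using L2_imp_integrable[OF P.finite_measure_axioms pe_L2[OF w]] pn_int[OF w] by auto
    have "(\<integral>z. \<bar>Ch n \<omega> k (fst z) (snd z) - C k (fst z) (snd z)\<bar> \<partial>(\<mu> \<Otimes>\<^sub>M \<mu>))
        \<le> (\<integral>z. 3 * real p / real n + \<bar>pair_noise k n \<omega> z\<bar> + \<bar>pair_ergodic k n \<omega> z\<bar>
          + u n \<omega> (fst z) + u n \<omega> (snd z) \<partial>(\<mu> \<Otimes>\<^sub>M \<mu>))"
    proof (rule integral_mono')
      fix z
      show "\<bar>Ch n \<omega> k (fst z) (snd z) - C k (fst z) (snd z)\<bar>
          \<le> 3 * real p / real n + \<bar>pair_noise k n \<omega> z\<bar> + \<bar>pair_ergodic k n \<omega> z\<bar>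
          + u n \<omega> (fst z) + u n \<omega> (snd z)"
        using Ch_error_le[of n k \<omega> "fst z" "snd z"] n k w by (simp add: u_def)
      show "0 \<le> 3 * real p / real n + \<bar>pair_noise k n \<omega> z\<bar> + \<bar>pair_ergodic k n \<omega> z\<bar>
          + u n \<omega> (fst z) + u n \<omega> (snd z)"
        using u0 by simp
    qed (use ie i1 i2 in simp)
    also have "\<dots> = c n + (\<integral>z. \<bar>pair_noise k n \<omega> z\<bar> \<partial>(\<mu> \<Otimes>\<^sub>M \<mu>))
        + (\<integral>z. \<bar>pair_ergodic k n \<omega> z\<bar> \<partial>(\<mu> \<Otimes>\<^sub>M \<mu>)) + (2 * m) * (\<integral>x. u n \<omega> x \<partial>\<mu>)"
      using ie i1 i2 by (simp add: v1 v2 c_def)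
    finally show "\<bar>\<integral>z. \<bar>Ch n \<omega> k (fst z) (snd z) - C k (fst z) (snd z)\<bar> \<partial>(\<mu> \<Otimes>\<^sub>M \<mu>)\<bar>
        \<le> 1 * \<bar>c n + (\<integral>z. \<bar>pair_noise k n \<omega> z\<bar> \<partial>(\<mu> \<Otimes>\<^sub>M \<mu>))
        + (\<integral>z. \<bar>pair_ergodic k n \<omega> z\<bar> \<partial>(\<mu> \<Otimes>\<^sub>M \<mu>)) + (2 * m) * (\<integral>x. u n \<omega> x \<partial>\<mu>)\<bar>"
      by simp
  qed simp
qed

lemma lag_operator_consistent:
  assumes "\<And>k. k \<in> {1..p} \<Longrightarrow> tendsto_zero_in_prob M
    (\<lambda>n \<omega>. \<integral>z. \<bar>Ch n \<omega> k (fst z) (snd z) - C k (fst z) (snd z)\<bar> \<partial>(\<mu> \<Otimes>\<^sub>M \<mu>))"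
  shows "tendsto_zero_in_prob M
    (\<lambda>n \<omega>. HS_norm \<mu> (\<lambda>x y. lag_kernel \<mu> p (Ch n \<omega>) x y - lag_kernel \<mu> p C x y))"
proof -
  define S where "S n \<omega> = (\<Sum>k=1..p. \<integral>z. \<bar>Ch n \<omega> k (fst z) (snd z) - C k (fst z) (snd z)\<bar> \<partial>(\<mu> \<Otimes>\<^sub>M \<mu>))" for n \<omega>
  define b where "b = 4 * real p * (measure \<mu> (space \<mu>))\<^sup>2"
  have S: "tendsto_zero_in_prob M (\<lambda>n \<omega>. b * S n \<omega>)"
  proof (rule tendsto_zero_in_prob_mono[of _ S "\<bar>b\<bar>" 0])
    show "tendsto_zero_in_prob M S"
      unfolding S_def using assms by (rule tendsto_zero_in_prob_sum)
  qed (auto simp: abs_mult)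
  show ?thesis
  proof (rule tendsto_zero_in_prob_mono[OF tendsto_zero_in_prob_sqrt[OF S], where c=1 and N=0])
    fix n \<omega> assume w: "\<omega> \<in> space M"
    let ?H = "HS_norm \<mu> (\<lambda>x y. lag_kernel \<mu> p (Ch n \<omega>) x y - lag_kernel \<mu> p C x y)"
    have "?H\<^sup>2 \<le> b * S n \<omega>"
      unfolding b_def S_def
      using lag_kernel_HS_norm_le[OF bounded_lag_kernels_C bounded_lag_kernels_Ch[OF w]] .
    from real_sqrt_le_mono[OF this] show "\<bar>?H\<bar> \<le> 1 * \<bar>sqrt (b * S n \<omega>)\<bar>" by simp
  qed simp
qed

end

theorem theorem5:
  fixes M :: "'a measure"
    and \<xi> :: "nat \<Rightarrow> 'a \<Rightarrow> real measure"
    and X :: "real \<Rightarrow> 'a \<Rightarrow> real"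
    and \<mu> :: "real measure"
    and p :: nat
    and q :: "nat \<Rightarrow> nat"
    and s :: "nat \<Rightarrow> nat \<Rightarrow> real"
    and \<theta> :: "nat \<Rightarrow> real"
    and \<psi> :: "nat \<Rightarrow> real \<Rightarrow> real"
    and \<theta>h :: "nat \<Rightarrow> 'a \<Rightarrow> nat \<Rightarrow> real"
    and \<psi>h :: "nat \<Rightarrow> 'a \<Rightarrow> nat \<Rightarrow> real \<Rightarrow> real"
  defines "R \<equiv> lag_kernel \<mu> p (cov_kernel M \<xi>)"
    and "Rh \<equiv> \<lambda>n \<omega>. lag_kernel \<mu> p (emp_cov X q s p n \<omega>)"
  assumes "prob_space M"
    and "\<And>t. \<xi> t \<in> measurable M (prob_algebra borel)"
    and "strictly_stationary M (prob_algebra borel) \<xi>"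
    and "conjugate_process M \<xi> X"
    and "cyclic_independent M \<xi> X"
    and "is_diffraction M \<xi> \<mu>"
    and "p \<ge> 1"
    and "closure_range \<mu> R = closure_range \<mu> (cov_kernel M \<xi> 0)"
    and "\<And>t. q t \<ge> 1"
    and "\<And>t i. i \<in> {1..q t} \<Longrightarrow> s t i \<in> {real t..<real t + 1}"
    and "eigensystem \<mu> R \<theta> \<psi>"
    and "\<And>n \<omega>. p < n \<Longrightarrow> \<omega> \<in> space M \<Longrightarrow> eigensystem \<mu> (Rh n \<omega>) (\<theta>h n \<omega>) (\<psi>h n \<omega>)"
    and "\<And>n \<omega> j. p < n \<Longrightarrow> \<omega> \<in> space M \<Longrightarrow> \<theta> j > 0 \<Longrightarrow> L2_inner \<mu> (\<psi>h n \<omega> j) (\<psi> j) \<ge> 0"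
    and "tendsto_zero_in_prob M
           (\<lambda>n \<omega>. levy_prohorov (mean_measure n (\<lambda>t. \<xi> t \<omega>)) (baricenter M (\<xi> 0)))"
    and "\<And>k. k \<in> {1..p} \<Longrightarrow> tendsto_zero_in_prob M
           (\<lambda>n \<omega>. L2_norm (\<mu> \<Otimes>\<^sub>M \<mu>) (\<lambda>(x, y).
              (1 / real n) * (\<Sum>t=1..n. cdf (\<xi> t \<omega>) x * cdf (\<xi> (t + k) \<omega>) y)
              - (\<integral>\<omega>'. cdf (\<xi> 0 \<omega>') x * cdf (\<xi> k \<omega>') y \<partial>M)))"
  shows "tendsto_zero_in_prob M (\<lambda>n \<omega>. HS_norm \<mu> (\<lambda>x y. Rh n \<omega> x y - R x y)) \<and>
    tendsto_zero_in_prob M (\<lambda>n \<omega>. SUP j. \<bar>\<theta>h n \<omega> j - \<theta> j\<bar>) \<and>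
    (inj_on \<theta> {j. \<theta> j \<noteq> 0} \<longrightarrow>
      (\<forall>j. \<theta> j > 0 \<longrightarrow> tendsto_zero_in_prob M (\<lambda>n \<omega>. L2_norm \<mu> (\<lambda>x. \<psi>h n \<omega> j x - \<psi> j x))))"
proof -
  interpret prob_space M by fact
  interpret S: sampled_diffraction M \<xi> X q s \<mu> p
  proof
    show "\<xi> t \<in> measurable M (prob_algebra borel)" for t by fact
    show "conjugate_process M \<xi> X" "cyclic_independent M \<xi> X" by fact+
    show "q t \<ge> 1" for t by fact
    show "s t i \<in> {real t..<real t + 1}" if "i \<in> {1..q t}" for t i using that by fact
    show "strictly_stationary M (prob_algebra borel) \<xi>" "is_diffraction M \<xi> \<mu>" by fact+
  qed
  interpret C: bounded_lag_kernels \<mu> S.C p by (rule S.bounded_lag_kernels_C)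
  have R: "psd_eigensystem \<mu> R (real p * measure \<mu> (space \<mu>)) \<theta> \<psi>"
    using assms(13) unfolding R_def by (rule C.lag_kernel_psd_eigensystem)
  have Rh: "psd_eigensystem \<mu> (Rh n \<omega>) (real p * measure \<mu> (space \<mu>)) (\<theta>h n \<omega>) (\<psi>h n \<omega>)"
    if "p < n" "\<omega> \<in> space M" for n \<omega>
    using assms(14)[OF that] unfolding Rh_def
    by (rule bounded_lag_kernels.lag_kernel_psd_eigensystem[OF S.bounded_lag_kernels_Ch[OF that(2)]])
  define H where "H n \<omega> = HS_norm \<mu> (\<lambda>x y. Rh n \<omega> x y - R x y)" for n \<omega>
  have H0: "0 \<le> H n \<omega>" for n \<omega> by (simp add: H_def HS_norm_def)
  have H: "tendsto_zero_in_prob M H"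
    unfolding H_def R_def Rh_def
    by (intro S.lag_operator_consistent S.emp_cov_consistent assms(16,17))
  have "tendsto_zero_in_prob M (\<lambda>n \<omega>. SUP j. \<bar>\<theta>h n \<omega> j - \<theta> j\<bar>)"
  proof (rule tendsto_zero_in_prob_mono[OF H, where c=1 and N="Suc p"])
    fix n \<omega> assume "Suc p \<le> n" "\<omega> \<in> space M"
    then have le: "\<bar>\<theta>h n \<omega> j - \<theta> j\<bar> \<le> H n \<omega>" for j
      unfolding H_def by (intro eigenvalue_perturbation[OF R Rh]) auto
    have "(SUP j. \<bar>\<theta>h n \<omega> j - \<theta> j\<bar>) \<le> H n \<omega>"
      using le by (intro cSUP_least) auto
    moreover have "0 \<le> (SUP j. \<bar>\<theta>h n \<omega> j - \<theta> j\<bar>)"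
      using le by (intro cSUP_upper2[where x="0 :: nat"]) (auto intro!: bdd_aboveI[of _ "H n \<omega>"])
    ultimately show "\<bar>SUP j. \<bar>\<theta>h n \<omega> j - \<theta> j\<bar>\<bar> \<le> 1 * \<bar>H n \<omega>\<bar>" by simp
  qed simp
  moreover have "tendsto_zero_in_prob M (\<lambda>n \<omega>. L2_norm \<mu> (\<lambda>x. \<psi>h n \<omega> j x - \<psi> j x))"
    if inj: "inj_on \<theta> {j. \<theta> j \<noteq> 0}" and j: "\<theta> j > 0" for j
  proof -
    interpret R: psd_eigensystem \<mu> R "real p * measure \<mu> (space \<mu>)" \<theta> \<psi> by (rule R)
    have ne: "\<theta> i \<noteq> \<theta> j" if "i \<noteq> j" for i
      using inj_onD[OF inj, of i j] that j by auto
    \<comment> \<open>The spectral gap around \<open>\<theta> j\<close>; by monotonicity the indices up to \<open>j + 1\<close> suffice.\<close>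
    define g where "g = Min ((\<lambda>i. \<bar>\<theta> i - \<theta> j\<bar>) ` ({..Suc j} - {j}))"
    have "g \<in> (\<lambda>i. \<bar>\<theta> i - \<theta> j\<bar>) ` ({..Suc j} - {j})"
      unfolding g_def by (rule Min_in) auto
    then obtain i where "g = \<bar>\<theta> i - \<theta> j\<bar>" "i \<noteq> j" by auto
    then have g: "0 < g" using ne by simp
    have g_le: "g \<le> \<bar>\<theta> i - \<theta> j\<bar>" if "i \<le> Suc j" "i \<noteq> j" for i
      unfolding g_def using that by (intro Min_le) auto
    have g_Suc: "g \<le> \<theta> j - \<theta> (Suc j)"
      using g_le[of "Suc j"] R.\<theta>_antimono[of j "Suc j"] by simp
    show ?thesis
    proof (rule tendsto_zero_in_prob_mono[OF H, where N="Suc p"])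
      fix n \<omega> assume n: "Suc p \<le> n" and w: "\<omega> \<in> space M"
      have "L2_norm \<mu> (\<lambda>x. \<psi>h n \<omega> j x - \<psi> j x) \<le> (8 * (real j + 1) / g) * H n \<omega>"
        unfolding H_def
      proof (rule eigenvector_perturbation[OF R Rh g _ g_Suc])
        show "0 \<le> L2_inner \<mu> (\<psi>h n \<omega> j) (\<psi> j)" using n w j by (intro assms(15)) auto
      qed (use n w g_le in auto)
      then show "\<bar>L2_norm \<mu> (\<lambda>x. \<psi>h n \<omega> j x - \<psi> j x)\<bar> \<le> (8 * (real j + 1) / g) * \<bar>H n \<omega>\<bar>"
        using H0[of n \<omega>] by simp
    qed (use g in simp)
  qed
  ultimately show ?thesis using H unfolding H_def by blast
qed

end
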